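(* Let $n\ge1$, let $\mathbb{I}=\{S_i\}_{i=1}^N$ be an affine IFS on $\mathbb{R}^n$ with affinity dimension $s\le n$, and let $C\subset\mathbb{R}^n$ be a non-empty compact condensation set such that the condensation open set condition (COSC) is satisfied. Let $X\subset\mathbb{R}^n$ be a compact ball with $S_i(X)\subset X$ for $i=1,\dots,N$ and $C\subseteq X$. Let $F_C$ be the inhomogeneous self-affine set of $\mathbb{I}$ with condensation set $C$. If $\underline{\dim}_{\mathrm{B}}C\ge n-1$ and there exists $\kappa>0$ such that for all $\delta\in(0,1]$ and all $\mathbf{i}\in\mathcal{I}_n(\delta)$ $$N_\delta(S_{\mathbf{i}}(C))\ \ge\ \kappa\, N_\delta(S_{\mathbf{i}}(X)),$$ then $$\overline{\dim}_{\mathrm{B}}F_C=\max\{s,\ \overline{\dim}_{\mathrm{B}}C\}$$ and $$\max\{s,\ \underline{\dim}_{\mathrm{B}}C\}\ \le\ \underline{\dim}_{\mathrm{B}}F_C\ \le\ \max\{s,\ \overline{\dim}_{\mathrm{B}}C\}.$$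
   Context: An affine IFS on $\mathbb{R}^n$ is a finite collection $\{S_i\}_{i=1}^N$ of affine maps $S_i(x)=A_ix+b_i$ with $A_i\in \mathrm{GL}(\mathbb{R},n)$, $b_i\in\mathbb{R}^n$, each contracting: there is $c\in(0,1)$ with $|S_i(x)-S_i(y)|\le c|x-y|$ for all $x,y$ (Euclidean norm). For compact $C\subset\mathbb{R}^n$, the inhomogeneous self-affine set $F_C$ with condensation set $C$ is the unique non-empty compact set with $F_C=\bigcup_{i=1}^N S_i(F_C)\cup C$. COSC: there exists an open set $U\subset\mathbb{R}^n$ with $C\subset U\setminus\bigcup_{i=1}^N\overline{S_i(U)}$, $S_i(U)\subset U$ for all $i$, and $S_i(U)\cap S_j(U)=\emptyset$ whenever $i\ne j$. Words: $\mathcal{I}=\{1,\dots,N\}$, $\mathcal{I}^*=\bigcup_{k\ge1}\mathcal{I}^k$, and for $\mathbf{i}=(i_1,\dots,i_k)\in\mathcal{I}^k$, $S_{\mathbf{i}}=S_{i_1}\circ\cdots\circ S_{i_k}$ and $\mathbf{i}_-=(i_1,\dots,i_{k-1})$ (for $k=1$ this is the empty word, whose map is the identity). For $A\in\mathrm{GL}(\mathbb{R},n)$ let $\alpha_1(A)\ge\dots\ge\alpha_n(A)>0$ be its singular values; for an affine map $S$ with linear part $A$ write $\alpha_j(S)=\alpha_j(A)$. For $\delta\in(0,1]$, $$\mathcal{I}_n(\delta)=\{\mathbf{i}\in\mathcal{I}^*:\ \alpha_n(S_{\mathbf{i}})<\delta\le\alpha_n(S_{\mathbf{i}_-})\}.$$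 Affinity dimension: for $0< t\le n$ put $\phi^t(A)=\alpha_1(A)\cdots\alpha_{m-1}(A)\,\alpha_m(A)^{t-m+1}$, where $m$ is the integer with $m-1<t\le m$; put $\phi^0(A)=1$ and $\phi^t(A)=|\det A|^{t/n}$ for $t>n$. For an affine map $S$ with linear part $A$, $\phi^t(S)=\phi^t(A)$. For $k\in\mathbb{N}$ let $s_k$ be the solution of $\sum_{\mathbf{i}\in\mathcal{I}^k}\phi^{s_k}(S_{\mathbf{i}})=1$. The limit $s=\lim_{k\to\infty}s_k$ exists and is called the affinity dimension of the IFS. Box dimensions: for non-empty bounded $F\subset\mathbb{R}^n$, $N_\delta(F)$ is the minimum number of hypercubes of sidelength $\delta$ needed to cover $F$; $\overline{\dim}_{\mathrm{B}}F$ and $\underline{\dim}_{\mathrm{B}}F$ are respectively the $\limsup$ and $\liminf$ as $\delta\to0$ of $\frac{\log N_\delta(F)}{-\log\delta}$. *)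

theory Defs
  imports "HOL-Analysis.Analysis"
begin

(* An IFS is a family S 1, ..., S N of self-maps of R^n = real^'n; only the values S i with
   i in {1..N} matter. *)

definition affine_IFS :: "nat \<Rightarrow> (nat \<Rightarrow> real^'n \<Rightarrow> real^'n) \<Rightarrow> bool" where
  "affine_IFS N S \<longleftrightarrow> N \<ge> 1 \<and>
     (\<forall>i\<in>{1..N}.
        (\<exists>A b. invertible A \<and> S i = (\<lambda>x. A *v x + b)) \<and>
        (\<exists>c\<in>{0<..<1}. \<forall>x y. norm (S i x - S i y) \<le> c * norm (x - y)))"

definition inhomogeneous_set ::
    "nat \<Rightarrow> (nat \<Rightarrow> real^'n \<Rightarrow> real^'n) \<Rightarrow> (real^'n) set \<Rightarrow> (real^'n) set" where
  "inhomogeneous_set N S C =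
     (THE F. F \<noteq> {} \<and> compact F \<and> F = (\<Union>i\<in>{1..N}. S i ` F) \<union> C)"

definition COSC :: "nat \<Rightarrow> (nat \<Rightarrow> real^'n \<Rightarrow> real^'n) \<Rightarrow> (real^'n) set \<Rightarrow> bool" where
  "COSC N S C \<longleftrightarrow> (\<exists>U. open U \<and>
     C \<subseteq> U - (\<Union>i\<in>{1..N}. closure (S i ` U)) \<and>
     (\<forall>i\<in>{1..N}. S i ` U \<subseteq> U) \<and>
     (\<forall>i\<in>{1..N}. \<forall>j\<in>{1..N}. i \<noteq> j \<longrightarrow> S i ` U \<inter> S j ` U = {}))"

definition words_of_length :: "nat \<Rightarrow> nat \<Rightarrow> nat list set" where
  "words_of_length N k = {w. length w = k \<and> set w \<subseteq> {1..N}}"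

definition words :: "nat \<Rightarrow> nat list set" where
  "words N = (\<Union>k\<in>{1..}. words_of_length N k)"

fun word_map :: "(nat \<Rightarrow> 'a \<Rightarrow> 'a) \<Rightarrow> nat list \<Rightarrow> 'a \<Rightarrow> 'a" where
  "word_map S [] = id"
| "word_map S (i # w) = S i \<circ> word_map S w"

definition linear_part :: "(real^'n \<Rightarrow> real^'n) \<Rightarrow> real^'n^'n" where
  "linear_part T = matrix (\<lambda>x. T x - T 0)"

(* The non-negative square roots of the eigenvalues of A^T A, counted with their multiplicity in
   the characteristic polynomial and listed in non-increasing order. *)
definition singular_values :: "real^'n^'n \<Rightarrow> real list" where
  "singular_values A =
     (THE xs. length xs = CARD('n) \<and> sorted_wrt (\<ge>) xs \<and> (\<forall>\<sigma>\<in>set xs. \<sigma> \<ge> 0) \<and>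
        (\<forall>x. det (mat x - transpose A ** A) = (\<Prod>\<sigma>\<leftarrow>xs. x - \<sigma>\<^sup>2)))"

(* Indexed from 1: singular_value 1 A is the largest, singular_value CARD('n) A the smallest. *)
definition singular_value :: "nat \<Rightarrow> real^'n^'n \<Rightarrow> real" where
  "singular_value j A = singular_values A ! (j - 1)"

definition stopping_words ::
    "nat \<Rightarrow> (nat \<Rightarrow> real^'n \<Rightarrow> real^'n) \<Rightarrow> real \<Rightarrow> nat list set" where
  "stopping_words N S \<delta> = {w \<in> words N.
     singular_value CARD('n) (linear_part (word_map S w)) < \<delta> \<and>
     \<delta> \<le> singular_value CARD('n) (linear_part (word_map S (butlast w)))}"

(* For 0 < t the integer m with m - 1 < t <= m is the ceiling of t.  Meaningful for t >= 0 only. *)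
definition sv_function :: "real \<Rightarrow> real^'n^'n \<Rightarrow> real" where
  "sv_function t A =
     (if t = 0 then 1
      else if t \<le> real CARD('n) then
        (let m = nat \<lceil>t\<rceil> in
          (\<Prod>j\<in>{1..<m}. singular_value j A) * singular_value m A powr (t - real m + 1))
      else \<bar>det A\<bar> powr (t / real CARD('n)))"

definition level_exponent :: "nat \<Rightarrow> (nat \<Rightarrow> real^'n \<Rightarrow> real^'n) \<Rightarrow> nat \<Rightarrow> real" where
  "level_exponent N S k = (THE t. 0 \<le> t \<and>
     (\<Sum>w\<in>words_of_length N k. sv_function t (linear_part (word_map S w))) = 1)"

(* The equation has no unique solution at k = 0; this term does not affect the limit. *)
definition affinity_dimension :: "nat \<Rightarrow> (nat \<Rightarrow> real^'n \<Rightarrow> real^'n) \<Rightarrow> real" where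
  "affinity_dimension N S = lim (\<lambda>k. level_exponent N S k)"

(* Hypercubes are taken closed and parallel to the coordinate axes. *)
definition hypercube :: "real \<Rightarrow> (real^'n) set \<Rightarrow> bool" where
  "hypercube \<delta> Q \<longleftrightarrow> (\<exists>a. Q = cbox a (a + (\<chi> i. \<delta>)))"

definition covering_number :: "real \<Rightarrow> (real^'n) set \<Rightarrow> nat" where
  "covering_number \<delta> F =
     (LEAST k. \<exists>\<Q>. finite \<Q> \<and> card \<Q> = k \<and> (\<forall>Q\<in>\<Q>. hypercube \<delta> Q) \<and> F \<subseteq> \<Union>\<Q>)"

definition upper_box_dim :: "(real^'n) set \<Rightarrow> ereal" where
  "upper_box_dim F =
     Limsup (at_right 0) (\<lambda>\<delta>. ereal (ln (real (covering_number \<delta> F)) / (- ln \<delta>)))"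

definition lower_box_dim :: "(real^'n) set \<Rightarrow> ereal" where
  "lower_box_dim F =
     Liminf (at_right 0) (\<lambda>\<delta>. ereal (ln (real (covering_number \<delta> F)) / (- ln \<delta>)))"

end

theory Submission
  imports Defs
begin

text \<open>
  Write \<alpha>_1 \<ge> \<dots> \<ge> \<alpha>_n > 0 for the singular values of an invertible matrix A and put
  M(A, d) = \<Prod>_j max 1 (\<alpha>_j / d), called \<open>ellipsoid_count\<close> below. The whole proof rests on two facts about M.
  First, up to factors that depend on n only, the image of a ball of radius r under an affine map with linear
  part A needs M(A, d / r) cubes of side d (\<open>covering_number_ellipsoid_le\<close>, \<open>covering_number_ellipsoid_ge\<close>).
  Secondly, for 0 \<le> t \<le> n the singular value function \<phi>^t(A) is the minimum of d^t M(A, d) over all d > 0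
  (\<open>sv_function_le_ellipsoid_count\<close>, \<open>sv_function_eq_ellipsoid_count\<close>). Covering in two stages shows that M is
  submultiplicative up to a constant, and the minimum inherits this: \<phi>^t(A B) \<le> K \<phi>^t(A) \<phi>^t(B)
  (\<open>sv_function_mult\<close>).

  From this inequality follows the cut set principle \<open>cut_set_bounds_partial_weight\<close>: if finitely many words Q
  contain a prefix of all but finitely many words and K \<Sum>_Q \<phi>^t < 1, then the sum of \<phi>^t over all words is finite.
  Applied to the words of length k, it shows that the solutions s_k of the level equations converge to the critical
  exponent of the series of \<phi>^t (\<open>level_exponent_tendsto\<close>). So the affinity dimension s has two properties: the
  series converges for t > s, and for 0 \<le> t < s every cut set has a \<phi>^t-sum of at least 1 / K.

  The fixed set F is the closure of the union of the images of C under all words, and it contains C.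

  Upper bound. F is bounded, so its upper dimension is at most n. Let max {s, upper dimension of C} < B \<le> n. Then
  B > n - 1, by the hypothesis on C. At scale d, the set F is covered by the images of C under the finitely many words with \<alpha>_n \<ge> d and the images of X under the stopping words.
  The covering number of each image is at most a constant times d^(-B) \<phi>^B, because B lies between n - 1 and n, and
  the series of \<phi>^B converges (\<open>upper_box_dim_orbit_le\<close>).

  Lower bound. Only s > n - 1 needs an argument, since F contains C and the lower dimension of C is at least
  n - 1. Let n - 1 \<le> t < s. By the condensation open set condition, the images of C under different stopping words at scale d have distance at least a multiple of d, so their
  covering numbers add up. By the hypothesis with \<kappa> they are comparable to those of the images of X, that is, at
  least a constant times d^(-t) \<phi>^t. The stopping words form a cut set, so the sum is at least a constant times d^(-t)
  (\<open>lower_box_dim_orbit_ge\<close>).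
\<close>

section \<open>Singular values\<close>

text \<open>
  A maximiser of the quadratic form T x \<bullet> x on the unit sphere of V is an eigenvector: the first variation
  in the direction w of the residual l v - T v would otherwise have a sign. The bound on the whole of V
  shows that eigenvalues chosen later in subspaces of V are at most l.
\<close>

lemma self_adjoint_max_eigenvector:
  fixes T :: "'a::euclidean_space \<Rightarrow> 'a"
  assumes lin: "linear T" and sym: "\<And>x y. T x \<bullet> y = x \<bullet> T y"
    and V: "subspace V" "T ` V \<subseteq> V" and nz: "V \<noteq> {0}"
  obtains v l where "v \<in> V" "norm v = 1" "T v = l *\<^sub>R v" "\<And>x. x \<in> V \<Longrightarrow> T x \<bullet> x \<le> l * (x \<bullet> x)"
proof -
  obtain y where y: "y \<in> V" "y \<noteq> 0" using nz V(1) subspace_0 by blast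
  let ?K = "sphere 0 1 \<inter> V"
  have "compact ?K" using closed_subspace[OF V(1)] by (simp add: compact_Int_closed)
  moreover have "y /\<^sub>R norm y \<in> ?K" using y V(1) by (auto simp: subspace_scale)
  hence "?K \<noteq> {}" by blast
  moreover have "continuous_on ?K (\<lambda>x. T x \<bullet> x)"
    by (intro continuous_intros linear_continuous_on linear_conv_bounded_linear[THEN iffD1] lin)
  ultimately obtain v where v: "v \<in> ?K" "\<And>x. x \<in> ?K \<Longrightarrow> T x \<bullet> x \<le> T v \<bullet> v"
    using continuous_attains_sup[of ?K "\<lambda>x. T x \<bullet> x"] by blast
  define l where "l = T v \<bullet> v"
  have max: "T x \<bullet> x \<le> l * (x \<bullet> x)" if "x \<in> V" for x
  proof (cases "x = 0")
    case False
    have "x /\<^sub>R norm x \<in> ?K" using False that V(1) by (auto simp: subspace_scale)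
    from v(2)[OF this] have "(T x \<bullet> x) / (norm x)\<^sup>2 \<le> l"
      unfolding l_def by (simp add: linear_scale[OF lin] power2_eq_square field_simps)
    thus ?thesis using False by (simp add: field_simps dot_square_norm)
  qed (simp add: linear_0[OF lin])
  have v1: "v \<in> V" "v \<bullet> v = 1" using v(1) by (auto simp: dot_square_norm)
  define w where "w = l *\<^sub>R v - T v"
  have wV: "w \<in> V" unfolding w_def using v1 V by (auto intro!: subspace_diff subspace_scale)
  define e where "e = l * (w \<bullet> w) - T w \<bullet> w"
  define d where "d = w \<bullet> w"
  have e0: "e \<ge> 0" using max[OF wV] by (simp add: e_def)
  have q: "0 \<le> 2 * t * d + t\<^sup>2 * e" for t
  proof -
    have "T (v + t *\<^sub>R w) \<bullet> (v + t *\<^sub>R w) \<le> l * ((v + t *\<^sub>R w) \<bullet> (v + t *\<^sub>R w))"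
      by (intro max subspace_add subspace_scale V v1 wV)
    moreover have "T w \<bullet> v = T v \<bullet> w" using sym[of w v] by (simp add: inner_commute)
    moreover have "d = l * (v \<bullet> w) - T v \<bullet> w" unfolding d_def
      by (subst (1) w_def) (simp add: inner_diff_left)
    hence "T v \<bullet> w = l * (v \<bullet> w) - d" by linarith
    ultimately have 1: "T (v + t *\<^sub>R w) \<bullet> (v + t *\<^sub>R w) \<le> l * ((v + t *\<^sub>R w) \<bullet> (v + t *\<^sub>R w))"
      "T w \<bullet> v = T v \<bullet> w" "T v \<bullet> w = l * (v \<bullet> w) - d" by blast+
    have "T (v + t *\<^sub>R w) \<bullet> (v + t *\<^sub>R w) = l + 2 * t * (l * (v \<bullet> w) - d) + t\<^sup>2 * (T w \<bullet> w)"
      using 1(2,3) by (simp add: linear_add[OF lin] linear_scale[OF lin] inner_add_left inner_add_right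
          l_def[symmetric] power2_eq_square ring_distribs)
    moreover have "l * ((v + t *\<^sub>R w) \<bullet> (v + t *\<^sub>R w)) = l + 2 * t * (l * (v \<bullet> w)) + t\<^sup>2 * (l * (w \<bullet> w))"
      by (simp add: inner_add_left inner_add_right v1 inner_commute[of w v] power2_eq_square algebra_simps)
    moreover have "t\<^sup>2 * e = t\<^sup>2 * (l * (w \<bullet> w)) - t\<^sup>2 * (T w \<bullet> w)"
      unfolding e_def by (simp add: algebra_simps)
    moreover have "2 * t * (l * (v \<bullet> w) - d) = 2 * t * (l * (v \<bullet> w)) - 2 * t * d" by (simp add: algebra_simps)
    ultimately show ?thesis using 1(1) by linarith
  qed
  \<comment> \<open>The quadratic 2 t d + t^2 e is non-negative for all t; t = - d / (1 + e) makes it negative unless d = 0.\<close>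
  define k where "k = d / (1 + e)"
  have k: "d = k * (1 + e)" using e0 by (simp add: k_def)
  have "2 * (- k) * d + (- k)\<^sup>2 * e = - (k\<^sup>2 * (2 + e))"
    unfolding k by (simp add: power2_eq_square algebra_simps)
  with q[of "- k"] have "k\<^sup>2 * (2 + e) \<le> 0" by linarith
  hence "k = 0" using e0 by (simp add: mult_le_0_iff)
  hence "d = 0" using k by simp
  hence "T v = l *\<^sub>R v" by (simp add: d_def w_def)
  thus thesis using that v1 max v(1) by auto
qed

text \<open>
  Split off a maximising eigenvector and continue in its orthogonal complement. Choosing maximisers
  makes the eigenvalues come out in non-increasing order, which is the order of the list of singular values.
\<close>

lemma self_adjoint_eigenbasis:
  fixes T :: "'a::euclidean_space \<Rightarrow> 'a"
  assumes lin: "linear T" and sym: "\<And>x y. T x \<bullet> y = x \<bullet> T y"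
    and "subspace V" "T ` V \<subseteq> V" "dim V = k"
  shows "\<exists>v l. (\<forall>i<k. v i \<in> V \<and> T (v i) = l i *\<^sub>R v i) \<and>
           (\<forall>i<k. \<forall>j<k. v i \<bullet> v j = (if i = j then 1 else 0)) \<and> (\<forall>i<k. \<forall>j\<le>i. l i \<le> (l j::real))"
  using assms(3-5)
proof (induction k arbitrary: V)
  case 0
  then show ?case by simp
next
  case (Suc k)
  have "V \<noteq> {0}" using Suc.prems(3) by auto
  then obtain v l where v: "v \<in> V" "norm v = 1" "T v = l *\<^sub>R v" "\<And>x. x \<in> V \<Longrightarrow> T x \<bullet> x \<le> l * (x \<bullet> x)"
    using self_adjoint_max_eigenvector[OF lin sym Suc.prems(1,2)] by metis
  define W where "W = {y \<in> V. \<forall>x\<in>span {v}. orthogonal x y}"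
  have W: "W = {y \<in> V. v \<bullet> y = 0}"
    unfolding W_def by (auto simp: span_singleton orthogonal_def)
  have "dim W + dim (span {v}) = dim V" unfolding W_def
    by (rule dim_subspace_orthogonal_to_vectors)
       (simp_all add: Suc.prems(1) v(1) span_minimal)
  moreover have "dim {v} = 1" using v(2) by auto
  ultimately have dW: "dim W = k" using Suc.prems(3) by simp
  have sW: "subspace W" unfolding W using Suc.prems(1)
    by (auto simp: subspace_def inner_add_right)
  have "v \<bullet> T y = 0" if "v \<bullet> y = 0" for y using sym[of v y] v(3) that by simp
  hence "T ` W \<subseteq> W" unfolding W using Suc.prems(2) by blast
  from Suc.IH[OF sW this dW] obtain v' l' where IH:
    "\<forall>i<k. v' i \<in> W \<and> T (v' i) = l' i *\<^sub>R v' i"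
    "\<forall>i<k. \<forall>j<k. v' i \<bullet> v' j = (if i = j then 1 else 0)" "\<forall>i<k. \<forall>j\<le>i. l' i \<le> (l' j::real)"
    by (elim exE conjE) (rule that; assumption)
  then have v':
    "\<And>i. i < k \<Longrightarrow> v' i \<in> W \<and> T (v' i) = l' i *\<^sub>R v' i"
    "\<And>i j. i < k \<Longrightarrow> j < k \<Longrightarrow> v' i \<bullet> v' j = (if i = j then 1 else 0)"
    "\<And>i j. i < k \<Longrightarrow> j \<le> i \<Longrightarrow> l' i \<le> (l' j::real)" by simp_all
  have le: "l' i \<le> l" if "i < k" for i
    using v'(1,2)[OF that] v(4)[of "v' i"] that by (auto simp: W)
  have vv: "v \<bullet> v = 1" using v(2) by (simp add: dot_square_norm)
  have ort: "v \<bullet> v' i = 0" "v' i \<bullet> v = 0" if "i < k" for i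
    using v'(1)[OF that] by (auto simp: W inner_commute)
  let ?v = "\<lambda>i. case i of 0 \<Rightarrow> v | Suc j \<Rightarrow> v' j" and ?l = "\<lambda>i. case i of 0 \<Rightarrow> l | Suc j \<Rightarrow> l' j"
  have all: "(\<forall>i<Suc k. P i) \<longleftrightarrow> P 0 \<and> (\<forall>i<k. P (Suc i))" for P
    by (rule All_less_Suc2)
  have "\<forall>i<Suc k. ?v i \<in> V \<and> T (?v i) = ?l i *\<^sub>R ?v i"
    unfolding all using v(1,3) v'(1) W by simp
  moreover have "\<forall>i<Suc k. \<forall>j<Suc k. ?v i \<bullet> ?v j = (if i = j then 1 else 0)"
    unfolding all using v'(2) ort vv by simp
  moreover have "\<forall>i<Suc k. \<forall>j\<le>i. ?l i \<le> ?l j"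
  proof (intro allI impI)
    show "?l i \<le> ?l j" if "i < Suc k" "j \<le> i" for i j
      using that v'(3) le by (cases i; cases j) auto
  qed
  ultimately show ?case by (intro exI[of _ ?v] exI[of _ ?l] conjI)
qed

definition orthonormal_frame :: "(nat \<Rightarrow> real^'n) \<Rightarrow> bool" where
  "orthonormal_frame v \<longleftrightarrow>
     (\<forall>i<CARD('n). \<forall>j<CARD('n). v i \<bullet> v j = (if i = j then 1 else 0))"

text \<open>
  The largest root of either product is the square of the head of its list, so the heads agree and can be
  cancelled.
\<close>

lemma sorted_roots_unique:
  fixes xs ys :: "real list"
  assumes "sorted_wrt (\<ge>) xs" "sorted_wrt (\<ge>) ys" "\<forall>x\<in>set xs. x \<ge> 0" "\<forall>x\<in>set ys. x \<ge> 0"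
    and "(\<Prod>a\<leftarrow>xs. [:-(a\<^sup>2), 1:]) = (\<Prod>a\<leftarrow>ys. [:-(a\<^sup>2), 1:])"
  shows "xs = ys"
  using assms
proof (induction xs arbitrary: ys)
  have root: "\<exists>b\<in>set zs. b\<^sup>2 = x" if "poly (\<Prod>a\<leftarrow>zs. [:-(a\<^sup>2), 1:]) x = 0" for zs and x :: real
    using that by (induction zs) auto
  have deg: "degree (\<Prod>a\<leftarrow>zs. [:-(a\<^sup>2), 1:]) = length zs" for zs :: "real list"
  proof (induction zs)
    case (Cons a zs)
    have "(\<Prod>a\<leftarrow>zs. [:-(a\<^sup>2), 1:]) \<noteq> (0::real poly)" by (auto simp: prod_list_zero_iff)
    then show ?case using Cons by (simp add: degree_mult_eq del: mult_pCons_left)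
  qed simp
  {
    case Nil
    then show ?case using deg[of ys] by simp
  next
    case (Cons a xs)
    have "ys \<noteq> []" using deg[of ys] deg[of "a # xs"] Cons.prems(5) by (metis length_0_conv list.distinct(1))
    then obtain b zs where ys: "ys = b # zs" by (cases ys) auto
    have "\<exists>c\<in>set (a # xs). c\<^sup>2 = b\<^sup>2" using Cons.prems(5) by (intro root) (simp add: ys)
    then have ba: "b \<le> a" using Cons.prems by (auto simp: ys power2_eq_iff_nonneg)
    have "poly (\<Prod>a\<leftarrow>ys. [:-(a\<^sup>2), 1:]) (a\<^sup>2) = 0" unfolding Cons.prems(5)[symmetric] by simp
    then have "\<exists>c\<in>set ys. c\<^sup>2 = a\<^sup>2" by (rule root)
    then have ab: "a \<le> b" using Cons.prems by (auto simp: ys power2_eq_iff_nonneg)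
    have e: "a = b" using ab ba by simp
    have "[:-(a\<^sup>2), 1:] * (\<Prod>a\<leftarrow>xs. [:-(a\<^sup>2), 1:]) = [:-(a\<^sup>2), 1:] * (\<Prod>a\<leftarrow>zs. [:-(a\<^sup>2), 1:])"
      using Cons.prems(5) by (simp add: ys e)
    then have "(\<Prod>a\<leftarrow>xs. [:-(a\<^sup>2), 1:]) = (\<Prod>a\<leftarrow>zs. [:-(a\<^sup>2), 1:])"
      by (subst (asm) mult_left_cancel) simp
    then show ?case using Cons.IH[of zs] Cons.prems by (simp add: ys e)
  }
qed

lemma singular_values_eqI:
  fixes A :: "real^'n^'n"
  assumes "length xs = CARD('n)" "sorted_wrt (\<ge>) xs" "\<forall>\<sigma>\<in>set xs. \<sigma> \<ge> 0"
    and "\<And>x. det (mat x - transpose A ** A) = (\<Prod>\<sigma>\<leftarrow>xs. x - \<sigma>\<^sup>2)"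
  shows "singular_values A = xs"
  unfolding singular_values_def
proof (rule the_equality)
  fix ys :: "real list"
  assume y: "length ys = CARD('n) \<and> sorted_wrt (\<ge>) ys \<and> (\<forall>\<sigma>\<in>set ys. \<sigma> \<ge> 0) \<and>
        (\<forall>x. det (mat x - transpose A ** A) = (\<Prod>\<sigma>\<leftarrow>ys. x - \<sigma>\<^sup>2))"
  have p: "poly (\<Prod>a\<leftarrow>zs. [:-(a\<^sup>2), 1:]) x = (\<Prod>\<sigma>\<leftarrow>zs. x - \<sigma>\<^sup>2)" for zs and x :: real
    by (induction zs) (auto simp: algebra_simps)
  have "(\<Prod>a\<leftarrow>ys. [:-(a\<^sup>2), 1:]) = (\<Prod>a\<leftarrow>xs. [:-(a\<^sup>2), 1:])"
    by (subst poly_eq_poly_eq_iff[symmetric]) (use y assms(4) in \<open>auto simp: fun_eq_iff p\<close>)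
  then show "ys = xs" using y assms by (intro sorted_roots_unique) auto
qed (use assms in auto)

text \<open>
  The matrix with columns \<open>v 0, v 1, \<dots>\<close>. Its columns are indexed by the type \<open>'n\<close>, so an enumeration
  of that type has to be chosen; determinants of two such matrices are only compared, so any choice will do.
\<close>

definition frame_matrix :: "(nat \<Rightarrow> real^'n) \<Rightarrow> real^'n^'n" where
  "frame_matrix v = (\<chi> i j. v ((SOME e. bij_betw e UNIV {..<CARD('n)}) j) $ i)"

lemma abs_det_frame_matrix:
  fixes v :: "nat \<Rightarrow> real^'n"
  assumes v: "orthonormal_frame v"
  shows "\<bar>det (frame_matrix v)\<bar> = 1"
proof -
  define e where "e = (SOME e :: 'n \<Rightarrow> nat. bij_betw e UNIV {..<CARD('n)})"
  have "\<exists>e :: 'n \<Rightarrow> nat. bij_betw e UNIV {..<CARD('n)}"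
    using ex_bij_betw_finite_nat[of "UNIV :: 'n set"] by (auto simp: atLeast0LessThan)
  hence e: "bij_betw e UNIV {..<CARD('n)}" unfolding e_def by (rule someI_ex)
  have e1: "e j < CARD('n)" for j using e by (auto simp: bij_betw_def)
  have e2: "e i = e j \<longleftrightarrow> i = j" for i j using e by (auto simp: bij_betw_def inj_def)
  have "transpose (frame_matrix v) ** frame_matrix v = mat 1"
    using v by (auto simp: vec_eq_iff matrix_matrix_mult_def transpose_def frame_matrix_def mat_def
        orthonormal_frame_def e_def[symmetric] e1 e2 inner_vec_def)
  hence "det (frame_matrix v) * det (frame_matrix v) = 1" by (metis det_I det_mul det_transpose)
  thus ?thesis by (metis abs_mult_self_eq abs_ge_zero abs_one mult_cancel_right1 power2_eq_1_iff power2_eq_square abs_neg_one)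
qed

lemma det_mult_frame_matrix:
  fixes M :: "real^'n^'n"
  assumes ev: "\<And>i. i < CARD('n) \<Longrightarrow> M *v v i = l i *\<^sub>R u i"
  shows "det M * det (frame_matrix v) = det (frame_matrix u) * (\<Prod>i<CARD('n). l i)"
proof -
  define e where "e = (SOME e :: 'n \<Rightarrow> nat. bij_betw e UNIV {..<CARD('n)})"
  have "\<exists>e :: 'n \<Rightarrow> nat. bij_betw e UNIV {..<CARD('n)}"
    using ex_bij_betw_finite_nat[of "UNIV :: 'n set"] by (auto simp: atLeast0LessThan)
  hence e: "bij_betw e UNIV {..<CARD('n)}" unfolding e_def by (rule someI_ex)
  have e1: "e j < CARD('n)" for j using e by (auto simp: bij_betw_def)
  define D :: "real^'n^'n" where "D = (\<chi> i j. if i = j then l (e j) else 0)"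
  have "(M ** frame_matrix v) $ i $ j = (frame_matrix u ** D) $ i $ j" for i j
  proof -
    have "(M ** frame_matrix v) $ i $ j = (M *v v (e j)) $ i"
      by (simp add: matrix_matrix_mult_def matrix_vector_mult_def frame_matrix_def e_def)
    also have "\<dots> = (l (e j) *\<^sub>R u (e j)) $ i" using ev[OF e1[of j]] by simp
    also have "\<dots> = (frame_matrix u ** D) $ i $ j"
      by (simp add: matrix_matrix_mult_def frame_matrix_def D_def e_def[symmetric] mult.commute
          if_distrib[where f="\<lambda>x. _ * x"] cong: if_cong)
    finally show ?thesis .
  qed
  hence "M ** frame_matrix v = frame_matrix u ** D" by (simp add: vec_eq_iff)
  hence "det M * det (frame_matrix v) = det (frame_matrix u) * det D" by (metis det_mul)
  also have "det D = (\<Prod>i\<in>UNIV. D $ i $ i)" by (rule det_diagonal) (simp add: D_def)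
  also have "\<dots> = (\<Prod>i\<in>UNIV. l (e i))" by (simp add: D_def)
  also have "\<dots> = (\<Prod>i<CARD('n). l i)" by (rule prod.reindex_bij_betw[OF e])
  finally show ?thesis .
qed

lemma det_eigenbasis:
  fixes M :: "real^'n^'n"
  assumes v: "orthonormal_frame v" and ev: "\<And>i. i < CARD('n) \<Longrightarrow> M *v v i = l i *\<^sub>R v i"
  shows "det (mat x - M) = (\<Prod>i<CARD('n). x - l i)"
proof -
  have "(mat x - M) *v v i = (x - l i) *\<^sub>R v i" if "i < CARD('n)" for i
    using ev[OF that] by (simp add: matrix_vector_mult_diff_rdistrib scaleR_diff_left)
      (simp add: vec_eq_iff matrix_vector_mult_def mat_def if_distrib[where f="\<lambda>x. x * _"] cong: if_cong)
  hence "det (mat x - M) * det (frame_matrix v) = det (frame_matrix v) * (\<Prod>i<CARD('n). x - l i)"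
    by (rule det_mult_frame_matrix)
  moreover have "det (frame_matrix v) \<noteq> 0" using abs_det_frame_matrix[OF v] by auto
  ultimately show ?thesis by simp
qed

text \<open>
  The frame v consists of eigenvectors of the symmetric matrix \<open>transpose A ** A\<close>, so the vectors A v_i are
  orthogonal; u is obtained by normalising them. The indices run from 0, so that \<open>singular_values A ! i\<close> is
  \<alpha>_(i+1)(A).
\<close>

theorem singular_value_decomposition:
  fixes A :: "real^'n^'n"
  assumes inv: "invertible A"
  obtains v u where "orthonormal_frame v" "orthonormal_frame u"
    "\<And>i. i < CARD('n) \<Longrightarrow> A *v v i = singular_values A ! i *\<^sub>R u i"
    "\<And>i. i < CARD('n) \<Longrightarrow> singular_values A ! i > 0"
    "\<And>i j. i < CARD('n) \<Longrightarrow> j \<le> i \<Longrightarrow> singular_values A ! i \<le> singular_values A ! j"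
proof -
  let ?M = "transpose A ** A" and ?n = "CARD('n)"
  have dot: "(?M *v x) \<bullet> y = (A *v x) \<bullet> (A *v y)" for x y
    by (metis dot_lmul_matrix inner_commute matrix_vector_mul_assoc transpose_matrix_vector)
  have "\<exists>v l. (\<forall>i<?n. v i \<in> UNIV \<and> ?M *v v i = l i *\<^sub>R v i) \<and>
      (\<forall>i<?n. \<forall>j<?n. v i \<bullet> v j = (if i = j then 1 else 0)) \<and> (\<forall>i<?n. \<forall>j\<le>i. l i \<le> (l j::real))"
  proof (rule self_adjoint_eigenbasis)
    show "(?M *v x) \<bullet> y = x \<bullet> (?M *v y)" for x y
      unfolding dot inner_commute[of x "?M *v y"] by (rule inner_commute)
  qed (simp_all add: matrix_vector_mul_linear)
  then obtain v l where v0: "\<forall>i<?n. v i \<in> UNIV \<and> ?M *v v i = l i *\<^sub>R v i"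
      "\<forall>i<?n. \<forall>j<?n. v i \<bullet> v j = (if i = j then 1 else 0)" "\<forall>i<?n. \<forall>j\<le>i. l i \<le> (l j::real)"
    by (elim exE conjE) (rule that; assumption)
  have v: "\<And>i. i < ?n \<Longrightarrow> ?M *v v i = l i *\<^sub>R v i"
    "\<And>i j. i < ?n \<Longrightarrow> j < ?n \<Longrightarrow> v i \<bullet> v j = (if i = j then 1 else 0)"
    "\<And>i j. i < ?n \<Longrightarrow> j \<le> i \<Longrightarrow> l i \<le> (l j::real)"
    using v0 by simp_all
  have Av: "(A *v v i) \<bullet> (A *v v j) = (if i = j then l i else 0)" if "i < ?n" "j < ?n" for i j
    using dot[of "v i" "v j"] unfolding v(1)[OF that(1)] inner_scaleR_left v(2)[OF that]
    by (cases "i = j") simp_all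
  have lpos: "l i > 0" if i: "i < ?n" for i
  proof -
    have "A *v v i \<noteq> 0" using v(2)[OF i i] inv
      by (metis inner_zero_left invertible_def matrix_vector_mul_assoc matrix_vector_mul_lid matrix_vector_mult_0_right zero_neq_one)
    thus ?thesis using Av[OF i i] by (metis inner_gt_zero_iff)
  qed
  define xs where "xs = map (\<lambda>i. sqrt (l i)) [0..<?n]"
  have xs: "xs ! i = sqrt (l i)" if "i < ?n" for i using that by (simp add: xs_def)
  have sv: "singular_values A = xs"
  proof (rule singular_values_eqI)
    show "length xs = ?n" by (simp add: xs_def)
    show "sorted_wrt (\<ge>) xs" unfolding sorted_wrt_iff_nth_less using v(3) by (auto simp: xs_def)
    show "\<forall>\<sigma>\<in>set xs. \<sigma> \<ge> 0" using lpos by (auto simp: xs_def less_imp_le)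
    fix x
    have "(\<Prod>\<sigma>\<leftarrow>xs. x - \<sigma>\<^sup>2) = (\<Prod>i<?n. x - (sqrt (l i))\<^sup>2)"
      by (simp add: xs_def o_def prod.distinct_set_conv_list[symmetric] atLeast0LessThan)
    also have "\<dots> = (\<Prod>i<?n. x - l i)" using lpos by (intro prod.cong) (auto simp: less_imp_le)
    finally have "(\<Prod>\<sigma>\<leftarrow>xs. x - \<sigma>\<^sup>2) = (\<Prod>i<?n. x - l i)" .
    thus "det (mat x - ?M) = (\<Prod>\<sigma>\<leftarrow>xs. x - \<sigma>\<^sup>2)"
      using det_eigenbasis[of v ?M l x] v by (simp add: orthonormal_frame_def)
  qed
  define u where "u i = (A *v v i) /\<^sub>R sqrt (l i)" for i
  show thesis
  proof (rule that[of v u])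
    show "orthonormal_frame v" using v by (auto simp: orthonormal_frame_def)
    show "orthonormal_frame u" unfolding orthonormal_frame_def u_def
      using Av lpos less_imp_neq[OF lpos] by (auto simp: field_simps less_imp_le real_sqrt_mult_self abs_of_pos)
  qed (use v lpos less_imp_neq[OF lpos] in \<open>auto simp: sv xs u_def less_imp_le intro: real_sqrt_gt_zero\<close>)
qed

lemma abs_det_eq_prod_singular_values:
  fixes A :: "real^'n^'n"
  assumes "invertible A"
  shows "\<bar>det A\<bar> = (\<Prod>i<CARD('n). singular_values A ! i)"
proof -
  obtain v u where v: "orthonormal_frame v" and u: "orthonormal_frame u"
    and Av: "\<And>i. i < CARD('n) \<Longrightarrow> A *v v i = singular_values A ! i *\<^sub>R u i"
    and pos: "\<And>i. i < CARD('n) \<Longrightarrow> singular_values A ! i > 0"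
    using singular_value_decomposition[OF assms] by metis
  have "\<bar>det A * det (frame_matrix v)\<bar> = \<bar>det (frame_matrix u) * (\<Prod>i<CARD('n). singular_values A ! i)\<bar>"
    using det_mult_frame_matrix[OF Av] by simp
  moreover have "(\<Prod>i<CARD('n). singular_values A ! i) > 0" using pos by (intro prod_pos) auto
  ultimately show ?thesis using abs_det_frame_matrix[OF v] abs_det_frame_matrix[OF u] by (simp add: abs_mult)
qed

section \<open>Orthonormal frames\<close>

lemma orthonormal_frame_expand:
  fixes v :: "nat \<Rightarrow> real^'n"
  assumes "orthonormal_frame v"
  shows "(\<Sum>i<CARD('n). (x \<bullet> v i) *\<^sub>R v i) = x"
proof -
  let ?B = "v ` {..<CARD('n)}"
  have v: "v i \<bullet> v j = (if i = j then 1 else 0)" if "i < CARD('n)" "j < CARD('n)" for i j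
    using assms that by (simp add: orthonormal_frame_def)
  have inj: "inj_on v {..<CARD('n)}"
  proof (rule inj_onI)
    fix i j assume ij: "i \<in> {..<CARD('n)}" "j \<in> {..<CARD('n)}" "v i = v j"
    with v[of i i] v[of i j] show "i = j" by (auto split: if_splits)
  qed
  have orth: "pairwise orthogonal ?B" using v by (auto simp: pairwise_def orthogonal_def)
  have norm: "norm b = 1" if "b \<in> ?B" for b using that v by (auto simp: norm_eq_1)
  have "0 \<notin> ?B" using norm by force
  hence "independent ?B" using orth by (rule pairwise_orthogonal_independent[rotated])
  hence "dim ?B = CARD('n)" by (simp add: dim_eq_card_independent card_image inj)
  hence "span ?B = UNIV" using dim_eq_full[of ?B] by simp
  hence "(\<Sum>b\<in>?B. (x \<bullet> b) *\<^sub>R b) = x"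
    using orth norm by (intro orthonormal_basis_expand) auto
  thus ?thesis using inj by (simp add: sum.reindex)
qed

lemma orthonormal_frame_coeff:
  fixes v :: "nat \<Rightarrow> real^'n"
  assumes "orthonormal_frame v" "j < CARD('n)"
  shows "(\<Sum>i<CARD('n). c i *\<^sub>R v i) \<bullet> v j = c j"
proof -
  have "(\<Sum>i<CARD('n). c i *\<^sub>R v i) \<bullet> v j = (\<Sum>i<CARD('n). if i = j then c i else 0)"
    unfolding inner_sum_left using assms by (intro sum.cong) (auto simp: orthonormal_frame_def)
  thus ?thesis using assms(2) by simp
qed

lemma orthonormal_frame_norm_sum:
  fixes v :: "nat \<Rightarrow> real^'n"
  assumes "orthonormal_frame v"
  shows "(norm (\<Sum>i<CARD('n). c i *\<^sub>R v i))\<^sup>2 = (\<Sum>i<CARD('n). (c i)\<^sup>2)"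
proof -
  have "(norm (\<Sum>i<CARD('n). c i *\<^sub>R v i))\<^sup>2 = (\<Sum>j<CARD('n). c j * ((\<Sum>i<CARD('n). c i *\<^sub>R v i) \<bullet> v j))"
    unfolding power2_norm_eq_inner by (simp add: inner_sum_right)
  thus ?thesis using orthonormal_frame_coeff[OF assms] by (simp add: power2_eq_square)
qed

lemma orthonormal_frame_norm:
  fixes v :: "nat \<Rightarrow> real^'n"
  assumes "orthonormal_frame v" "i < CARD('n)"
  shows "norm (v i) = 1"
  using assms by (simp add: orthonormal_frame_def norm_eq_1)

lemma orthonormal_frame_coeff_le:
  fixes v :: "nat \<Rightarrow> real^'n"
  assumes "orthonormal_frame v" "i < CARD('n)"
  shows "\<bar>x \<bullet> v i\<bar> \<le> norm x"
  using Cauchy_Schwarz_ineq2[of x "v i"] orthonormal_frame_norm[OF assms] by simp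

lemma orthonormal_frame_norm_le:
  fixes v :: "nat \<Rightarrow> real^'n"
  assumes "orthonormal_frame v"
  shows "norm (\<Sum>i<CARD('n). c i *\<^sub>R v i) \<le> (\<Sum>i<CARD('n). \<bar>c i\<bar>)"
  by (rule sum_norm_le) (simp add: orthonormal_frame_norm[OF assms])

lemma matrix_vector_mult_frame:
  fixes A :: "real^'n^'n"
  assumes "\<And>i. i < CARD('n) \<Longrightarrow> A *v v i = \<sigma> i *\<^sub>R u i"
  shows "A *v (\<Sum>i<CARD('n). c i *\<^sub>R v i) = (\<Sum>i<CARD('n). (\<sigma> i * c i) *\<^sub>R u i)"
proof -
  have "A *v (\<Sum>i<CARD('n). c i *\<^sub>R v i) = (\<Sum>i<CARD('n). c i *\<^sub>R (A *v v i))"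
    using matrix_vector_mul_linear[of A] by (simp add: linear_sum linear_scale)
  thus ?thesis using assms by (simp add: mult.commute)
qed

section \<open>Covering numbers\<close>

lemma hypercube_norm_le:
  fixes Q :: "(real^'n) set"
  assumes "hypercube d Q" "x \<in> Q" "y \<in> Q"
  shows "norm (x - y) \<le> real CARD('n) * d"
proof -
  obtain a where Q: "Q = cbox a (a + (\<chi> i. d))" using assms(1) by (auto simp: hypercube_def)
  have "\<bar>(x - y) $ i\<bar> \<le> d" for i
    using assms(2,3) unfolding Q by (auto simp: mem_box_cart abs_le_iff dest!: spec[of _ i])
  hence "(\<Sum>i\<in>UNIV. \<bar>(x - y) $ i\<bar>) \<le> (\<Sum>i\<in>(UNIV::'n set). d)" by (intro sum_mono)
  thus ?thesis using norm_le_l1_cart[of "x - y"] by simp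
qed

lemma cball_subset_hypercube:
  fixes x :: "real^'n"
  shows "cball x (d/2) \<subseteq> cbox (x - (\<chi> i. d/2)) (x - (\<chi> i. d/2) + (\<chi> i. d))"
proof
  fix y assume "y \<in> cball x (d/2)"
  hence c: "\<bar>x $ i - y $ i\<bar> \<le> d/2" for i
    using component_le_norm_cart[of "x - y" i] by (simp add: dist_norm)
  have c': "x $ i - y $ i \<le> d/2" "y $ i - x $ i \<le> d/2" for i
    using c[of i] by linarith+
  thus "y \<in> cbox (x - (\<chi> i. d/2)) (x - (\<chi> i. d/2) + (\<chi> i. d))"
    unfolding mem_box_cart
  proof (intro allI conjI)
    fix i
    show "(x - (\<chi> i. d/2)) $ i \<le> y $ i" using c'(1)[of i] by simp
    show "y $ i \<le> (x - (\<chi> i. d/2) + (\<chi> i. d)) $ i" using c'(2)[of i] by simp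
  qed
qed

lemma covering_number_le_card:
  assumes "finite \<Q>" "\<And>Q. Q \<in> \<Q> \<Longrightarrow> hypercube d Q" "F \<subseteq> \<Union>\<Q>"
  shows "covering_number d F \<le> card \<Q>"
  unfolding covering_number_def by (rule Least_le) (use assms in auto)

lemma covering_number_le_centres:
  assumes "finite P" "F \<subseteq> (\<Union>p\<in>P. cball p (d/2))"
  shows "covering_number d F \<le> card P"
proof -
  let ?q = "\<lambda>p::real^'a. cbox (p - (\<chi> i. d/2)) (p - (\<chi> i. d/2) + (\<chi> i. d))"
  have "F \<subseteq> \<Union>(?q ` P)" using assms(2) cball_subset_hypercube by blast
  hence "covering_number d F \<le> card (?q ` P)"
    using assms(1) by (intro covering_number_le_card) (auto simp: hypercube_def)
  thus ?thesis using card_image_le[OF assms(1), of ?q] by linarith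
qed

lemma optimal_cover:
  fixes F :: "(real^'n) set"
  assumes "bounded F" "d > 0"
  obtains \<Q> where "finite \<Q>" "card \<Q> = covering_number d F" "\<And>Q. Q \<in> \<Q> \<Longrightarrow> hypercube d Q" "F \<subseteq> \<Union>\<Q>"
proof -
  have "compact (closure F)" using assms(1) by (simp add: compact_closure)
  then obtain P where P: "finite P" "closure F \<subseteq> (\<Union>x\<in>P. ball x (d/2))"
    by (rule compactE_image[of "closure F" "closure F" "\<lambda>x. ball x (d/2)"]) (use assms(2) in auto)
  let ?q = "\<lambda>p::real^'n. cbox (p - (\<chi> i. d/2)) (p - (\<chi> i. d/2) + (\<chi> i. d))"
  have "F \<subseteq> \<Union>(?q ` P)"
  proof
    fix y assume "y \<in> F"
    then obtain p where "p \<in> P" "y \<in> ball p (d/2)" using P(2) closure_subset by blast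
    thus "y \<in> \<Union>(?q ` P)" using cball_subset_hypercube[of p d] ball_subset_cball[of p "d/2"] by blast
  qed
  hence "\<exists>k \<Q>. finite \<Q> \<and> card \<Q> = k \<and> (\<forall>Q\<in>\<Q>. hypercube d Q) \<and> F \<subseteq> \<Union>\<Q>"
    using P(1) by (intro exI[of _ "card (?q ` P)"] exI[of _ "?q ` P"]) (auto simp: hypercube_def)
  from LeastI_ex[OF this] show ?thesis using that unfolding covering_number_def by blast
qed

lemma covering_number_mono:
  assumes "F \<subseteq> G" "bounded G" "d > 0"
  shows "covering_number d F \<le> covering_number d G"
  using optimal_cover[OF assms(2,3)] covering_number_le_card assms(1)
  by (metis subset_trans)

lemma covering_number_closure:
  assumes "bounded F" "d > 0"
  shows "covering_number d (closure F) \<le> covering_number d F"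
proof -
  obtain \<Q> where Q: "finite \<Q>" "card \<Q> = covering_number d F" "\<And>Q. Q \<in> \<Q> \<Longrightarrow> hypercube d Q" "F \<subseteq> \<Union>\<Q>"
    using optimal_cover[OF assms] by blast
  have "closed (\<Union>\<Q>)" using Q(1,3) by (intro closed_Union) (auto simp: hypercube_def)
  hence "closure F \<subseteq> \<Union>\<Q>" using Q(4) by (intro closure_minimal)
  thus ?thesis using covering_number_le_card[OF Q(1,3)] Q(2) by simp
qed

lemma covering_number_UN:
  assumes "finite I" "\<And>i. i \<in> I \<Longrightarrow> bounded (F i)" "d > 0"
  shows "covering_number d (\<Union>i\<in>I. F i) \<le> (\<Sum>i\<in>I. covering_number d (F i))"
proof -
  have "\<exists>\<Q>. finite \<Q> \<and> card \<Q> = covering_number d (F i) \<and> (\<forall>Q\<in>\<Q>. hypercube d Q) \<and> F i \<subseteq> \<Union>\<Q>"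
    if "i \<in> I" for i
    using optimal_cover[OF assms(2)[OF that] assms(3)] by metis
  then obtain q where q: "\<And>i. i \<in> I \<Longrightarrow> finite (q i) \<and> card (q i) = covering_number d (F i) \<and>
      (\<forall>Q\<in>q i. hypercube d Q) \<and> F i \<subseteq> \<Union>(q i)" by metis
  have "covering_number d (\<Union>i\<in>I. F i) \<le> card (\<Union>i\<in>I. q i)"
    using q assms(1) by (intro covering_number_le_card) (auto, blast)
  also have "\<dots> \<le> (\<Sum>i\<in>I. card (q i))" by (rule card_UN_le[OF assms(1)])
  also have "\<dots> = (\<Sum>i\<in>I. covering_number d (F i))" using q by (intro sum.cong) auto
  finally show ?thesis .
qed

lemma covering_number_Un:
  assumes "bounded F" "bounded G" "d > 0"
  shows "covering_number d (F \<union> G) \<le> covering_number d F + covering_number d G"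
  using covering_number_UN[of "UNIV::bool set" "\<lambda>b. if b then F else G" d] assms
  by (simp add: UNIV_bool Un_commute add.commute)

lemma covering_number_antimono:
  fixes F :: "(real^'n) set"
  assumes "bounded F" "0 < d" "d \<le> e"
  shows "covering_number e F \<le> covering_number d F"
proof -
  obtain \<Q> where Q: "finite \<Q>" "card \<Q> = covering_number d F" "\<And>Q. Q \<in> \<Q> \<Longrightarrow> hypercube d Q" "F \<subseteq> \<Union>\<Q>"
    using optimal_cover[OF assms(1,2)] by blast
  have "\<exists>R. hypercube e R \<and> Q \<subseteq> R" if Qq: "Q \<in> \<Q>" for Q
  proof -
    obtain a where "Q = cbox a (a + (\<chi> i. d))" using Q(3)[OF Qq] by (auto simp: hypercube_def)
    hence "Q \<subseteq> cbox a (a + (\<chi> i. e))" using assms(3) 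
      by (auto simp: mem_box_cart) (smt (verit))
    thus ?thesis by (auto simp: hypercube_def)
  qed
  then obtain r where r: "\<And>Q. Q \<in> \<Q> \<Longrightarrow> hypercube e (r Q) \<and> Q \<subseteq> r Q" by metis
  have "F \<subseteq> \<Union>(r ` \<Q>)" using r Q(4) by blast
  hence "covering_number e F \<le> card (r ` \<Q>)" using Q(1) r by (intro covering_number_le_card) auto
  thus ?thesis using card_image_le[OF Q(1), of r] Q(2) by linarith
qed

text \<open>
  A cube of side d has diameter at most n d, so it contains at most one point of a set with larger gaps.
\<close>

lemma card_separated_le_covering_number:
  fixes F :: "(real^'n) set"
  assumes "bounded F" "d > 0" "P \<subseteq> F"
    and sep: "\<And>x y. x \<in> P \<Longrightarrow> y \<in> P \<Longrightarrow> x \<noteq> y \<Longrightarrow> norm (x - y) > real CARD('n) * d"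
  shows "card P \<le> covering_number d F"
proof -
  obtain \<Q> where Q: "finite \<Q>" "card \<Q> = covering_number d F" "\<And>Q. Q \<in> \<Q> \<Longrightarrow> hypercube d Q" "F \<subseteq> \<Union>\<Q>"
    using optimal_cover[OF assms(1,2)] by blast
  have "\<exists>Q. Q \<in> \<Q> \<and> x \<in> Q" if "x \<in> P" for x using that assms(3) Q(4) by blast
  then obtain q where q: "\<And>x. x \<in> P \<Longrightarrow> q x \<in> \<Q> \<and> x \<in> q x" by metis
  have "inj_on q P"
  proof (rule inj_onI, rule ccontr)
    fix x y assume *: "x \<in> P" "y \<in> P" "q x = q y" "x \<noteq> y"
    with q[of x] q[of y] Q(3)[of "q x"] have "norm (x - y) \<le> real CARD('n) * d"
      by (intro hypercube_norm_le[of d "q x"]) auto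
    with sep[of x y] * show False by simp
  qed
  hence "card P \<le> card \<Q>" using q Q(1) by (intro card_inj_on_le[of q]) auto
  thus ?thesis using Q(2) by simp
qed

lemma covering_number_pos:
  fixes F :: "(real^'n) set"
  assumes "bounded F" "d > 0" "F \<noteq> {}"
  shows "covering_number d F \<ge> 1"
proof -
  obtain x where "x \<in> F" using assms(3) by blast
  thus ?thesis using card_separated_le_covering_number[of F d "{x}"] assms(1,2) by auto
qed

section \<open>Counting cubes that meet an ellipsoid\<close>

text \<open>
  The order of magnitude of the number of cubes of side d that cover the image of the unit ball: the
  image is an ellipsoid with semi-axes \<alpha>_i, and an axis shorter than d still costs one cube.
\<close>

definition ellipsoid_count :: "real^'n^'n \<Rightarrow> real \<Rightarrow> real" where
  "ellipsoid_count A d = (\<Prod>i<CARD('n). max 1 (singular_values A ! i / d))"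

lemma affine_image_cball_bounded: "bounded ((\<lambda>x. A *v x + b) ` cball z (r::real))"
  for A :: "real^'n^'n"
  by (intro compact_imp_bounded compact_continuous_image continuous_intros compact_cball
      linear_continuous_on linear_conv_bounded_linear[THEN iffD1] matrix_vector_mul_linear)

lemma max_one_scale: "c \<ge> 1 \<Longrightarrow> x \<le> c * y \<Longrightarrow> max 1 x \<le> c * max 1 (y::real)"
  by (smt (verit) mult_left_mono mult_le_cancel_left1)

text \<open>
  In the frame u the ellipsoid lies in a box with half-sides \<alpha>_i r. A grid of mesh d / (2 n) in that box is
  so fine that every point of the box is within d / 2 of a grid point.
\<close>

lemma covering_number_ellipsoid_le:
  fixes A :: "real^'n^'n"
  assumes inv: "invertible A" and d: "d > 0" and r: "r > 0"
  shows "real (covering_number d ((\<lambda>x. A *v x + b) ` cball z r))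
           \<le> (8 * real CARD('n)) ^ CARD('n) * ellipsoid_count A (d / r)"
proof -
  let ?n = "CARD('n)" and ?\<sigma> = "\<lambda>i. singular_values A ! i"
  obtain v u where v: "orthonormal_frame v" and u: "orthonormal_frame u"
    and Av: "\<And>i. i < ?n \<Longrightarrow> A *v v i = ?\<sigma> i *\<^sub>R u i" and pos: "\<And>i. i < ?n \<Longrightarrow> ?\<sigma> i > 0"
    using singular_value_decomposition[OF inv] by metis
  define h where "h = d / (2 * ?n)"
  have h: "h > 0" "?n * h = d / 2" using d by (auto simp: h_def)
  define T where "T i = ?\<sigma> i * r / h" for i
  have T0: "T i \<ge> 0" if "i < ?n" for i using pos[OF that] r h by (simp add: T_def)
  define K where "K = (\<Pi>\<^sub>E i\<in>{..<?n}. {-\<lfloor>T i\<rfloor>-1..\<lfloor>T i\<rfloor>})"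
  have finK: "finite K" unfolding K_def by (intro finite_PiE) auto
  define p where "p k = A *v z + b + (\<Sum>i<?n. (of_int (k i) * h) *\<^sub>R u i)" for k :: "nat \<Rightarrow> int"
  have "(\<lambda>x. A *v x + b) ` cball z r \<subseteq> (\<Union>q\<in>p ` K. cball q (d/2))"
  proof (rule image_subsetI)
    fix x assume x: "x \<in> cball z r"
    define c where "c i = (x - z) \<bullet> v i" for i
    have c: "\<bar>c i\<bar> \<le> r" if "i < ?n" for i
      using orthonormal_frame_coeff_le[OF v that, of "x - z"] x by (simp add: c_def dist_norm norm_minus_commute)
    define k where "k = restrict (\<lambda>i. \<lfloor>?\<sigma> i * c i / h\<rfloor>) {..<?n}"
    have kK: "k \<in> K" unfolding K_def k_def
    proof (rule restrict_PiE_iff[THEN iffD2], intro ballI)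
      fix i assume "i \<in> {..<?n}"
      hence i: "i < ?n" by simp
      have "\<bar>?\<sigma> i * c i / h\<bar> \<le> T i"
        using c[OF i] pos[OF i] h(1) unfolding T_def by (simp add: abs_mult divide_right_mono)
      hence "?\<sigma> i * c i / h \<le> T i" "- T i \<le> ?\<sigma> i * c i / h" by linarith+
      thus "\<lfloor>?\<sigma> i * c i / h\<rfloor> \<in> {-\<lfloor>T i\<rfloor>-1..\<lfloor>T i\<rfloor>}"
        by (simp add: floor_mono) linarith
    qed
    have "A *v x + b = A *v z + b + A *v (\<Sum>i<?n. c i *\<^sub>R v i)"
      unfolding c_def orthonormal_frame_expand[OF v]
      by (simp add: matrix_vector_mult_diff_distrib)
    also have "A *v (\<Sum>i<?n. c i *\<^sub>R v i) = (\<Sum>i<?n. (?\<sigma> i * c i) *\<^sub>R u i)"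
      by (rule matrix_vector_mult_frame[OF Av])
    finally have e: "A *v x + b - p k = (\<Sum>i<?n. (?\<sigma> i * c i - of_int (k i) * h) *\<^sub>R u i)"
      by (simp add: p_def sum_subtractf scaleR_diff_left)
    have "norm (A *v x + b - p k) \<le> (\<Sum>i<?n. \<bar>?\<sigma> i * c i - of_int (k i) * h\<bar>)"
      unfolding e by (rule orthonormal_frame_norm_le[OF u])
    also have "\<dots> \<le> (\<Sum>i<?n. h)"
    proof (rule sum_mono)
      fix i assume "i \<in> {..<?n}"
      hence k: "k i = \<lfloor>?\<sigma> i * c i / h\<rfloor>" by (simp add: k_def)
      have "of_int (k i) \<le> ?\<sigma> i * c i / h" "?\<sigma> i * c i / h \<le> of_int (k i) + 1" unfolding k by linarith+
      hence "of_int (k i) * h \<le> ?\<sigma> i * c i" "?\<sigma> i * c i \<le> of_int (k i) * h + h"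
        using h(1) by (simp_all add: field_simps)
      thus "\<bar>?\<sigma> i * c i - of_int (k i) * h\<bar> \<le> h" by linarith
    qed
    also have "\<dots> = d / 2" using h(2) by simp
    finally have "A *v x + b \<in> cball (p k) (d/2)" by (simp add: dist_norm norm_minus_commute)
    thus "A *v x + b \<in> (\<Union>q\<in>p ` K. cball q (d/2))" using kK by blast
  qed
  hence "covering_number d ((\<lambda>x. A *v x + b) ` cball z r) \<le> card (p ` K)"
    using finK by (intro covering_number_le_centres) auto
  also have "\<dots> \<le> card K" by (rule card_image_le[OF finK])
  also have "card K = (\<Prod>i<?n. card {-\<lfloor>T i\<rfloor>-1..\<lfloor>T i\<rfloor>})" unfolding K_def by (simp add: card_PiE)
  finally have "real (covering_number d ((\<lambda>x. A *v x + b) ` cball z r))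
      \<le> real (\<Prod>i<?n. card {-\<lfloor>T i\<rfloor>-1..\<lfloor>T i\<rfloor>})" by (rule of_nat_mono)
  also have "\<dots> = (\<Prod>i<?n. real (card {-\<lfloor>T i\<rfloor>-1..\<lfloor>T i\<rfloor>}))" by (rule of_nat_prod)
  also have "\<dots> \<le> (\<Prod>i<?n. (8 * real ?n) * max 1 (?\<sigma> i / (d / r)))"
  proof (rule prod_mono, intro conjI)
    fix i assume "i \<in> {..<?n}"
    hence i: "i < ?n" by simp
    have n2: "1 \<le> 2 * real ?n" using zero_less_card_finite[where 'a = 'n] by linarith
    have "card {-\<lfloor>T i\<rfloor>-1..\<lfloor>T i\<rfloor>} = nat (2 * \<lfloor>T i\<rfloor> + 2)"
      unfolding card_atLeastAtMost_int by (rule arg_cong[where f = nat]) simp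
    moreover have "0 \<le> 2 * \<lfloor>T i\<rfloor> + 2" using T0[OF i] by simp
    ultimately have "real (card {-\<lfloor>T i\<rfloor>-1..\<lfloor>T i\<rfloor>}) = 2 * of_int \<lfloor>T i\<rfloor> + 2" by simp
    also have "\<dots> \<le> 4 * max 1 (T i)" by linarith
    also have "4 * max 1 (T i) \<le> 4 * ((2 * real ?n) * max 1 (?\<sigma> i / (d / r)))"
      unfolding T_def h_def using d by (intro mult_left_mono max_one_scale n2) (auto simp: field_simps)
    finally show "real (card {-\<lfloor>T i\<rfloor>-1..\<lfloor>T i\<rfloor>}) \<le> (8 * real ?n) * max 1 (?\<sigma> i / (d / r))" by simp
  qed simp
  also have "\<dots> = (8 * real ?n) ^ ?n * ellipsoid_count A (d / r)"
    by (simp add: ellipsoid_count_def prod.distrib power_mult_distrib)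
  finally show ?thesis .
qed

text \<open>
  A grid of mesh (n + 1) d along the frame u has gaps larger than the diameter of a cube of side d. The grid
  points with i-th coordinate at most \<alpha>_i r / n lie in the ellipsoid, so they can be counted from below.
\<close>

lemma covering_number_ellipsoid_ge:
  fixes A :: "real^'n^'n"
  assumes inv: "invertible A" and d: "d > 0" and r: "r > 0"
  shows "ellipsoid_count A (d / r)
           \<le> (real CARD('n) * (real CARD('n) + 1)) ^ CARD('n) * real (covering_number d ((\<lambda>x. A *v x + b) ` cball z r))"
proof -
  let ?n = "CARD('n)" and ?\<sigma> = "\<lambda>i. singular_values A ! i"
  let ?E = "(\<lambda>x. A *v x + b) ` cball z r"
  obtain v u where v: "orthonormal_frame v" and u: "orthonormal_frame u"
    and Av: "\<And>i. i < ?n \<Longrightarrow> A *v v i = ?\<sigma> i *\<^sub>R u i" and pos: "\<And>i. i < ?n \<Longrightarrow> ?\<sigma> i > 0"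
    using singular_value_decomposition[OF inv] by metis
  define h where "h = (real ?n + 1) * d"
  have h: "h > 0" "?n * d < h" using d by (auto simp: h_def algebra_simps intro: add_pos_pos)
  define T where "T i = ?\<sigma> i * r / (real ?n * h)" for i
  have T0: "T i \<ge> 0" if "i < ?n" for i using pos[OF that] r h by (simp add: T_def)
  define K where "K = (\<Pi>\<^sub>E i\<in>{..<?n}. {..nat \<lfloor>T i\<rfloor>})"
  define p where "p k = A *v z + b + (\<Sum>i<?n. (real (k i) * h) *\<^sub>R u i)" for k :: "nat \<Rightarrow> nat"
  have sep: "norm (p k - p l) > real ?n * d" if kl: "k \<in> K" "l \<in> K" "k \<noteq> l" for k l
  proof -
    obtain i where i: "i < ?n" "k i \<noteq> l i" using kl unfolding K_def by (metis PiE_ext lessThan_iff)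
    have "p k - p l = (\<Sum>i<?n. (real (k i) * h - real (l i) * h) *\<^sub>R u i)"
      by (simp add: p_def sum_subtractf scaleR_diff_left)
    hence "(p k - p l) \<bullet> u i = (real (k i) - real (l i)) * h"
      by (simp only: orthonormal_frame_coeff[OF u i(1)]) (simp add: algebra_simps)
    hence "\<bar>real (k i) - real (l i)\<bar> * h \<le> norm (p k - p l)"
      using orthonormal_frame_coeff_le[OF u i(1), of "p k - p l"] h(1) by (simp add: abs_mult)
    moreover have "1 \<le> \<bar>real (k i) - real (l i)\<bar>" using i(2) by linarith
    hence "1 * h \<le> \<bar>real (k i) - real (l i)\<bar> * h" using h(1) by (intro mult_right_mono) auto
    ultimately show ?thesis using h(2) by linarith
  qed
  have inj: "inj_on p K"
  proof (rule inj_onI, rule ccontr)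
    fix k l assume "k \<in> K" "l \<in> K" "p k = p l" "k \<noteq> l"
    with sep[of k l] d show False by (simp add: mult_less_0_iff)
  qed
  have sub: "p ` K \<subseteq> ?E"
  proof (rule image_subsetI)
    fix k assume k: "k \<in> K"
    define c where "c i = real (k i) * h / ?\<sigma> i" for i
    define x where "x = z + (\<Sum>i<?n. c i *\<^sub>R v i)"
    have "norm (\<Sum>i<?n. c i *\<^sub>R v i) \<le> (\<Sum>i<?n. \<bar>c i\<bar>)" by (rule orthonormal_frame_norm_le[OF v])
    also have "\<dots> \<le> (\<Sum>i<?n. r / ?n)"
    proof (rule sum_mono)
      fix i assume "i \<in> {..<?n}"
      hence i: "i < ?n" by simp
      have "k i \<le> nat \<lfloor>T i\<rfloor>" using k i by (auto simp: K_def PiE_def Pi_def)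
      hence "real (k i) \<le> T i" using T0[OF i] by linarith
      hence "real (k i) * h \<le> T i * h" using h(1) by simp
      also have "T i * h = ?\<sigma> i * r / ?n" using h(1) by (simp add: T_def)
      finally show "\<bar>c i\<bar> \<le> r / ?n" using pos[OF i] h(1) by (simp add: c_def field_simps)
    qed
    also have "\<dots> = r" by simp
    finally have "x \<in> cball z r" by (simp add: x_def dist_norm)
    moreover have "p k = A *v x + b"
    proof -
      have "A *v x = A *v z + A *v (\<Sum>i<?n. c i *\<^sub>R v i)" unfolding x_def
        by (simp add: matrix_vector_right_distrib)
      also have "A *v (\<Sum>i<?n. c i *\<^sub>R v i) = (\<Sum>i<?n. (?\<sigma> i * c i) *\<^sub>R u i)"
        by (rule matrix_vector_mult_frame[OF Av])
      also have "\<dots> = (\<Sum>i<?n. (real (k i) * h) *\<^sub>R u i)"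
        using less_imp_neq[OF pos] by (intro sum.cong) (auto simp: c_def)
      finally show ?thesis by (simp add: p_def)
    qed
    ultimately show "p k \<in> ?E" by (intro image_eqI[where x = x])
  qed
  have "ellipsoid_count A (d / r) \<le> (\<Prod>i<?n. (real ?n * (real ?n + 1)) * real (card {..nat \<lfloor>T i\<rfloor>}))"
    unfolding ellipsoid_count_def
  proof (rule prod_mono, intro conjI)
    fix i assume "i \<in> {..<?n}"
    hence i: "i < ?n" by simp
    have "max 1 (?\<sigma> i / (d / r)) \<le> (real ?n * (real ?n + 1)) * max 1 (T i)"
    proof (rule max_one_scale)
      show "1 \<le> real ?n * (real ?n + 1)"
        using mult_mono[of 1 "real ?n" 1 "real ?n + 1"] by (simp add: Suc_le_eq)
      have "real ?n * (real ?n + 1) * T i = ?\<sigma> i * r * ((real ?n * (real ?n + 1)) / ((real ?n * (real ?n + 1)) * d))"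
        unfolding T_def h_def by (simp add: mult.assoc)
      also have "(real ?n * (real ?n + 1)) / ((real ?n * (real ?n + 1)) * d) = 1 / d"
        by (subst nonzero_divide_mult_cancel_left) (auto simp: add_eq_0_iff)
      finally show "?\<sigma> i / (d / r) \<le> (real ?n * (real ?n + 1)) * T i" by simp
    qed
    also have "\<dots> \<le> (real ?n * (real ?n + 1)) * real (card {..nat \<lfloor>T i\<rfloor>})"
      using T0[OF i] by (intro mult_left_mono) (auto, linarith+)
    finally show "max 1 (?\<sigma> i / (d / r)) \<le> (real ?n * (real ?n + 1)) * real (card {..nat \<lfloor>T i\<rfloor>})" .
  qed simp
  also have "\<dots> = (real ?n * (real ?n + 1)) ^ ?n * (\<Prod>i<?n. real (card {..nat \<lfloor>T i\<rfloor>}))"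
    by (simp only: prod.distrib prod_constant card_lessThan power_mult_distrib)
  also have "(\<Prod>i<?n. real (card {..nat \<lfloor>T i\<rfloor>})) = real (card (p ` K))"
    unfolding card_image[OF inj] by (simp add: K_def card_PiE del: card_atMost)
  also have "(real ?n * (real ?n + 1)) ^ ?n * real (card (p ` K))
      \<le> (real ?n * (real ?n + 1)) ^ ?n * real (covering_number d ?E)"
  proof (intro mult_left_mono of_nat_mono card_separated_le_covering_number d sub affine_image_cball_bounded)
    fix x y assume "x \<in> p ` K" "y \<in> p ` K" "x \<noteq> y"
    thus "norm (x - y) > real ?n * d" using sep by blast
  qed simp
  finally show ?thesis .
qed

lemma ellipsoid_count_antimono:
  fixes A :: "real^'n^'n"
  assumes "invertible A" "0 < d" "d \<le> e"
  shows "ellipsoid_count A e \<le> ellipsoid_count A d"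
  unfolding ellipsoid_count_def
proof (rule prod_mono, intro conjI)
  fix i assume "i \<in> {..<CARD('n)}"
  hence "singular_values A ! i > 0" using singular_value_decomposition[OF assms(1)] by (metis lessThan_iff)
  hence "singular_values A ! i / e \<le> singular_values A ! i / d" using assms by (intro divide_left_mono) auto
  thus "max 1 (singular_values A ! i / e) \<le> max 1 (singular_values A ! i / d)" by auto
qed simp

lemma ellipsoid_count_ge_1: "ellipsoid_count A d \<ge> 1"
  unfolding ellipsoid_count_def by (intro prod_ge_1) auto

lemma ellipsoid_count_rescale:
  fixes A :: "real^'n^'n"
  assumes "c \<ge> 1"
  shows "ellipsoid_count A (d / c) \<le> c ^ CARD('n) * ellipsoid_count A d"
proof -
  have "ellipsoid_count A (d / c) \<le> (\<Prod>i<CARD('n). c * max 1 (singular_values A ! i / d))"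
    unfolding ellipsoid_count_def using assms 
    by (intro prod_mono conjI max_one_scale) (auto simp: field_simps)
  thus ?thesis by (simp add: ellipsoid_count_def prod.distrib)
qed

text \<open>
  Each cube of an optimal cover of F by cubes of side r lies in a ball of radius n r, whose image is an ellipsoid.
\<close>

lemma covering_number_image_le:
  fixes A :: "real^'n^'n"
  assumes inv: "invertible A" and d: "d > 0" and r: "r > 0" and F: "bounded F"
  shows "real (covering_number d ((\<lambda>x. A *v x + b) ` F))
     \<le> (8 * real CARD('n) * real CARD('n)) ^ CARD('n) * real (covering_number r F) * ellipsoid_count A (d / r)"
proof -
  let ?n = "real CARD('n)" and ?f = "\<lambda>x. A *v x + b"
  obtain \<Q> where Q: "finite \<Q>" "card \<Q> = covering_number r F" "\<And>Q. Q \<in> \<Q> \<Longrightarrow> hypercube r Q" "F \<subseteq> \<Union>\<Q>"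
    using optimal_cover[OF F r] by blast
  have "\<exists>z. Q \<subseteq> cball z (?n * r)" if "Q \<in> \<Q>" for Q
  proof (cases "Q = {}")
    case False
    then obtain z where "z \<in> Q" by blast
    hence "Q \<subseteq> cball z (?n * r)" using hypercube_norm_le[OF Q(3)[OF that]] by (auto simp: dist_norm)
    thus ?thesis ..
  qed auto
  then obtain z where z: "\<And>Q. Q \<in> \<Q> \<Longrightarrow> Q \<subseteq> cball (z Q) (?n * r)" by metis
  have "?f ` F \<subseteq> (\<Union>Q\<in>\<Q>. ?f ` cball (z Q) (?n * r))"
  proof (rule image_subsetI)
    fix x assume "x \<in> F"
    then obtain Q where "Q \<in> \<Q>" "x \<in> Q" using Q(4) by blast
    with z[of Q] show "?f x \<in> (\<Union>Q\<in>\<Q>. ?f ` cball (z Q) (?n * r))" by (intro UN_I[of Q] imageI) auto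
  qed
  hence "covering_number d (?f ` F) \<le> covering_number d (\<Union>Q\<in>\<Q>. ?f ` cball (z Q) (?n * r))"
    by (intro covering_number_mono bounded_UN Q(1) ballI affine_image_cball_bounded d)
  also have "\<dots> \<le> (\<Sum>Q\<in>\<Q>. covering_number d (?f ` cball (z Q) (?n * r)))"
    by (intro covering_number_UN Q(1) affine_image_cball_bounded d)
  finally have "real (covering_number d (?f ` F)) \<le> (\<Sum>Q\<in>\<Q>. real (covering_number d (?f ` cball (z Q) (?n * r))))"
    by (simp only: of_nat_sum[symmetric] of_nat_le_iff)
  also have "\<dots> \<le> (\<Sum>Q\<in>\<Q>. (8 * ?n) ^ CARD('n) * (?n ^ CARD('n) * ellipsoid_count A (d / r)))"
  proof (rule sum_mono)
    fix Q
    have "real (covering_number d (?f ` cball (z Q) (?n * r))) \<le> (8 * ?n) ^ CARD('n) * ellipsoid_count A (d / (?n * r))"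
      using r by (intro covering_number_ellipsoid_le inv d) simp
    also have "ellipsoid_count A (d / (?n * r)) = ellipsoid_count A ((d / r) / ?n)" by (simp add: mult.commute)
    also have "(8 * ?n) ^ CARD('n) * \<dots> \<le> (8 * ?n) ^ CARD('n) * (?n ^ CARD('n) * ellipsoid_count A (d / r))"
      by (intro mult_left_mono ellipsoid_count_rescale) (auto simp: Suc_le_eq)
    finally show "real (covering_number d (?f ` cball (z Q) (?n * r))) \<le> (8 * ?n) ^ CARD('n) * (?n ^ CARD('n) * ellipsoid_count A (d / r))" .
  qed
  also have "\<dots> = (8 * ?n * ?n) ^ CARD('n) * real (covering_number r F) * ellipsoid_count A (d / r)"
    by (simp add: Q(2) power_mult_distrib)
  finally show ?thesis .
qed

text \<open>
  Cover B(ball) by cubes of side r and then the A-image of each of them by cubes of side d. This argument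
  replaces exterior powers in the proof that the singular value function is submultiplicative.
\<close>

theorem ellipsoid_count_mult:
  obtains K :: real where "K \<ge> 1" "\<And>(A::real^'n^'n) B d r. invertible A \<Longrightarrow> invertible B \<Longrightarrow> d > 0 \<Longrightarrow> r > 0 \<Longrightarrow>
     ellipsoid_count (A ** B) d \<le> K * ellipsoid_count A (d / r) * ellipsoid_count B r"
proof -
  let ?n = "real CARD('n)"
  define K where "K = (?n * (?n + 1)) ^ CARD('n) * ((8 * ?n * ?n) ^ CARD('n) * (8 * ?n) ^ CARD('n))"
  have n: "?n \<ge> 1" by (simp add: Suc_le_eq)
  have "K \<ge> 1 * (1 * 1)" unfolding K_def using n
    by (intro mult_mono one_le_power zero_le_power mult_ge1_I) auto
  moreover have "ellipsoid_count (A ** B) d \<le> K * ellipsoid_count A (d / r) * ellipsoid_count B r"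
    if inv: "invertible A" "invertible B" and d: "d > 0" and r: "r > 0" for A B :: "real^'n^'n" and d r
  proof -
    let ?B = "(\<lambda>x. B *v x + 0) ` cball 0 1"
    have "ellipsoid_count (A ** B) d
        \<le> (?n * (?n + 1)) ^ CARD('n) * real (covering_number d ((\<lambda>x. (A ** B) *v x + 0) ` cball 0 1))"
      using covering_number_ellipsoid_ge[where A = "A ** B" and d = d and r = 1 and b = 0 and z = 0] inv d
      by (simp add: invertible_mult)
    also have "(\<lambda>x. (A ** B) *v x + 0) ` cball 0 1 = (\<lambda>x. A *v x + 0) ` ?B"
      by (simp add: image_image matrix_vector_mul_assoc)
    also have "real (covering_number d ((\<lambda>x. A *v x + 0) ` ?B))
       \<le> (8 * ?n * ?n) ^ CARD('n) * real (covering_number r ?B) * ellipsoid_count A (d / r)"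
      by (intro covering_number_image_le inv d r affine_image_cball_bounded)
    also have "real (covering_number r ?B) \<le> (8 * ?n) ^ CARD('n) * ellipsoid_count B (r / 1)"
      by (intro covering_number_ellipsoid_le inv r) simp
    finally show ?thesis
      using ellipsoid_count_ge_1[of A "d / r"] by (simp add: K_def mult_ac)
  qed
  ultimately show thesis using that by simp
qed

section \<open>Extreme singular values\<close>

lemma singular_values_pos:
  fixes A :: "real^'n^'n"
  assumes "invertible A" "i < CARD('n)"
  shows "singular_values A ! i > 0"
  using singular_value_decomposition[OF assms(1)] assms(2) by metis

lemma singular_values_antimono:
  fixes A :: "real^'n^'n"
  assumes "invertible A" "j \<le> i" "i < CARD('n)"
  shows "singular_values A ! i \<le> singular_values A ! j"
  using singular_value_decomposition[OF assms(1)] assms(2,3) by metis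

lemma norm_matrix_bounds:
  fixes A :: "real^'n^'n"
  assumes inv: "invertible A"
  shows "singular_value CARD('n) A * norm x \<le> norm (A *v x)"
    and "norm (A *v x) \<le> singular_value 1 A * norm x"
proof -
  let ?n = "CARD('n)" and ?\<sigma> = "\<lambda>i. singular_values A ! i"
  obtain v u where v: "orthonormal_frame v" and u: "orthonormal_frame u"
    and Av: "\<And>i. i < ?n \<Longrightarrow> A *v v i = ?\<sigma> i *\<^sub>R u i"
    using singular_value_decomposition[OF inv] by metis
  define c where "c i = x \<bullet> v i" for i
  have x: "x = (\<Sum>i<?n. c i *\<^sub>R v i)" by (simp add: c_def orthonormal_frame_expand[OF v])
  have nx: "(norm x)\<^sup>2 = (\<Sum>i<?n. (c i)\<^sup>2)" by (subst x) (rule orthonormal_frame_norm_sum[OF v])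
  have "A *v x = (\<Sum>i<?n. (?\<sigma> i * c i) *\<^sub>R u i)" by (subst x) (rule matrix_vector_mult_frame[OF Av])
  hence nA: "(norm (A *v x))\<^sup>2 = (\<Sum>i<?n. (?\<sigma> i)\<^sup>2 * (c i)\<^sup>2)"
    using orthonormal_frame_norm_sum[OF u, of "\<lambda>i. ?\<sigma> i * c i"] by (simp add: power_mult_distrib)
  have lo: "0 < ?\<sigma> (?n - 1)" "0 < ?\<sigma> 0" using singular_values_pos[OF inv] by simp_all
  have "(?\<sigma> (?n - 1) * norm x)\<^sup>2 = (\<Sum>i<?n. (?\<sigma> (?n - 1))\<^sup>2 * (c i)\<^sup>2)"
    by (simp add: power_mult_distrib nx sum_distrib_left)
  also have "\<dots> \<le> (norm (A *v x))\<^sup>2" unfolding nA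
    using lo(1) by (intro sum_mono mult_right_mono power_mono singular_values_antimono[OF inv]) auto
  finally show "singular_value ?n A * norm x \<le> norm (A *v x)"
    unfolding singular_value_def by (rule power2_le_imp_le) simp
  have "(norm (A *v x))\<^sup>2 \<le> (\<Sum>i<?n. (?\<sigma> 0)\<^sup>2 * (c i)\<^sup>2)" unfolding nA
    using singular_values_pos[OF inv]
    by (intro sum_mono mult_right_mono power_mono singular_values_antimono[OF inv]) (auto intro: less_imp_le)
  also have "\<dots> = (?\<sigma> 0 * norm x)\<^sup>2" by (simp add: power_mult_distrib nx sum_distrib_left)
  finally show "norm (A *v x) \<le> singular_value 1 A * norm x"
    unfolding singular_value_def using lo(2) by (intro power2_le_imp_le[of "norm (A *v x)"]) auto
qed

lemma extreme_singular_values_attained: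
  fixes A :: "real^'n^'n"
  assumes inv: "invertible A" and j: "1 \<le> j" "j \<le> CARD('n)"
  obtains x where "norm x = 1" "norm (A *v x) = singular_value j A"
proof -
  obtain v u where v: "orthonormal_frame v" and u: "orthonormal_frame u"
    and Av: "\<And>i. i < CARD('n) \<Longrightarrow> A *v v i = singular_values A ! i *\<^sub>R u i"
    using singular_value_decomposition[OF inv] by metis
  have "j - 1 < CARD('n)" using j by simp
  with orthonormal_frame_norm[OF v this] orthonormal_frame_norm[OF u this] Av[OF this]
    singular_values_pos[OF inv this] show ?thesis
    by (intro that[of "v (j - 1)"]) (auto simp: singular_value_def)
qed

lemma singular_value_pos:
  fixes A :: "real^'n^'n"
  assumes "invertible A" "1 \<le> j" "j \<le> CARD('n)"
  shows "singular_value j A > 0"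
  using assms singular_values_pos[of A "j - 1"] by (simp add: singular_value_def)

lemma singular_value_min_le_max:
  fixes A :: "real^'n^'n"
  assumes "invertible A"
  shows "singular_value CARD('n) A \<le> singular_value 1 A"
  using singular_values_antimono[OF assms, of 0 "CARD('n) - 1"] by (simp add: singular_value_def)

lemma singular_value_max_le:
  fixes A :: "real^'n^'n"
  assumes "invertible A" "\<And>x. norm (A *v x) \<le> c * norm x"
  shows "singular_value 1 A \<le> c"
proof -
  obtain x where "norm x = 1" "norm (A *v x) = singular_value 1 A"
    by (rule extreme_singular_values_attained[OF assms(1), of 1]) (auto simp: Suc_le_eq)
  thus ?thesis using assms(2)[of x] by simp
qed

lemma singular_value_min_mult_ge:
  fixes A B :: "real^'n^'n"
  assumes "invertible A" "invertible B"
  shows "singular_value CARD('n) A * singular_value CARD('n) B \<le> singular_value CARD('n) (A ** B)"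
proof -
  have inv: "invertible (A ** B)" using assms by (rule invertible_mult)
  obtain x where x: "norm x = 1" "norm ((A ** B) *v x) = singular_value CARD('n) (A ** B)"
    by (rule extreme_singular_values_attained[OF inv, of "CARD('n)"]) (auto simp: Suc_le_eq)
  have "singular_value CARD('n) A * (singular_value CARD('n) B * norm x) \<le> singular_value CARD('n) A * norm (B *v x)"
    using norm_matrix_bounds(1)[OF assms(2)] singular_value_pos[OF assms(1), of "CARD('n)"]
    by (intro mult_left_mono) (auto simp: Suc_le_eq)
  also have "\<dots> \<le> norm ((A ** B) *v x)"
    using norm_matrix_bounds(1)[OF assms(1), of "B *v x"] by (simp add: matrix_vector_mul_assoc)
  finally show ?thesis using x by simp
qed

text \<open>
  Test the lower bound for \<open>A ** B\<close> on the vector that B maps to a unit vector y minimising \<open>norm (A *v y)\<close>.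
\<close>

lemma singular_value_min_mult_le:
  fixes A B :: "real^'n^'n"
  assumes "invertible A" "invertible B"
  shows "singular_value CARD('n) (A ** B) \<le> singular_value CARD('n) A * singular_value 1 B"
proof -
  obtain y where y: "norm y = 1" "norm (A *v y) = singular_value CARD('n) A"
    by (rule extreme_singular_values_attained[OF assms(1), of "CARD('n)"]) (auto simp: Suc_le_eq)
  obtain B' where B': "B ** B' = mat 1" using assms(2) by (auto simp: invertible_def)
  define x where "x = B' *v y"
  have Bx: "B *v x = y" by (simp add: x_def matrix_vector_mul_assoc B')
  have "singular_value CARD('n) (A ** B) * norm x \<le> norm ((A ** B) *v x)"
    by (intro norm_matrix_bounds invertible_mult assms)
  also have "\<dots> = singular_value CARD('n) A" by (metis Bx matrix_vector_mul_assoc y(2))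
  finally have 1: "singular_value CARD('n) (A ** B) * norm x \<le> singular_value CARD('n) A" .
  have 2: "1 \<le> singular_value 1 B * norm x" using norm_matrix_bounds(2)[OF assms(2), of x] by (simp add: Bx y)
  have p: "singular_value CARD('n) (A ** B) > 0" "singular_value 1 B > 0"
    by (intro singular_value_pos invertible_mult assms; simp add: Suc_le_eq)+
  have "singular_value CARD('n) (A ** B) * 1 \<le> singular_value CARD('n) (A ** B) * (singular_value 1 B * norm x)"
    using 2 p by (intro mult_left_mono) auto
  also have "\<dots> = singular_value 1 B * (singular_value CARD('n) (A ** B) * norm x)" by simp
  also have "\<dots> \<le> singular_value 1 B * singular_value CARD('n) A" using 1 p by (intro mult_left_mono) auto
  finally show ?thesis by (simp add: mult.commute)
qed

section \<open>The singular value function\<close>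

text \<open>
  The exponent of \<alpha>_(i+1) in \<phi>^t. The first summand is t - i cut off to the interval [0, 1], and the second
  one, which vanishes for t \<le> n, is the extra power of the determinant for t > n. Writing \<phi>^t as one product
  over all singular values makes continuity and monotonicity in t visible.
\<close>

definition sv_weight :: "nat \<Rightarrow> real \<Rightarrow> nat \<Rightarrow> real" where
  "sv_weight n t i = max 0 (min 1 (t - real i)) + max 0 (t / real n - 1)"

lemma sum_clip: "t \<ge> 0 \<Longrightarrow> (\<Sum>i<n. max 0 (min 1 (t - real i))) = min t (real n)"
  by (induction n) (auto simp: min_def max_def)

lemma sum_sv_weight: "n > 0 \<Longrightarrow> t \<ge> 0 \<Longrightarrow> (\<Sum>i<n. sv_weight n t i) = t"
proof -
  assume n: "n > 0" and t: "t \<ge> 0"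
  have "(\<Sum>i<n. sv_weight n t i) = min t (real n) + real n * max 0 (t / real n - 1)"
    by (simp add: sv_weight_def sum.distrib sum_clip t)
  also have "real n * max 0 (t / real n - 1) = max 0 (t - real n)"
    using n by (simp add: max_def field_simps)
  finally show ?thesis by (simp add: min_def max_def)
qed

lemma sv_weight_mono: "t \<le> t' \<Longrightarrow> sv_weight n t i \<le> sv_weight n t' i"
  unfolding sv_weight_def by (intro add_mono max.mono min.mono diff_right_mono divide_right_mono) auto

lemma sv_weight_le_n: "t \<le> real n \<Longrightarrow> sv_weight n t i = max 0 (min 1 (t - real i))"
  by (cases "n = 0") (auto simp: sv_weight_def max_def field_simps)

lemma sv_function_eq_prod:
  fixes A :: "real^'n^'n"
  assumes inv: "invertible A" and t: "t \<ge> 0"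
  shows "sv_function t A = (\<Prod>i<CARD('n). singular_values A ! i powr sv_weight CARD('n) t i)"
proof -
  let ?n = "CARD('n)" and ?\<sigma> = "\<lambda>i. singular_values A ! i"
  have pos: "?\<sigma> i > 0" if "i < ?n" for i using singular_values_pos[OF inv that] .
  consider "t = 0" | "0 < t" "t \<le> ?n" | "t > ?n" using t by linarith
  thus ?thesis
  proof cases
    case 1
    have "?\<sigma> i powr sv_weight ?n t i = 1" if "i < ?n" for i
      using pos[OF that] 1 by (simp add: sv_weight_def)
    thus ?thesis using 1 by (simp add: sv_function_def)
  next
    case 2
    define p where "p = nat \<lceil>t\<rceil> - 1"
    have m: "nat \<lceil>t\<rceil> = Suc p" using 2(1) unfolding p_def by simp
    have p: "real p < t" "t \<le> real p + 1" using m by linarith+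
    have pn: "Suc p \<le> ?n" using p(1) 2(2) by linarith
    have "sv_function t A = (\<Prod>j\<in>{1..<Suc p}. singular_value j A) * ?\<sigma> p powr (t - real p)"
      using 2 m by (simp add: sv_function_def Let_def singular_value_def)
    also have "(\<Prod>j\<in>{1..<Suc p}. singular_value j A) = (\<Prod>i<p. ?\<sigma> i)"
      unfolding One_nat_def prod.atLeast_Suc_lessThan_Suc_shift
      by (simp add: singular_value_def lessThan_atLeast0)
    also have "\<dots> = (\<Prod>i<p. ?\<sigma> i powr sv_weight ?n t i)"
    proof (intro prod.cong refl)
      fix i assume "i \<in> {..<p}"
      hence "i < ?n" "real i + 1 \<le> t" using pn p(1) by auto
      thus "?\<sigma> i = ?\<sigma> i powr sv_weight ?n t i" using pos[of i] 2(2) by (simp add: sv_weight_le_n)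
    qed
    also have "?\<sigma> p powr (t - real p) = ?\<sigma> p powr sv_weight ?n t p"
      using p 2(2) by (simp add: sv_weight_le_n)
    also have "(\<Prod>i<p. ?\<sigma> i powr sv_weight ?n t i) * ?\<sigma> p powr sv_weight ?n t p
        = (\<Prod>i<Suc p. ?\<sigma> i powr sv_weight ?n t i)" by simp
    also have "\<dots> = (\<Prod>i<?n. ?\<sigma> i powr sv_weight ?n t i)"
    proof (rule prod.mono_neutral_left)
      show "\<forall>i\<in>{..<?n} - {..<Suc p}. ?\<sigma> i powr sv_weight ?n t i = 1"
      proof
        fix i assume i: "i \<in> {..<?n} - {..<Suc p}"
        hence "t - real i \<le> 0" using p(2) by auto
        thus "?\<sigma> i powr sv_weight ?n t i = 1" using i pos[of i] 2(2) by (auto simp: sv_weight_le_n)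
      qed
    qed (use pn in auto)
    finally show ?thesis .
  next
    case 3
    have n: "real ?n > 0" by simp
    have w: "sv_weight ?n t i = t / ?n" if "i < ?n" for i
    proof -
      have "real i + 1 \<le> t" using that 3 by linarith
      thus ?thesis using 3 n by (simp add: sv_weight_def field_simps)
    qed
    have "sv_function t A = (\<Prod>i<?n. ?\<sigma> i) powr (t / ?n)"
      using 3 n by (simp add: sv_function_def abs_det_eq_prod_singular_values[OF inv] del: zero_less_card_finite)
    also have "\<dots> = (\<Prod>i<?n. ?\<sigma> i powr (t / ?n))"
      by (rule prod_powr_distrib)
    also have "\<dots> = (\<Prod>i<?n. ?\<sigma> i powr sv_weight ?n t i)" by (intro prod.cong) (auto simp: w)
    finally show ?thesis .
  qed
qed

lemma sv_function_pos:
  fixes A :: "real^'n^'n"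
  assumes "invertible A" "t \<ge> 0"
  shows "sv_function t A > 0"
  unfolding sv_function_eq_prod[OF assms] using singular_values_pos[OF assms(1)]
  by (intro prod_pos) (auto simp: less_imp_neq[symmetric])

lemma continuous_on_sv_function:
  fixes A :: "real^'n^'n"
  assumes "invertible A"
  shows "continuous_on {0..} (\<lambda>t. sv_function t A)"
proof -
  have "continuous_on {0..} (\<lambda>t. \<Prod>i<CARD('n). singular_values A ! i powr sv_weight CARD('n) t i)"
    unfolding sv_weight_def using less_imp_neq[OF singular_values_pos[OF assms]]
    by (intro continuous_intros) auto
  thus ?thesis by (subst continuous_on_cong[OF refl sv_function_eq_prod[OF assms]]) auto
qed

text \<open>
  Raising t to t + h raises the exponents by non-negative amounts of total h, and each \<alpha>_i is at most \<alpha>_1.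
\<close>

lemma sv_function_add_le:
  fixes A :: "real^'n^'n"
  assumes inv: "invertible A" and t: "t \<ge> 0" and h: "h \<ge> 0"
  shows "sv_function (t + h) A \<le> sv_function t A * singular_value 1 A powr h"
proof -
  let ?n = "CARD('n)" and ?\<sigma> = "\<lambda>i. singular_values A ! i"
  define \<Delta> where "\<Delta> i = sv_weight ?n (t + h) i - sv_weight ?n t i" for i
  have pos: "?\<sigma> i > 0" if "i < ?n" for i using singular_values_pos[OF inv that] .
  have \<Delta>: "\<Delta> i \<ge> 0" for i using sv_weight_mono[of t "t + h" ?n i] h by (simp add: \<Delta>_def)
  have "(\<Sum>i<?n. \<Delta> i) = h" using t h by (simp add: \<Delta>_def sum_subtractf sum_sv_weight)
  have "sv_function (t + h) A = (\<Prod>i<?n. ?\<sigma> i powr sv_weight ?n t i * ?\<sigma> i powr \<Delta> i)"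
    using t h by (simp add: sv_function_eq_prod[OF inv] powr_add[symmetric] \<Delta>_def)
  also have "\<dots> \<le> (\<Prod>i<?n. ?\<sigma> i powr sv_weight ?n t i * ?\<sigma> 0 powr \<Delta> i)"
  proof (rule prod_mono, intro conjI)
    fix i assume "i \<in> {..<?n}"
    hence i: "i < ?n" by simp
    show "?\<sigma> i powr sv_weight ?n t i * ?\<sigma> i powr \<Delta> i \<le> ?\<sigma> i powr sv_weight ?n t i * ?\<sigma> 0 powr \<Delta> i"
      using pos[OF i] singular_values_antimono[OF inv _ i, of 0] \<Delta>
      by (intro mult_left_mono powr_mono2) auto
  qed simp
  also have "\<dots> = sv_function t A * (\<Prod>i<?n. ?\<sigma> 0 powr \<Delta> i)"
    using t by (simp add: sv_function_eq_prod[OF inv] prod.distrib)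
  also have "(\<Prod>i<?n. ?\<sigma> 0 powr \<Delta> i) = ?\<sigma> 0 powr (\<Sum>i<?n. \<Delta> i)"
    using pos[of 0] by (intro powr_sum[symmetric]) auto
  finally show ?thesis using \<open>(\<Sum>i<?n. \<Delta> i) = h\<close> by (simp add: singular_value_def)
qed

lemma powr_times_ellipsoid_count:
  fixes A :: "real^'n^'n"
  assumes t: "0 \<le> t" "t \<le> real CARD('n)" and d: "d > 0"
  shows "d powr t * ellipsoid_count A d
     = (\<Prod>i<CARD('n). d powr sv_weight CARD('n) t i * max 1 (singular_values A ! i / d))"
proof -
  have "d powr t = d powr (\<Sum>i<CARD('n). sv_weight CARD('n) t i)" using t by (simp add: sum_sv_weight)
  also have "\<dots> = (\<Prod>i<CARD('n). d powr sv_weight CARD('n) t i)" using d by (intro powr_sum) auto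
  finally show ?thesis by (simp add: ellipsoid_count_def prod.distrib)
qed

text \<open>
  The weights lie in [0, 1] and sum to t, so d^t can be distributed over the factors; then each factor is the
  inequality x^w \<le> max 1 x with x = \<alpha>_i / d.
\<close>

lemma sv_function_le_ellipsoid_count:
  fixes A :: "real^'n^'n"
  assumes inv: "invertible A" and t: "0 \<le> t" "t \<le> real CARD('n)" and d: "d > 0"
  shows "sv_function t A \<le> d powr t * ellipsoid_count A d"
  unfolding powr_times_ellipsoid_count[OF t d] sv_function_eq_prod[OF inv t(1)]
proof (rule prod_mono, intro conjI)
  fix i assume "i \<in> {..<CARD('n)}"
  define x where "x = singular_values A ! i / d"
  define w where "w = sv_weight CARD('n) t i"
  have x: "x > 0" using singular_values_pos[OF inv, of i] \<open>i \<in> _\<close> d by (simp add: x_def)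
  have w: "0 \<le> w" "w \<le> 1" using t by (auto simp: w_def sv_weight_le_n)
  have "x powr w \<le> max 1 x"
  proof (cases "x \<le> 1")
    case True
    thus ?thesis using x w powr_le1[of w x] by simp
  next
    case False
    thus ?thesis using powr_mono[of w 1 x] w by simp
  qed
  hence "d powr w * x powr w \<le> d powr w * max 1 x" by (intro mult_left_mono) auto
  moreover have "singular_values A ! i = d * x" using d by (simp add: x_def)
  ultimately show "singular_values A ! i powr w \<le> d powr w * max 1 x" using d x by (simp add: powr_mult)
qed simp

text \<open>
  Equality in the previous bound at d = \<alpha>_(p+1): the longer axes have weight 1 and the shorter ones weight 0.
  At integer t there are two admissible p; the upper bound for the box dimension uses p = n - 1 also at t = n - 1.
\<close>

lemma sv_function_eq_ellipsoid_count:
  fixes A :: "real^'n^'n"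
  assumes inv: "invertible A" and t: "0 \<le> t" "t \<le> real CARD('n)" and p: "p < CARD('n)"
    and below: "real p \<le> t \<or> p = 0" and above: "t \<le> real p + 1"
  shows "sv_function t A = singular_values A ! p powr t * ellipsoid_count A (singular_values A ! p)"
proof -
  let ?n = "CARD('n)" and ?\<sigma> = "\<lambda>i. singular_values A ! i"
  have pos: "?\<sigma> i > 0" if "i < ?n" for i using singular_values_pos[OF inv that] .
  show ?thesis
    unfolding powr_times_ellipsoid_count[OF t pos[OF p]] sv_function_eq_prod[OF inv t(1)]
  proof (rule prod.cong)
    fix i assume "i \<in> {..<?n}"
    hence i: "i < ?n" by simp
    consider "i < p" | "i = p" | "i > p" by linarith
    thus "?\<sigma> i powr sv_weight ?n t i = ?\<sigma> p powr sv_weight ?n t i * max 1 (?\<sigma> i / ?\<sigma> p)"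
    proof cases
      case 1
      hence "real i + 1 \<le> t" using below by linarith
      hence "sv_weight ?n t i = 1" using t by (simp add: sv_weight_le_n)
      moreover have "1 \<le> ?\<sigma> i / ?\<sigma> p" using singular_values_antimono[OF inv _ p, of i] 1 pos[OF p] by simp
      ultimately show ?thesis using pos[OF p] pos[OF i] by (simp add: max_def)
    next
      case 2
      thus ?thesis using pos[OF p] by simp
    next
      case 3
      hence "t - real i \<le> 0" using above by linarith
      hence "sv_weight ?n t i = 0" using t by (simp add: sv_weight_le_n)
      moreover have "?\<sigma> i / ?\<sigma> p \<le> 1" using singular_values_antimono[OF inv _ i, of p] 3 pos[OF p] by simp
      ultimately show ?thesis using pos[OF p] pos[OF i] by (simp add: max_def)
    qed
  qed simp
qed

text \<open>
  For t \<le> n take the scales at which \<open>ellipsoid_count\<close> attains \<phi>^t(A) and \<phi>^t(B), and multiply them. For t > n the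
  function is a power of the determinant.
\<close>

theorem sv_function_mult:
  obtains K :: real where "K \<ge> 1" "\<And>(A::real^'n^'n) B t. invertible A \<Longrightarrow> invertible B \<Longrightarrow> t \<ge> 0 \<Longrightarrow>
     sv_function t (A ** B) \<le> K * sv_function t A * sv_function t B"
proof -
  obtain K :: real where K: "K \<ge> 1" "\<And>(A::real^'n^'n) B d r. invertible A \<Longrightarrow> invertible B \<Longrightarrow> d > 0 \<Longrightarrow> r > 0 \<Longrightarrow>
     ellipsoid_count (A ** B) d \<le> K * ellipsoid_count A (d / r) * ellipsoid_count B r"
    using ellipsoid_count_mult by metis
  have "sv_function t (A ** B) \<le> K * sv_function t A * sv_function t B"
    if inv: "invertible A" "invertible B" and t: "t \<ge> 0" for A B :: "real^'n^'n" and t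
  proof (cases "t \<le> real CARD('n)")
    case True
    \<comment> \<open>For 0 < t this is the index of the fractional factor; at t = 0 the truncated difference gives p = 0.\<close>
    define p where "p = nat \<lceil>t\<rceil> - 1"
    have p: "real p \<le> t \<or> p = 0" "t \<le> real p + 1" "p < CARD('n)"
    proof -
      show "p < CARD('n)"
      proof (cases "t = 0")
        case True
        thus ?thesis by (simp add: p_def)
      next
        case False
        have "\<lceil>t\<rceil> \<le> int CARD('n)" using True by (simp add: ceiling_le_iff)
        thus ?thesis using False t zero_less_card_finite[where 'a = 'n] unfolding p_def by linarith
      qed
    qed (use t in \<open>unfold p_def, linarith+\<close>)
    define a where "a = singular_values A ! p"
    define b where "b = singular_values B ! p"
    have ab: "a > 0" "b > 0" using singular_values_pos inv p(3) by (auto simp: a_def b_def)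
    have "sv_function t (A ** B) \<le> (a * b) powr t * ellipsoid_count (A ** B) (a * b)"
      using ab by (intro sv_function_le_ellipsoid_count invertible_mult inv t True) simp
    also have "\<dots> \<le> (a * b) powr t * (K * ellipsoid_count A (a * b / b) * ellipsoid_count B b)"
      using ab by (intro mult_left_mono K inv) auto
    also have "\<dots> = K * (a powr t * ellipsoid_count A a) * (b powr t * ellipsoid_count B b)"
      using ab by (simp add: powr_mult)
    also have "\<dots> = K * sv_function t A * sv_function t B"
      using sv_function_eq_ellipsoid_count[OF inv(1) t True p(3,1,2)]
        sv_function_eq_ellipsoid_count[OF inv(2) t True p(3,1,2)] by (simp add: a_def b_def)
    finally show ?thesis .
  next
    case False
    hence "sv_function t (A ** B) = 1 * sv_function t A * sv_function t B"
      using t by (simp add: sv_function_def det_mul abs_mult powr_mult)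
    also have "\<dots> \<le> K * sv_function t A * sv_function t B"
      using K(1) sv_function_pos[OF inv(1) t] sv_function_pos[OF inv(2) t]
      by (intro mult_right_mono) (auto intro: less_imp_le)
    finally show ?thesis .
  qed
  thus thesis using that K(1) by blast
qed

section \<open>Submultiplicative weights on words\<close>

lemma finite_lists_bounded_length:
  "finite I \<Longrightarrow> finite {w \<in> lists I. length w \<le> L}"
  by (rule finite_subset[OF _ finite_lists_length_le[of I L]]) (auto simp: lists_eq_set)

definition partial_weight :: "'a set \<Rightarrow> ('a list \<Rightarrow> real) \<Rightarrow> nat \<Rightarrow> real" where
  "partial_weight I f L = (\<Sum>w\<in>{w \<in> lists I. length w \<le> L}. f w)"

text \<open>
  Removing the prefix in Q from a word outside R leaves a word that is no longer, so the partial sums T(L) satisfy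
  T(L) \<le> \<Sum>_R f + K (\<Sum>_Q f) T(L). Since T(L) is finite, this can be solved for T(L).
\<close>

lemma cut_set_bounds_partial_weight:
  fixes f :: "'a list \<Rightarrow> real"
  assumes I: "finite I" and nonneg: "\<And>w. w \<in> lists I \<Longrightarrow> f w \<ge> 0"
    and mult: "\<And>u v. u \<in> lists I \<Longrightarrow> v \<in> lists I \<Longrightarrow> f (u @ v) \<le> K * f u * f v"
    and K: "K \<ge> 0"
    and Q: "finite Q" "Q \<subseteq> lists I" and R: "finite R" "R \<subseteq> lists I"
    and cut: "\<And>w. w \<in> lists I \<Longrightarrow> w \<in> R \<or> (\<exists>p\<in>Q. \<exists>v. w = p @ v)"
    and small: "K * sum f Q < 1"
  shows "\<exists>M. \<forall>L. partial_weight I f L \<le> M"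
proof -
  have "partial_weight I f L \<le> sum f R / (1 - K * sum f Q)" for L
  proof -
    let ?V = "{w \<in> lists I. length w \<le> L}"
    have finV: "finite ?V" by (rule finite_lists_bounded_length[OF I])
    have sub: "?V \<subseteq> R \<union> (\<lambda>(p, v). p @ v) ` (Q \<times> ?V)"
    proof
      fix w assume w: "w \<in> ?V"
      hence "w \<in> R \<or> (\<exists>p\<in>Q. \<exists>v. w = p @ v)" using cut by blast
      thus "w \<in> R \<union> (\<lambda>(p, v). p @ v) ` (Q \<times> ?V)"
      proof
        assume "\<exists>p\<in>Q. \<exists>v. w = p @ v"
        then obtain p v where pv: "p \<in> Q" "w = p @ v" by blast
        hence "(p, v) \<in> Q \<times> ?V" using w by auto
        thus ?thesis using pv(2) by (intro UnI2 image_eqI[of _ _ "(p, v)"]) auto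
      qed simp
    qed
    have "partial_weight I f L \<le> sum f (R \<union> (\<lambda>(p, v). p @ v) ` (Q \<times> ?V))"
      unfolding partial_weight_def
    proof (rule sum_mono2[OF _ sub])
      show "finite (R \<union> (\<lambda>(p, v). p @ v) ` (Q \<times> ?V))" using finV Q(1) R(1) by simp
      fix w assume "w \<in> R \<union> (\<lambda>(p, v). p @ v) ` (Q \<times> ?V) - ?V"
      moreover have "(\<lambda>(p, v). p @ v) ` (Q \<times> ?V) \<subseteq> lists I"
        using Q(2) by (force simp: subset_iff in_lists_conv_set)
      ultimately have "w \<in> lists I" using R(2) by blast
      thus "0 \<le> f w" by (rule nonneg)
    qed
    also have "\<dots> \<le> sum f R + sum f ((\<lambda>(p, v). p @ v) ` (Q \<times> ?V))"
    proof -
      have "0 \<le> sum f (R \<inter> (\<lambda>(p, v). p @ v) ` (Q \<times> ?V))"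
        using R(2) nonneg by (intro sum_nonneg) blast
      thus ?thesis using sum.union_inter[of R "(\<lambda>(p, v). p @ v) ` (Q \<times> ?V)" f] R(1) Q(1) finV by simp
    qed
    also have "sum f ((\<lambda>(p, v). p @ v) ` (Q \<times> ?V)) \<le> (\<Sum>x\<in>Q \<times> ?V. f (case x of (p, v) \<Rightarrow> p @ v))"
    proof -
      have "sum f ((\<lambda>(p, v). p @ v) ` (Q \<times> ?V)) \<le> sum (f \<circ> (\<lambda>(p, v). p @ v)) (Q \<times> ?V)"
      proof (rule sum_image_le)
        show "0 \<le> f (case x of (p, v) \<Rightarrow> p @ v)" if "x \<in> Q \<times> ?V" for x
          using that Q(2) by (intro nonneg) (auto simp: subset_iff in_lists_conv_set split: prod.splits)
      qed (use Q(1) finV in simp)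
      thus ?thesis by (simp add: o_def)
    qed
    also have "\<dots> \<le> (\<Sum>x\<in>Q \<times> ?V. case x of (p, v) \<Rightarrow> K * f p * f v)"
    proof (rule sum_mono)
      fix x assume "x \<in> Q \<times> ?V"
      then obtain p v where "x = (p, v)" "p \<in> Q" "v \<in> ?V" by blast
      thus "f (case x of (p, v) \<Rightarrow> p @ v) \<le> (case x of (p, v) \<Rightarrow> K * f p * f v)"
        using mult[of p v] Q(2) by (simp add: subset_iff)
    qed
    also have "\<dots> = K * sum f Q * partial_weight I f L"
      unfolding partial_weight_def mult.assoc sum_product
      by (simp add: sum.cartesian_product[symmetric] sum_distrib_left)
    finally have "partial_weight I f L * (1 - K * sum f Q) \<le> sum f R" by (simp add: algebra_simps)
    thus ?thesis using small by (simp add: pos_le_divide_eq)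
  qed
  thus ?thesis by blast
qed

section \<open>Words of an affine iterated function system\<close>

lemma linear_part_affine: "linear_part (\<lambda>x. A *v x + b) = A"
  by (simp add: linear_part_def matrix_of_matrix_vector_mul)

lemma word_map_append: "word_map S (u @ v) = word_map S u \<circ> word_map S v"
  by (induction u) (auto simp: o_assoc)

locale contracting_affine_IFS =
  fixes N :: nat and S :: "nat \<Rightarrow> real^'n \<Rightarrow> real^'n"
  assumes ifs: "affine_IFS N S"
begin

abbreviation all_words :: "nat list set" where "all_words \<equiv> lists {1..N}"

abbreviation lin :: "nat list \<Rightarrow> real^'n^'n" where "lin w \<equiv> linear_part (word_map S w)"

abbreviation smin :: "nat list \<Rightarrow> real" where "smin w \<equiv> singular_value CARD('n) (lin w)"

abbreviation smax :: "nat list \<Rightarrow> real" where "smax w \<equiv> singular_value 1 (lin w)"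

lemma N_pos: "N \<ge> 1" using ifs by (simp add: affine_IFS_def)

lemma word_map_affine_invertible:
  assumes "w \<in> all_words"
  shows "\<exists>A b. invertible A \<and> word_map S w = (\<lambda>x. A *v x + b)"
  using assms
proof (induction w)
  case Nil
  show ?case by (intro exI[of _ "mat 1"] exI[of _ 0]) (auto simp: invertible_def)
next
  case (Cons i w)
  then obtain A b where 1: "invertible A" "word_map S w = (\<lambda>x. A *v x + b)" by auto
  have "i \<in> {1..N}" using Cons.hyps by simp
  then obtain A' b' where 2: "invertible A'" "S i = (\<lambda>x. A' *v x + b')"
    using ifs unfolding affine_IFS_def by blast
  have "word_map S (i # w) = (\<lambda>x. (A' ** A) *v x + (A' *v b + b'))"
    by (simp add: 1 2 fun_eq_iff matrix_vector_right_distrib matrix_vector_mul_assoc)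
  thus ?case using invertible_mult[OF 2(1) 1(1)] by blast
qed

lemma word_map_eq: "w \<in> all_words \<Longrightarrow> word_map S w = (\<lambda>x. lin w *v x + word_map S w 0)"
  and invertible_lin: "w \<in> all_words \<Longrightarrow> invertible (lin w)"
proof -
  assume "w \<in> all_words"
  from word_map_affine_invertible[OF this] obtain A b where
    A: "invertible A" "word_map S w = (\<lambda>x. A *v x + b)" by blast
  have e: "lin w = A" unfolding A(2) by (rule linear_part_affine)
  show "word_map S w = (\<lambda>x. lin w *v x + word_map S w 0)" unfolding e unfolding A(2) by simp
  show "invertible (lin w)" unfolding e by (rule A(1))
qed

lemma word_map_diff:
  assumes "w \<in> all_words"
  shows "word_map S w x - word_map S w y = lin w *v (x - y)"
  using word_map_eq[OF assms] by (metis add_diff_cancel_right matrix_vector_mult_diff_distrib)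

lemma lin_Nil: "linear_part (word_map S []) = mat 1"
  using linear_part_affine[of "mat 1 :: real^'n^'n" 0] by (simp add: id_def)

lemma lin_append:
  assumes "u \<in> all_words" "v \<in> all_words"
  shows "lin (u @ v) = lin u ** lin v"
proof -
  have "word_map S (u @ v) = (\<lambda>x. (lin u ** lin v) *v x + (lin u *v word_map S v 0 + word_map S u 0))"
    unfolding word_map_append by (subst word_map_eq[OF assms(1)], subst word_map_eq[OF assms(2)])
      (simp add: fun_eq_iff matrix_vector_right_distrib matrix_vector_mul_assoc)
  thus ?thesis using linear_part_affine by metis
qed

lemma smin_pos: "w \<in> all_words \<Longrightarrow> smin w > 0"
  by (rule singular_value_pos[OF invertible_lin]) (auto simp: Suc_le_eq)

lemma smax_pos: "w \<in> all_words \<Longrightarrow> smax w > 0"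
  by (rule singular_value_pos[OF invertible_lin]) (auto simp: Suc_le_eq)

lemma smin_le_smax: "w \<in> all_words \<Longrightarrow> smin w \<le> smax w"
  by (rule singular_value_min_le_max[OF invertible_lin])

lemma smin_Nil: "smin [] = 1"
proof -
  have "invertible (lin [])" by (rule invertible_lin) simp
  then obtain x where "norm x = 1" "norm (lin [] *v x) = smin []"
    by (rule extreme_singular_values_attained[of _ "CARD('n)"]) (auto simp: Suc_le_eq)
  thus ?thesis using lin_Nil by simp
qed

text \<open>
  A common contraction ratio of the finitely many maps.
\<close>

definition ratio :: real where
  "ratio = (SOME c. 0 < c \<and> c < 1 \<and> (\<forall>i\<in>{1..N}. \<forall>x y. norm (S i x - S i y) \<le> c * norm (x - y)))"

lemma ratio: "0 < ratio" "ratio < 1" "i \<in> {1..N} \<Longrightarrow> norm (S i x - S i y) \<le> ratio * norm (x - y)"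
proof -
  have "\<exists>c. 0 < c \<and> c < 1 \<and> (\<forall>x y. norm (S i x - S i y) \<le> c * norm (x - y))" if "i \<in> {1..N}" for i
  proof -
    have "\<exists>c\<in>{0<..<1}. \<forall>x y. norm (S i x - S i y) \<le> c * norm (x - y)"
      using ifs[unfolded affine_IFS_def, THEN conjunct2, rule_format, OF that] by (rule conjunct2)
    then obtain c where "c \<in> {0<..<1}" "\<forall>x y. norm (S i x - S i y) \<le> c * norm (x - y)" ..
    thus ?thesis by (intro exI[of _ c]) simp
  qed
  then obtain c where c: "\<And>i. i \<in> {1..N} \<Longrightarrow> 0 < c i \<and> c i < 1 \<and> (\<forall>x y. norm (S i x - S i y) \<le> c i * norm (x - y))"
    by metis
  define m where "m = Max (c ` {1..N})"
  have ne: "finite (c ` {1..N})" "c ` {1..N} \<noteq> {}" using N_pos by auto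
  have "m \<in> c ` {1..N}" unfolding m_def by (rule Max_in[OF ne])
  hence m: "0 < m" "m < 1" using c by auto
  have "norm (S i x - S i y) \<le> m * norm (x - y)" if "i \<in> {1..N}" for i x y
  proof -
    have "c i \<le> m" unfolding m_def using that ne by (intro Max_ge) auto
    hence "c i * norm (x - y) \<le> m * norm (x - y)" by (intro mult_right_mono) auto
    thus ?thesis using c[OF that] by (meson order_trans)
  qed
  hence "\<exists>c. 0 < c \<and> c < 1 \<and> (\<forall>i\<in>{1..N}. \<forall>x y. norm (S i x - S i y) \<le> c * norm (x - y))"
    using m by blast
  from someI_ex[OF this, folded ratio_def]
  show "0 < ratio" "ratio < 1" "i \<in> {1..N} \<Longrightarrow> norm (S i x - S i y) \<le> ratio * norm (x - y)" by auto
qed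

lemma word_map_contraction:
  assumes "w \<in> all_words"
  shows "norm (word_map S w x - word_map S w y) \<le> ratio ^ length w * norm (x - y)"
  using assms
proof (induction w)
  case (Cons i w)
  have "norm (word_map S (i # w) x - word_map S (i # w) y) \<le> ratio * norm (word_map S w x - word_map S w y)"
    using Cons.hyps ratio(3)[of i] by simp
  also have "\<dots> \<le> ratio * (ratio ^ length w * norm (x - y))"
    using Cons ratio(1) by (intro mult_left_mono) auto
  finally show ?case by simp
qed simp

lemma smax_le:
  assumes "w \<in> all_words"
  shows "smax w \<le> ratio ^ length w"
proof (rule singular_value_max_le[OF invertible_lin[OF assms]])
  fix x
  show "norm (lin w *v x) \<le> ratio ^ length w * norm x"
    using word_map_contraction[OF assms, of x 0] word_map_diff[OF assms, of x 0] by simp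
qed

lemma smax_le_1: "w \<in> all_words \<Longrightarrow> smax w \<le> 1"
  using smax_le[of w] power_le_one[of ratio "length w"] ratio(1,2) by linarith

lemma smin_append_le:
  assumes "u \<in> all_words" "v \<in> all_words"
  shows "smin (u @ v) \<le> smin u"
proof -
  have "smin (u @ v) \<le> smin u * smax v"
    unfolding lin_append[OF assms] by (intro singular_value_min_mult_le invertible_lin assms)
  also have "\<dots> \<le> smin u * 1" using smin_pos[OF assms(1)] smax_le_1[OF assms(2)] by (intro mult_left_mono) auto
  finally show ?thesis by simp
qed

text \<open>
  A lower bound for the factor by which appending one letter shrinks the smallest singular value.
\<close>

definition amin :: real where "amin = Min ((\<lambda>i. smin [i]) ` {1..N})"

lemma amin_pos: "amin > 0" and amin_le: "i \<in> {1..N} \<Longrightarrow> amin \<le> smin [i]"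
proof -
  have ne: "finite ((\<lambda>i. smin [i]) ` {1..N})" "(\<lambda>i. smin [i]) ` {1..N} \<noteq> {}" using N_pos by auto
  have "amin \<in> (\<lambda>i. smin [i]) ` {1..N}" unfolding amin_def by (rule Min_in[OF ne])
  then obtain j where "j \<in> {1..N}" "amin = smin [j]" by blast
  thus "amin > 0" using smin_pos[of "[j]"] by simp
  show "i \<in> {1..N} \<Longrightarrow> amin \<le> smin [i]" unfolding amin_def using ne by (intro Min_le) auto
qed

lemma smin_snoc_ge:
  assumes "w \<in> all_words" "i \<in> {1..N}"
  shows "amin * smin w \<le> smin (w @ [i])"
proof -
  have i: "[i] \<in> all_words" using assms(2) by simp
  have "amin * smin w \<le> smin w * smin [i]"
    using amin_le[OF assms(2)] smin_pos[OF assms(1)] by (subst mult.commute) (intro mult_left_mono, auto)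
  also have "\<dots> \<le> smin (w @ [i])"
    unfolding lin_append[OF assms(1) i] by (intro singular_value_min_mult_ge invertible_lin assms i)
  finally show ?thesis .
qed

section \<open>The critical exponent\<close>

abbreviation weight :: "real \<Rightarrow> nat list \<Rightarrow> real" where "weight t w \<equiv> sv_function t (lin w)"

text \<open>
  Convergence of the series of \<phi>^t over all words, expressed by bounded partial sums because the terms are
  non-negative.
\<close>

definition summable_exponent :: "real \<Rightarrow> bool" where
  "summable_exponent t \<longleftrightarrow> (\<exists>M. \<forall>L. partial_weight {1..N} (weight t) L \<le> M)"

definition submult_const :: real where
  "submult_const = (SOME K. K \<ge> 1 \<and> (\<forall>(A::real^'n^'n) B t. invertible A \<longrightarrow> invertible B \<longrightarrow> t \<ge> 0 \<longrightarrow>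
     sv_function t (A ** B) \<le> K * sv_function t A * sv_function t B))"

lemma submult_const_ge_1: "submult_const \<ge> 1"
  and weight_append: "u \<in> all_words \<Longrightarrow> v \<in> all_words \<Longrightarrow> t \<ge> 0 \<Longrightarrow>
    weight t (u @ v) \<le> submult_const * weight t u * weight t v"
proof -
  have "\<exists>K. K \<ge> 1 \<and> (\<forall>(A::real^'n^'n) B t. invertible A \<longrightarrow> invertible B \<longrightarrow> t \<ge> 0 \<longrightarrow>
     sv_function t (A ** B) \<le> K * sv_function t A * sv_function t B)"
    using sv_function_mult[where 'n = 'n] by metis
  from someI_ex[OF this, folded submult_const_def]
  show "submult_const \<ge> 1" "u \<in> all_words \<Longrightarrow> v \<in> all_words \<Longrightarrow> t \<ge> 0 \<Longrightarrow>
    weight t (u @ v) \<le> submult_const * weight t u * weight t v"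
    by (auto simp: lin_append invertible_lin)
qed

lemma weight_pos: "w \<in> all_words \<Longrightarrow> t \<ge> 0 \<Longrightarrow> weight t w > 0"
  by (intro sv_function_pos invertible_lin)

lemma weight_add_le:
  assumes "w \<in> all_words" "t \<ge> 0" "h \<ge> 0"
  shows "weight (t + h) w \<le> weight t w * (ratio powr h) ^ length w"
proof -
  have "weight (t + h) w \<le> weight t w * smax w powr h"
    by (intro sv_function_add_le invertible_lin assms)
  also have "smax w powr h \<le> (ratio ^ length w) powr h"
    using smax_le[OF assms(1)] smax_pos[OF assms(1)] assms(3) by (intro powr_mono2) auto
  hence "weight t w * smax w powr h \<le> weight t w * (ratio ^ length w) powr h"
    using weight_pos[OF assms(1,2)] by (intro mult_left_mono) auto
  also have "(ratio ^ length w) powr h = (ratio powr h) ^ length w"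
    using ratio(1) by (simp add: powr_realpow[symmetric] powr_powr mult.commute)
  finally show ?thesis .
qed

text \<open>
  The contrapositive of \<open>cut_set_bounds_partial_weight\<close>: below the critical exponent every finite cut set
  carries a weight that is bounded away from 0. It is applied to the words of a fixed length and to the
  stopping words.
\<close>

lemma cut_set_weight_ge:
  assumes t: "t \<ge> 0" "\<not> summable_exponent t"
    and Q: "finite Q" "Q \<subseteq> all_words" and R: "finite R" "R \<subseteq> all_words"
    and cut: "\<And>w. w \<in> all_words \<Longrightarrow> w \<in> R \<or> (\<exists>p\<in>Q. \<exists>v. w = p @ v)"
  shows "1 \<le> submult_const * (\<Sum>w\<in>Q. weight t w)"
proof (rule ccontr)
  assume "\<not> ?thesis"
  hence "submult_const * (\<Sum>w\<in>Q. weight t w) < 1" by simp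
  moreover have "0 \<le> weight t w" if "w \<in> all_words" for w using weight_pos[OF that t(1)] by simp
  moreover have "0 \<le> submult_const" using submult_const_ge_1 by simp
  ultimately have "\<exists>M. \<forall>L. partial_weight {1..N} (weight t) L \<le> M"
    using weight_append[OF _ _ t(1)]
    by (intro cut_set_bounds_partial_weight[where Q = Q and R = R and K = submult_const] Q R cut) simp_all
  hence "summable_exponent t" by (simp only: summable_exponent_def)
  with t(2) show False ..
qed

definition level_weight :: "nat \<Rightarrow> real \<Rightarrow> real" where
  "level_weight k t = (\<Sum>w\<in>words_of_length N k. weight t w)"

lemma words_of_length_eq: "words_of_length N k = {w \<in> all_words. length w = k}"
  by (auto simp: words_of_length_def lists_eq_set)

lemma finite_words_of_length: "finite (words_of_length N k)"
  unfolding words_of_length_eq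
  by (rule finite_subset[OF _ finite_lists_bounded_length[of "{1..N}" k]]) auto

lemma card_words_of_length: "card (words_of_length N k) = N ^ k"
  using card_lists_length_eq[of "{1..N}" k] by (simp add: words_of_length_def conj_commute)

lemma partial_weight_eq: "partial_weight {1..N} (weight t) L = (\<Sum>k\<le>L. level_weight k t)"
proof -
  have "{w \<in> all_words. length w \<le> L} = (\<Union>k\<in>{..L}. words_of_length N k)"
    by (auto simp: words_of_length_eq)
  moreover have "sum (weight t) (\<Union>k\<in>{..L}. words_of_length N k) = (\<Sum>k\<le>L. level_weight k t)"
    unfolding level_weight_def
    using finite_words_of_length by (intro sum.UNION_disjoint) (auto simp: words_of_length_eq)
  ultimately show ?thesis by (simp add: partial_weight_def)
qed

lemma level_weight_pos: "t \<ge> 0 \<Longrightarrow> level_weight k t > 0"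
proof -
  assume t: "t \<ge> 0"
  have "card (words_of_length N k) > 0" using N_pos by (simp add: card_words_of_length)
  hence "words_of_length N k \<noteq> {}" by auto
  thus ?thesis unfolding level_weight_def using t
    by (intro sum_pos finite_words_of_length weight_pos) (auto simp: words_of_length_eq)
qed

lemma level_weight_add_le:
  assumes "t \<ge> 0" "h \<ge> 0"
  shows "level_weight k (t + h) \<le> level_weight k t * (ratio powr h) ^ k"
  unfolding level_weight_def sum_distrib_right
  using weight_add_le[OF _ assms] by (intro sum_mono) (force simp: words_of_length_eq)

lemma ratio_powr: "h \<ge> 0 \<Longrightarrow> 0 < ratio powr h" "h \<ge> 0 \<Longrightarrow> ratio powr h \<le> 1" "h > 0 \<Longrightarrow> ratio powr h < 1"
  using ratio(1,2) by (auto intro: powr_le1 simp: powr_def mult_pos_neg mult_nonneg_nonpos)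

lemma level_weight_antimono:
  assumes "0 \<le> t" "t \<le> t'"
  shows "level_weight k t' \<le> level_weight k t"
proof -
  have "level_weight k t' \<le> level_weight k t * (ratio powr (t' - t)) ^ k"
    using level_weight_add_le[of t "t' - t" k] assms by simp
  also have "\<dots> \<le> level_weight k t * 1"
    using level_weight_pos[OF assms(1), of k] ratio_powr(1,2)[of "t' - t"] assms
    by (intro mult_left_mono power_le_one) auto
  finally show ?thesis by simp
qed

lemma level_weight_0: "level_weight k 0 = real N ^ k"
  by (simp add: level_weight_def sv_function_def card_words_of_length)

text \<open>
  The similarity-dimension bound: the root t of N ratio^t = 1. It serves as the right end of the interval in which the
  intermediate value theorem finds the level exponents.
\<close>

definition big_exponent :: real where "big_exponent = ln (real N) / (- ln ratio)"

lemma big_exponent: "big_exponent \<ge> 0" "ratio powr big_exponent = 1 / real N"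
proof -
  have "ln ratio < 0" using ratio(1,2) by simp
  thus "big_exponent \<ge> 0" using N_pos by (simp add: big_exponent_def field_simps)
  show "ratio powr big_exponent = 1 / real N"
    using \<open>ln ratio < 0\<close> ratio(1) N_pos by (simp add: powr_def big_exponent_def exp_minus field_simps)
qed

lemma level_weight_big_exponent: "level_weight k big_exponent \<le> 1"
proof -
  have "level_weight k (0 + big_exponent) \<le> level_weight k 0 * (ratio powr big_exponent) ^ k"
    by (intro level_weight_add_le big_exponent) simp
  thus ?thesis using N_pos by (simp add: big_exponent level_weight_0 power_one_over)
qed

text \<open>
  The level sums are continuous, strictly decreasing for k \<ge> 1, at least 1 at 0 and at most 1 at \<open>big_exponent\<close>.
\<close>

lemma level_exponent:
  assumes k: "k \<ge> 1"
  shows "level_exponent N S k \<ge> 0" "level_weight k (level_exponent N S k) = 1"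
proof -
  have "continuous_on {0..big_exponent} (\<lambda>t. level_weight k t)"
    unfolding level_weight_def
    by (intro continuous_on_sum continuous_on_subset[OF continuous_on_sv_function] invertible_lin)
       (auto simp: words_of_length_eq)
  moreover have "1 \<le> level_weight k 0" using N_pos by (simp add: level_weight_0)
  ultimately obtain t where t: "0 \<le> t" "level_weight k t = 1"
    using IVT2'[of "level_weight k" big_exponent 1 0] level_weight_big_exponent[of k] big_exponent(1) by auto
  have uniq: "\<not> t1 < t2" if "0 \<le> t1" "level_weight k t1 = 1" "level_weight k t2 = 1" for t1 t2
  proof
    assume "t1 < t2"
    hence "(ratio powr (t2 - t1)) ^ k < 1"
      using ratio_powr[of "t2 - t1"] k by (intro power_less_one_iff[THEN iffD2]) auto
    moreover have "level_weight k t2 \<le> level_weight k t1 * (ratio powr (t2 - t1)) ^ k"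
      using level_weight_add_le[of t1 "t2 - t1" k] that \<open>t1 < t2\<close> by simp
    ultimately show False using that by simp
  qed
  have "level_exponent N S k = t" unfolding level_exponent_def level_weight_def[symmetric]
    using t uniq by (intro the_equality) (auto intro: antisym_conv3[THEN iffD1])
  thus "level_exponent N S k \<ge> 0" "level_weight k (level_exponent N S k) = 1" using t by auto
qed

lemma summable_exponent_level_weight:
  assumes "t \<ge> 0" "summable_exponent t"
  shows "(\<lambda>k. level_weight k t) \<longlonglongrightarrow> 0"
proof -
  obtain M where "\<And>L. (\<Sum>k\<le>L. level_weight k t) \<le> M"
    using assms(2) unfolding summable_exponent_def partial_weight_eq by blast
  hence "summable (\<lambda>k. level_weight k t)"
    using level_weight_pos[OF assms(1)] by (intro bounded_imp_summable[of _ M]) (auto intro: less_imp_le)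
  thus ?thesis by (rule summable_LIMSEQ_zero)
qed

lemma summable_exponent_mono:
  assumes "0 \<le> t" "t \<le> t'" "summable_exponent t"
  shows "summable_exponent t'"
proof -
  obtain M where M: "\<And>L. (\<Sum>k\<le>L. level_weight k t) \<le> M"
    using assms(3) unfolding summable_exponent_def partial_weight_eq by blast
  have "(\<Sum>k\<le>L. level_weight k t') \<le> M" for L
    using sum_mono[of "{..L}" "\<lambda>k. level_weight k t'" "\<lambda>k. level_weight k t"]
      level_weight_antimono[OF assms(1,2)] M[of L] by fastforce
  thus ?thesis unfolding summable_exponent_def partial_weight_eq by blast
qed

lemma level_weight_ge_of_not_summable:
  assumes "t \<ge> 0" "\<not> summable_exponent t"
  shows "1 \<le> submult_const * level_weight k t"
  unfolding level_weight_def
proof (rule cut_set_weight_ge[OF assms, where R = "{w \<in> all_words. length w \<le> k}"])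
  fix w assume w: "w \<in> all_words"
  show "w \<in> {w \<in> all_words. length w \<le> k} \<or> (\<exists>p\<in>words_of_length N k. \<exists>v. w = p @ v)"
  proof (cases "length w \<le> k")
    case False
    hence "take k w \<in> words_of_length N k" using w by (auto simp: words_of_length_eq dest: in_set_takeD)
    thus ?thesis by (metis append_take_drop_id)
  qed (use w in simp)
next
  show "finite (words_of_length N k)" by (rule finite_words_of_length)
  show "finite {w \<in> all_words. length w \<le> k}" by (rule finite_lists_bounded_length) simp
qed (auto simp: words_of_length_eq)

definition critical_exponent :: real where
  "critical_exponent = Inf {t. 0 \<le> t \<and> summable_exponent t}"

lemma ex_summable_exponent: "\<exists>t\<ge>0. summable_exponent t"
proof (rule ccontr)
  assume no: "\<not> ?thesis"
  have "level_weight 1 (big_exponent + real m) \<le> ratio ^ m" for m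
  proof -
    have "level_weight 1 (big_exponent + real m) \<le> level_weight 1 big_exponent * (ratio powr real m) ^ 1"
      by (intro level_weight_add_le big_exponent) simp
    also have "\<dots> \<le> 1 * (ratio powr real m) ^ 1"
      by (intro mult_right_mono level_weight_big_exponent) simp
    finally show ?thesis using ratio(1) by (simp add: powr_realpow)
  qed
  hence 1: "1 \<le> submult_const * ratio ^ m" for m
    using level_weight_ge_of_not_summable[of "big_exponent + real m" 1] no big_exponent(1) submult_const_ge_1
      mult_left_mono[of "level_weight 1 (big_exponent + real m)" "ratio ^ m" submult_const]
    by (smt (verit) of_nat_0_le_iff)
  have "(\<lambda>m. submult_const * ratio ^ m) \<longlonglongrightarrow> submult_const * 0"
    using ratio(1,2) by (intro tendsto_intros LIMSEQ_realpow_zero) auto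
  hence "eventually (\<lambda>m. submult_const * ratio ^ m < 1) sequentially"
    by (intro order_tendstoD) auto
  then obtain m where "submult_const * ratio ^ m < 1" by (auto simp: eventually_sequentially)
  with 1[of m] show False by simp
qed

lemma critical_exponent_nonneg: "critical_exponent \<ge> 0"
  unfolding critical_exponent_def using ex_summable_exponent by (intro cInf_greatest) auto

lemma summable_above_critical:
  assumes "t > critical_exponent"
  shows "summable_exponent t"
proof -
  have "{t. 0 \<le> t \<and> summable_exponent t} \<noteq> {}" using ex_summable_exponent by auto
  from cInf_lessD[OF this assms[unfolded critical_exponent_def]]
  obtain t' where "t' \<in> {t. 0 \<le> t \<and> summable_exponent t}" "t' < t" ..
  thus ?thesis using summable_exponent_mono[of t' t] by auto
qed

lemma not_summable_below_critical:
  assumes "0 \<le> t" "t < critical_exponent"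
  shows "\<not> summable_exponent t"
proof
  assume "summable_exponent t"
  hence "critical_exponent \<le> t" unfolding critical_exponent_def
    using assms(1) by (intro cInf_lower bdd_belowI[of _ 0]) auto
  with assms(2) show False by simp
qed

text \<open>
  Above the critical exponent the level sums tend to 0, so they are eventually below 1 and the level exponents
  are smaller. Below it, at b, every level sum is at least 1 / K; a level exponent at most a < b would make the sum
  over level k at b at most ratio to the power k (b - a), which is too small for large k.
\<close>

theorem level_exponent_tendsto: "level_exponent N S \<longlonglongrightarrow> critical_exponent"
proof (rule order_tendstoI)
  fix a assume a: "critical_exponent < a"
  have a0: "a \<ge> 0" using a critical_exponent_nonneg by simp
  have "eventually (\<lambda>k. level_weight k a < 1) sequentially"
    using summable_exponent_level_weight[OF a0 summable_above_critical[OF a]] by (rule order_tendstoD) simp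
  moreover have "eventually (\<lambda>k. k \<ge> (1::nat)) sequentially" by (rule eventually_ge_at_top)
  ultimately show "eventually (\<lambda>k. level_exponent N S k < a) sequentially"
  proof eventually_elim
    case (elim k)
    show ?case
    proof (rule ccontr)
      assume "\<not> ?case"
      hence "level_weight k (level_exponent N S k) \<le> level_weight k a"
        using a0 by (intro level_weight_antimono) auto
      with elim level_exponent(2)[of k] show False by simp
    qed
  qed
next
  fix a assume a: "a < critical_exponent"
  have k1: "eventually (\<lambda>k. k \<ge> (1::nat)) sequentially" by (rule eventually_ge_at_top)
  show "eventually (\<lambda>k. a < level_exponent N S k) sequentially"
  proof (cases "a < 0")
    case True
    from k1 show ?thesis
      by eventually_elim (use True level_exponent(1) in force)
  next
    case False
    define b where "b = (a + critical_exponent) / 2"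
    have b: "a < b" "b < critical_exponent" using a by (auto simp: b_def)
    define q where "q = ratio powr (b - a)"
    have q: "0 \<le> q" "q < 1" using ratio_powr(1,3)[of "b - a"] b by (auto simp: q_def)
    have "(\<lambda>k. submult_const * q ^ k) \<longlonglongrightarrow> submult_const * 0"
      using q by (intro tendsto_intros LIMSEQ_realpow_zero) auto
    hence "eventually (\<lambda>k. submult_const * q ^ k < 1) sequentially"
      by (intro order_tendstoD) auto
    with k1 show ?thesis
    proof eventually_elim
      case (elim k)
      show ?case
      proof (rule ccontr)
        assume "\<not> ?case"
        hence "level_weight k a \<le> 1"
          using level_exponent[OF elim(1)] level_weight_antimono[of "level_exponent N S k" a k] by simp
        have "level_weight k b \<le> level_weight k a * q ^ k"
          using level_weight_add_le[of a "b - a" k] False b by (simp add: q_def)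
        also have "\<dots> \<le> 1 * q ^ k" using \<open>level_weight k a \<le> 1\<close> q by (intro mult_right_mono) auto
        finally have "submult_const * level_weight k b \<le> submult_const * q ^ k"
          using submult_const_ge_1 by (intro mult_left_mono) auto
        moreover have "1 \<le> submult_const * level_weight k b"
          using False b by (intro level_weight_ge_of_not_summable not_summable_below_critical) auto
        ultimately show False using elim(2) by simp
      qed
    qed
  qed
qed

corollary affinity_dimension_eq: "affinity_dimension N S = critical_exponent"
  unfolding affinity_dimension_def using level_exponent_tendsto by (rule limI)

end

section \<open>Box dimensions\<close>

text \<open>
  The logarithmic quotient of K d^(-b) is b + ln K / (- ln d), so multiplicative constants do not affect box dimensions.
\<close>

lemma tendsto_const_add_div_ln: "((\<lambda>d::real. b + c / (- ln d)) \<longlongrightarrow> b) (at_right 0)"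
proof -
  have "filterlim (\<lambda>d::real. - ln d) at_top (at_right 0)"
    using ln_at_0 by (simp add: filterlim_uminus_at_bot)
  hence "filterlim (\<lambda>d::real. - ln d) at_infinity (at_right 0)"
    by (rule filterlim_at_top_imp_at_infinity)
  hence "((\<lambda>d::real. c / (- ln d)) \<longlongrightarrow> 0) (at_right 0)" by (rule tendsto_divide_0[OF tendsto_const])
  hence "((\<lambda>d::real. b + c / (- ln d)) \<longlongrightarrow> b + 0) (at_right 0)" by (intro tendsto_intros)
  thus ?thesis by simp
qed

lemma eventually_at_right_0: "(e::real) > 0 \<Longrightarrow> eventually (\<lambda>d. 0 < d \<and> d < e) (at_right 0)"
  by (auto simp: eventually_at_right_field)

lemma upper_box_dim_le:
  fixes F :: "(real^'n) set"
  assumes F: "bounded F" "F \<noteq> {}" and K: "K > 0"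
    and le: "\<And>d. 0 < d \<Longrightarrow> d \<le> 1 \<Longrightarrow> real (covering_number d F) \<le> K * d powr (- B)"
  shows "upper_box_dim F \<le> ereal B"
proof -
  have "upper_box_dim F \<le> Limsup (at_right 0) (\<lambda>d::real. ereal (B + ln K / (- ln d)))"
    unfolding upper_box_dim_def
  proof (rule Limsup_mono, rule eventually_mono[OF eventually_at_right_0[of 1]])
    fix d :: real assume d: "0 < d \<and> d < 1"
    hence l: "ln d < 0" by simp
    have "real (covering_number d F) \<ge> 1" using covering_number_pos[OF F(1) _ F(2), of d] d by simp
    hence "ln (real (covering_number d F)) \<le> ln (K * d powr (- B))"
      using le[of d] d by (subst ln_le_cancel_iff) auto
    also have "\<dots> = ln K - B * ln d" using K d by (simp add: ln_mult ln_powr)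
    finally have "ln (real (covering_number d F)) / (- ln d) \<le> (ln K - B * ln d) / (- ln d)"
      using l by (intro divide_right_mono) auto
    also have "\<dots> = B + ln K / (- ln d)" using l by (simp add: field_simps)
    finally show "ereal (ln (real (covering_number d F)) / (- ln d)) \<le> ereal (B + ln K / (- ln d))" by simp
  qed simp
  also have "\<dots> = ereal B"
    by (intro lim_imp_Limsup trivial_limit_at_right_real tendsto_ereal tendsto_const_add_div_ln)
  finally show ?thesis .
qed

lemma lower_box_dim_ge:
  fixes F :: "(real^'n) set"
  assumes K: "K > 0" and e: "e > 0"
    and ge: "\<And>d. 0 < d \<Longrightarrow> d \<le> e \<Longrightarrow> K * d powr (- t) \<le> real (covering_number d F)"
  shows "ereal t \<le> lower_box_dim F"
proof -
  have "ereal t = Liminf (at_right 0) (\<lambda>d::real. ereal (t + ln K / (- ln d)))"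
    by (intro lim_imp_Liminf[symmetric] trivial_limit_at_right_real tendsto_ereal tendsto_const_add_div_ln)
  also have "\<dots> \<le> lower_box_dim F"
    unfolding lower_box_dim_def
  proof (rule Liminf_mono, rule eventually_mono[OF eventually_at_right_0[of "min 1 e"]])
    fix d :: real assume "0 < d \<and> d < min 1 e"
    hence d: "0 < d" "d < 1" "d < e" by auto
    hence l: "ln d < 0" by simp
    have p: "0 < K * d powr (- t)" using K d by simp
    have "ln K - t * ln d = ln (K * d powr (- t))" using K d by (simp add: ln_mult ln_powr)
    also have "\<dots> \<le> ln (real (covering_number d F))"
      using ge[of d] d p by (subst ln_le_cancel_iff) auto
    finally have "(ln K - t * ln d) / (- ln d) \<le> ln (real (covering_number d F)) / (- ln d)"
      using l by (intro divide_right_mono) auto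
    moreover have "(ln K - t * ln d) / (- ln d) = t + ln K / (- ln d)" using l by (simp add: field_simps)
    ultimately show "ereal (t + ln K / (- ln d)) \<le> ereal (ln (real (covering_number d F)) / (- ln d))" by simp
  qed (use e in simp)
  finally show ?thesis .
qed

text \<open>
  The definition of the upper box dimension gives the bound for small d; the remaining d \<ge> e are absorbed into K
  because covering numbers decrease in d.
\<close>

lemma covering_number_le_of_upper_box_dim:
  fixes F :: "(real^'n) set"
  assumes F: "bounded F" "F \<noteq> {}" and B: "upper_box_dim F < ereal B" "B \<ge> 0"
  obtains K where "K > 0" "\<And>d. 0 < d \<Longrightarrow> d \<le> 1 \<Longrightarrow> real (covering_number d F) \<le> K * d powr (- B)"
proof -
  have "eventually (\<lambda>d. ereal (ln (real (covering_number d F)) / (- ln d)) < ereal B) (at_right 0)"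
    using B(1) unfolding upper_box_dim_def by (rule Limsup_lessD)
  then obtain b where b: "b > 0"
    "\<And>d. 0 < d \<Longrightarrow> d < b \<Longrightarrow> ln (real (covering_number d F)) / (- ln d) < B"
    unfolding eventually_at_right_field by auto
  \<comment> \<open>The halving makes e strictly smaller than b, so that the bound also holds at e.\<close>
  define e where "e = min b 1 / 2"
  have e: "0 < e" "e < b" "e < 1" using b(1) by (auto simp: e_def)
  define K where "K = max 1 (real (covering_number e F))"
  have "real (covering_number d F) \<le> K * d powr (- B)" if d: "0 < d" "d \<le> 1" for d
  proof (cases "d < e")
    case True
    have l: "ln d < 0" using True e d by simp
    have pos: "real (covering_number d F) > 0" using covering_number_pos[OF F(1) d(1) F(2)] by simp
    have "ln (real (covering_number d F)) \<le> B * (- ln d)"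
      using b(2)[of d] True e d l by (simp add: field_simps)
    also have "\<dots> = ln (d powr (- B))" using d by (simp add: ln_powr)
    finally have "real (covering_number d F) \<le> 1 * d powr (- B)"
      using pos d by (subst (asm) ln_le_cancel_iff) auto
    also have "\<dots> \<le> K * d powr (- B)" by (intro mult_right_mono) (auto simp: K_def)
    finally show ?thesis .
  next
    case False
    hence "real (covering_number d F) \<le> K * 1"
      using covering_number_antimono[OF F(1) e(1), of d] by (simp add: K_def)
    also have "\<dots> \<le> K * d powr (- B)"
      using powr_mono2'[of "- B" d 1] d B(2) by (intro mult_left_mono) (auto simp: K_def)
    finally show ?thesis .
  qed
  moreover have "K > 0" by (simp add: K_def)
  ultimately show thesis using that by blast
qed

lemma box_dim_mono:
  fixes F G :: "(real^'n) set"
  assumes "F \<subseteq> G" "bounded G" "F \<noteq> {}"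
  shows "upper_box_dim F \<le> upper_box_dim G" "lower_box_dim F \<le> lower_box_dim G"
proof -
  have "ereal (ln (real (covering_number d F)) / (- ln d)) \<le> ereal (ln (real (covering_number d G)) / (- ln d))"
    if d: "0 < d \<and> d < 1" for d
  proof -
    have "covering_number d F \<ge> 1"
      using covering_number_pos[OF bounded_subset[OF assms(2,1)] _ assms(3)] d by simp
    moreover have "covering_number d F \<le> covering_number d G"
      using covering_number_mono[OF assms(1,2)] d by simp
    ultimately have "ln (real (covering_number d F)) \<le> ln (real (covering_number d G))"
      by (subst ln_le_cancel_iff) auto
    moreover have "- ln d > 0" using d by simp
    ultimately show ?thesis by (simp only: ereal_less_eq divide_right_mono less_imp_le)
  qed
  hence "eventually (\<lambda>d. ereal (ln (real (covering_number d F)) / (- ln d)) 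
      \<le> ereal (ln (real (covering_number d G)) / (- ln d))) (at_right 0)"
    by (intro eventually_mono[OF eventually_at_right_0[of 1]]) auto
  thus "upper_box_dim F \<le> upper_box_dim G" "lower_box_dim F \<le> lower_box_dim G"
    unfolding upper_box_dim_def lower_box_dim_def by (intro Limsup_mono Liminf_mono; assumption)+
qed

lemma lower_le_upper_box_dim: "lower_box_dim F \<le> upper_box_dim F"
  unfolding lower_box_dim_def upper_box_dim_def
  by (intro Liminf_le_Limsup trivial_limit_at_right_real)

lemma ellipsoid_count_scale:
  fixes A :: "real^'n^'n"
  assumes "invertible A" "d > 0" "q > 0"
  shows "ellipsoid_count A d \<le> max 1 q ^ CARD('n) * ellipsoid_count A (q * d)"
proof -
  define c where "c = max 1 q"
  have c: "c \<ge> 1" "c \<ge> q" by (auto simp: c_def)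
  have "ellipsoid_count A d = ellipsoid_count A ((c * d) / c)" using c by simp
  also have "\<dots> \<le> c ^ CARD('n) * ellipsoid_count A (c * d)" by (rule ellipsoid_count_rescale[OF c(1)])
  also have "\<dots> \<le> c ^ CARD('n) * ellipsoid_count A (q * d)"
    using c assms by (intro mult_left_mono ellipsoid_count_antimono) auto
  finally show ?thesis by (simp add: c_def)
qed

text \<open>
  A ball is the image of itself under the identity matrix, so the count of cubes that meet an ellipsoid applies.
\<close>

lemma upper_box_dim_le_dimension:
  fixes F :: "(real^'n) set"
  assumes F: "bounded F" "F \<noteq> {}"
  shows "upper_box_dim F \<le> ereal (real CARD('n))"
proof -
  let ?n = "CARD('n)" and ?I = "mat 1 :: real^'n^'n"
  have inv: "invertible ?I" by (auto simp: invertible_def)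
  obtain R where "R > 0" "F \<subseteq> ball 0 R" using bounded_subset_ballD[OF F(1)] by blast
  hence R: "R > 0" "F \<subseteq> (\<lambda>x. ?I *v x + 0) ` cball 0 R" using ball_subset_cball[of 0 R] by auto
  define K where "K = (8 * real ?n) ^ ?n * (max 1 R ^ ?n * ellipsoid_count ?I 1)"
  have "K > 0" unfolding K_def using ellipsoid_count_ge_1[of ?I 1]
    by (intro mult_pos_pos zero_less_power) auto
  thus ?thesis
  proof (rule upper_box_dim_le[OF F])
    fix d :: real assume d: "0 < d" "d \<le> 1"
    have "real (covering_number d F) \<le> real (covering_number d ((\<lambda>x. ?I *v x + 0) ` cball 0 R))"
      using covering_number_mono[OF R(2) affine_image_cball_bounded d(1)] by simp
    also have "\<dots> \<le> (8 * real ?n) ^ ?n * ellipsoid_count ?I (d / R)"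
      by (intro covering_number_ellipsoid_le inv d R)
    also have "ellipsoid_count ?I (d / R) \<le> max 1 R ^ ?n * ellipsoid_count ?I (R * (d / R))"
      using d R by (intro ellipsoid_count_scale inv) auto
    also have "R * (d / R) = 1 / (1 / d)" using R by simp
    also have "ellipsoid_count ?I (1 / (1 / d)) \<le> (1 / d) ^ ?n * ellipsoid_count ?I 1"
      using d by (intro ellipsoid_count_rescale) simp
    also have "(1 / d) ^ ?n = d powr (- real ?n)"
      using d by (simp add: powr_minus powr_realpow power_one_over inverse_eq_divide)
    finally show "real (covering_number d F) \<le> K * d powr (- real ?n)"
      by (simp add: K_def mult_ac)
  qed
qed

text \<open>
  A cube of a cover of the union meets at most one of the sets, so the cover splits into disjoint covers of the parts.
\<close>

lemma sum_covering_number_separated_le: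
  fixes F :: "'a \<Rightarrow> (real^'n) set"
  assumes I: "finite I" and b: "bounded (\<Union>i\<in>I. F i)" and d: "d > 0"
    and sep: "\<And>i j x y. i \<in> I \<Longrightarrow> j \<in> I \<Longrightarrow> i \<noteq> j \<Longrightarrow> x \<in> F i \<Longrightarrow> y \<in> F j \<Longrightarrow> real CARD('n) * d < norm (x - y)"
  shows "(\<Sum>i\<in>I. covering_number d (F i)) \<le> covering_number d (\<Union>i\<in>I. F i)"
proof -
  obtain \<Q> where Q: "finite \<Q>" "card \<Q> = covering_number d (\<Union>i\<in>I. F i)"
    "\<And>Q. Q \<in> \<Q> \<Longrightarrow> hypercube d Q" "(\<Union>i\<in>I. F i) \<subseteq> \<Union>\<Q>"
    using optimal_cover[OF b d] by blast
  define q where "q i = {Q \<in> \<Q>. Q \<inter> F i \<noteq> {}}" for i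
  have fin: "finite (q i)" for i using Q(1) by (simp add: q_def)
  have disj: "q i \<inter> q j = {}" if ij: "i \<in> I" "j \<in> I" "i \<noteq> j" for i j
  proof (rule ccontr)
    assume "q i \<inter> q j \<noteq> {}"
    then obtain R x y where R: "R \<in> \<Q>" "x \<in> R" "y \<in> R" "x \<in> F i" "y \<in> F j" by (auto simp: q_def)
    show False using hypercube_norm_le[OF Q(3)[OF R(1)] R(2,3)] sep[OF ij R(4,5)] by simp
  qed
  have "(\<Sum>i\<in>I. covering_number d (F i)) \<le> (\<Sum>i\<in>I. card (q i))"
  proof (intro sum_mono covering_number_le_card fin)
    fix i assume i: "i \<in> I"
    show "F i \<subseteq> \<Union>(q i)"
    proof
      fix x assume x: "x \<in> F i"
      hence "x \<in> \<Union>\<Q>" using Q(4) i by blast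
      then obtain R where "R \<in> \<Q>" "x \<in> R" by blast
      thus "x \<in> \<Union>(q i)" using x by (auto simp: q_def)
    qed
  qed (use Q(3) in \<open>auto simp: q_def\<close>)
  also have "\<dots> = card (\<Union>i\<in>I. q i)"
    using I fin disj by (intro card_UN_disjoint[symmetric]) auto
  also have "\<dots> \<le> card \<Q>" using Q(1) by (intro card_mono) (auto simp: q_def)
  finally show ?thesis using Q(2) by simp
qed

section \<open>The inhomogeneous self-affine set\<close>

context contracting_affine_IFS
begin

definition orbit :: "(real^'n) set \<Rightarrow> (real^'n) set" where
  "orbit C = (\<Union>w\<in>all_words. word_map S w ` C)"

lemma word_map_image_subset:
  assumes "\<And>i. i \<in> {1..N} \<Longrightarrow> S i ` X \<subseteq> X" "w \<in> all_words"
  shows "word_map S w ` X \<subseteq> X"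
  using assms(2)
proof (induction w)
  case (Cons i w)
  have "word_map S (i # w) ` X = S i ` (word_map S w ` X)" by (simp add: image_comp)
  also have "\<dots> \<subseteq> S i ` X" using Cons.IH by (rule image_mono)
  also have "\<dots> \<subseteq> X" using Cons.hyps(1) by (rule assms(1))
  finally show ?case .
qed simp

lemma orbit_subset:
  assumes "\<And>i. i \<in> {1..N} \<Longrightarrow> S i ` X \<subseteq> X" "C \<subseteq> X"
  shows "orbit C \<subseteq> X"
  unfolding orbit_def
proof (rule UN_least)
  fix w assume w: "w \<in> all_words"
  show "word_map S w ` C \<subseteq> X"
    using image_mono[OF assms(2), of "word_map S w"] word_map_image_subset[OF assms(1) w] by blast
qed

lemma condensation_subset_orbit: "C \<subseteq> orbit C"
proof -
  have "word_map S [] ` C \<subseteq> orbit C" unfolding orbit_def by (rule UN_upper) simp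
  thus ?thesis by simp
qed

lemma orbit_fixed: "orbit C = (\<Union>i\<in>{1..N}. S i ` orbit C) \<union> C"
proof
  show "orbit C \<subseteq> (\<Union>i\<in>{1..N}. S i ` orbit C) \<union> C"
  proof
    fix x assume "x \<in> orbit C"
    then obtain w c where w: "w \<in> all_words" "c \<in> C" "x = word_map S w c" by (auto simp: orbit_def)
    show "x \<in> (\<Union>i\<in>{1..N}. S i ` orbit C) \<union> C"
    proof (cases w)
      case Nil
      thus ?thesis using w by simp
    next
      case (Cons i v)
      hence iv: "i \<in> {1..N}" "v \<in> all_words" using w(1) by simp_all
      hence "word_map S v c \<in> orbit C" unfolding orbit_def using w(2) by blast
      hence "x \<in> S i ` orbit C" using w(3) Cons by simp
      thus ?thesis using iv(1) by blast
    qed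
  qed
  have "S i ` orbit C \<subseteq> orbit C" if i: "i \<in> {1..N}" for i
  proof (rule image_subsetI)
    fix x assume "x \<in> orbit C"
    then obtain w c where w: "w \<in> all_words" "c \<in> C" "x = word_map S w c" by (auto simp: orbit_def)
    have "i # w \<in> all_words" using i w(1) by simp
    hence "word_map S (i # w) c \<in> orbit C" unfolding orbit_def using w(2) by blast
    thus "S i x \<in> orbit C" using w(3) by simp
  qed
  thus "(\<Union>i\<in>{1..N}. S i ` orbit C) \<union> C \<subseteq> orbit C" using condensation_subset_orbit[of C] by blast
qed

lemma continuous_on_map: "i \<in> {1..N} \<Longrightarrow> continuous_on A (S i)"
proof -
  assume "i \<in> {1..N}"
  then obtain B b where "S i = (\<lambda>x. B *v x + b)" using ifs unfolding affine_IFS_def by blast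
  moreover have "continuous_on A ((*v) B)"
    by (intro linear_continuous_on linear_conv_bounded_linear[THEN iffD1] matrix_vector_mul_linear)
  ultimately show ?thesis by (simp add: continuous_on_add)
qed

lemma closure_orbit_fixed:
  assumes "compact C" "bounded (orbit C)"
  shows "closure (orbit C) = (\<Union>i\<in>{1..N}. S i ` closure (orbit C)) \<union> C"
proof
  let ?O = "orbit C"
  have cO: "compact (closure ?O)" using assms(2) by (simp add: compact_closure)
  have "compact (S i ` closure ?O)" if "i \<in> {1..N}" for i
    by (intro compact_continuous_image continuous_on_map cO that)
  hence "closed ((\<Union>i\<in>{1..N}. S i ` closure ?O) \<union> C)"
    using assms(1) by (intro closed_Un closed_UN ballI compact_imp_closed) auto
  moreover have "?O \<subseteq> (\<Union>i\<in>{1..N}. S i ` closure ?O) \<union> C"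
    using orbit_fixed[of C] closure_subset[of ?O] by blast
  ultimately show "closure ?O \<subseteq> (\<Union>i\<in>{1..N}. S i ` closure ?O) \<union> C" by (rule closure_minimal[rotated])
  have "S i ` closure ?O \<subseteq> closure ?O" if i: "i \<in> {1..N}" for i
  proof (rule image_closure_subset[OF continuous_on_map[OF i]])
    show "S i ` ?O \<subseteq> closure ?O" using orbit_fixed[of C] closure_subset[of ?O] i by blast
  qed simp
  thus "(\<Union>i\<in>{1..N}. S i ` closure ?O) \<union> C \<subseteq> closure ?O"
    using condensation_subset_orbit[of C] closure_subset[of ?O] by blast
qed

text \<open>
  Unfolding the fixed point equation k times writes a point of G either as a point of the orbit or as a point of
  \<open>word_map S w ` G\<close> with w of length k. The latter set contains a point of the orbit and has diameter of order
  ratio^k.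
\<close>

lemma fixed_set_eq_closure_orbit:
  assumes G: "compact G" "G = (\<Union>i\<in>{1..N}. S i ` G) \<union> C" and C: "C \<noteq> {}"
  shows "G = closure (orbit C)"
proof
  have "orbit C \<subseteq> G" using G(2) by (intro orbit_subset) blast+
  thus "closure (orbit C) \<subseteq> G" using compact_imp_closed[OF G(1)] by (rule closure_minimal)
  have iter: "x \<in> orbit C \<or> (\<exists>w\<in>all_words. length w = k \<and> x \<in> word_map S w ` G)" if x: "x \<in> G" for x k
  proof (induction k)
    case 0
    have "x \<in> word_map S [] ` G" using x by simp
    thus ?case by (metis lists.Nil list.size(3))
  next
    case (Suc k)
    {
      fix w g assume w: "w \<in> all_words" "length w = k" "g \<in> G" "x = word_map S w g"
      from w(3) G(2) have "(\<exists>i\<in>{1..N}. g \<in> S i ` G) \<or> g \<in> C" by blast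
      hence ?case
      proof
        assume "g \<in> C"
        hence "x \<in> orbit C" unfolding orbit_def using w by blast
        thus ?case ..
      next
        assume "\<exists>i\<in>{1..N}. g \<in> S i ` G"
        then obtain i g' where i: "i \<in> {1..N}" "g' \<in> G" "g = S i g'" by blast
        have "x = word_map S (w @ [i]) g'" using w(4) i(3) by (simp add: word_map_append)
        moreover have "w @ [i] \<in> all_words" "length (w @ [i]) = Suc k" using w i by simp_all
        ultimately show ?case using i(2) by blast
      qed
    }
    with Suc.IH show ?case by blast
  qed
  obtain R where R: "\<And>x. x \<in> G \<Longrightarrow> norm x \<le> R"
    using compact_imp_bounded[OF G(1)] by (auto simp: bounded_iff)
  obtain c where c: "c \<in> C" using C by blast
  have cG: "c \<in> G" using G(2) c by blast
  show "G \<subseteq> closure (orbit C)"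
  proof
    fix x assume x: "x \<in> G"
    show "x \<in> closure (orbit C)" unfolding closure_approachable
    proof (intro allI impI)
      fix e :: real assume e: "e > 0"
      have "(\<lambda>k. ratio ^ k * (2 * R)) \<longlonglongrightarrow> 0 * (2 * R)"
        using ratio(1,2) by (intro tendsto_intros LIMSEQ_realpow_zero) auto
      hence "eventually (\<lambda>k. ratio ^ k * (2 * R) < e) sequentially"
        using e by (intro order_tendstoD) auto
      then obtain k where k: "ratio ^ k * (2 * R) < e" by (auto simp: eventually_sequentially)
      from iter[OF x, of k] show "\<exists>y\<in>orbit C. dist y x < e"
      proof
        assume "x \<in> orbit C"
        thus ?thesis using e by (intro bexI[of _ x]) auto
      next
        assume "\<exists>w\<in>all_words. length w = k \<and> x \<in> word_map S w ` G"
        then obtain w g where w: "w \<in> all_words" "length w = k" "g \<in> G" "x = word_map S w g" by blast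
        have "norm (word_map S w c - word_map S w g) \<le> ratio ^ k * norm (c - g)"
          using word_map_contraction[OF w(1)] w(2) by simp
        also have "norm (c - g) \<le> 2 * R"
          using norm_triangle_ineq4[of c g] R[OF cG] R[OF w(3)] by linarith
        hence "ratio ^ k * norm (c - g) \<le> ratio ^ k * (2 * R)" using ratio(1) by (intro mult_left_mono) auto
        finally have "dist (word_map S w c) x < e" using k w(4) by (simp add: dist_norm)
        moreover have "word_map S w c \<in> orbit C" unfolding orbit_def using w(1) c by blast
        ultimately show ?thesis by blast
      qed
    qed
  qed
qed

theorem inhomogeneous_set_eq:
  assumes "C \<noteq> {}" "compact C" "bounded (orbit C)"
  shows "inhomogeneous_set N S C = closure (orbit C)"
  unfolding inhomogeneous_set_def
proof (rule the_equality)
  show "closure (orbit C) \<noteq> {} \<and> compact (closure (orbit C)) \<and>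
      closure (orbit C) = (\<Union>i\<in>{1..N}. S i ` closure (orbit C)) \<union> C"
    using closure_orbit_fixed[OF assms(2,3)] assms(1,3) condensation_subset_orbit[of C]
    by (auto simp: compact_closure)
  fix G assume "G \<noteq> {} \<and> compact G \<and> G = (\<Union>i\<in>{1..N}. S i ` G) \<union> C"
  thus "G = closure (orbit C)" using assms(1) by (intro fixed_set_eq_closure_orbit) auto
qed

end

context contracting_affine_IFS
begin

section \<open>Stopping words\<close>

text \<open>
  The words at which the passage along prefixes has not yet reached the scale d.
\<close>

definition large_words :: "real \<Rightarrow> nat list set" where
  "large_words d = {w \<in> all_words. d \<le> smin w}"

lemma stopping_words_eq:
  "stopping_words N S d = {w \<in> all_words. w \<noteq> [] \<and> smin w < d \<and> d \<le> smin (butlast w)}"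
proof -
  have "words N = {w \<in> all_words. w \<noteq> []}"
    by (auto simp: words_def words_of_length_eq Suc_le_eq)
  thus ?thesis by (auto simp: stopping_words_def)
qed

lemma stopping_words_subset: "stopping_words N S d \<subseteq> all_words"
  by (auto simp: stopping_words_eq)

text \<open>
  The smallest singular value starts at 1 for the empty word and decreases along prefixes; the first prefix where it
  falls below d is a stopping word.
\<close>

lemma large_or_stopping_prefix:
  assumes d: "d \<le> 1"
  shows "w \<in> all_words \<Longrightarrow> w \<in> large_words d \<or> (\<exists>p\<in>stopping_words N S d. \<exists>v. w = p @ v)"
proof (induction w rule: rev_induct)
  case Nil
  have "smin [] = 1" by (rule smin_Nil)
  thus ?case using d by (simp add: large_words_def del: word_map.simps)
next
  case (snoc i w)
  have w: "w \<in> all_words" "w @ [i] \<in> all_words" using snoc.prems by simp_all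
  from snoc.IH[OF w(1)] show ?case
  proof
    assume "w \<in> large_words d"
    hence "d \<le> smin (w @ [i]) \<or> w @ [i] \<in> stopping_words N S d"
      using w(2) by (auto simp: large_words_def stopping_words_eq)
    thus ?thesis
    proof
      assume "d \<le> smin (w @ [i])"
      thus ?thesis using w(2) by (simp add: large_words_def)
    next
      assume "w @ [i] \<in> stopping_words N S d"
      moreover have "w @ [i] = (w @ [i]) @ []" by simp
      ultimately show ?thesis by blast
    qed
  next
    assume "\<exists>p\<in>stopping_words N S d. \<exists>v. w = p @ v"
    then obtain p v where "p \<in> stopping_words N S d" "w @ [i] = p @ (v @ [i])" by auto
    thus ?thesis by blast
  qed
qed

lemma finite_large_words:
  assumes d: "d > 0"
  shows "finite (large_words d)"
proof -
  have "(\<lambda>k. ratio ^ k) \<longlonglongrightarrow> 0" using ratio(1,2) by (intro LIMSEQ_realpow_zero) auto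
  hence "eventually (\<lambda>k. ratio ^ k < d) sequentially" using d by (rule order_tendstoD)
  then obtain L where L: "\<And>k. k \<ge> L \<Longrightarrow> ratio ^ k < d" by (auto simp: eventually_sequentially)
  have "length w \<le> L" if "w \<in> large_words d" for w
  proof (rule ccontr)
    assume "\<not> length w \<le> L"
    hence "ratio ^ length w < d" by (intro L) simp
    moreover have "d \<le> smin w" "w \<in> all_words" using that by (auto simp: large_words_def)
    ultimately show False using smin_le_smax[of w] smax_le[of w] by linarith
  qed
  hence "large_words d \<subseteq> {w \<in> all_words. length w \<le> L}" by (auto simp: large_words_def)
  thus ?thesis by (rule finite_subset) (simp add: finite_lists_bounded_length)
qed

lemma finite_stopping_words:
  assumes d: "d > 0"
  shows "finite (stopping_words N S d)"
proof (rule finite_subset)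
  show "stopping_words N S d \<subseteq> (\<lambda>(w, i). w @ [i]) ` (large_words d \<times> {1..N})"
  proof
    fix w assume w: "w \<in> stopping_words N S d"
    have ne: "w \<noteq> []" and b: "d \<le> smin (butlast w)" and W: "w \<in> all_words"
      using w by (simp_all add: stopping_words_eq)
    have "butlast w \<in> all_words" "last w \<in> {1..N}"
      using W ne by (auto simp: in_lists_conv_set dest: in_set_butlastD)
    hence "(butlast w, last w) \<in> large_words d \<times> {1..N}" using b by (simp add: large_words_def)
    moreover have "w = (\<lambda>(w, i). w @ [i]) (butlast w, last w)" using ne by simp
    ultimately show "w \<in> (\<lambda>(w, i). w @ [i]) ` (large_words d \<times> {1..N})" by (intro image_eqI)
  qed
  show "finite ((\<lambda>(w, i). w @ [i]) ` (large_words d \<times> {1..N}))"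
    using finite_large_words[OF d] by simp
qed

lemma smin_stopping_word_ge:
  assumes "w \<in> stopping_words N S d"
  shows "amin * d \<le> smin w"
proof -
  have ne: "w \<noteq> []" and b: "d \<le> smin (butlast w)" and W: "w \<in> all_words"
    using assms by (simp_all add: stopping_words_eq)
  have "butlast w \<in> all_words" "last w \<in> {1..N}"
    using W ne by (auto simp: in_lists_conv_set dest: in_set_butlastD)
  hence "amin * smin (butlast w) \<le> smin (butlast w @ [last w])" by (rule smin_snoc_ge)
  moreover have "amin * d \<le> amin * smin (butlast w)" using b amin_pos by (intro mult_left_mono) auto
  moreover have "butlast w @ [last w] = w" using ne by simp
  ultimately show ?thesis by simp
qed

text \<open>
  If u were a proper prefix of v, then already \<open>butlast v\<close> would extend u, and its smallest singular value would be
  below d.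
\<close>

lemma stopping_words_not_prefix:
  assumes "u \<in> stopping_words N S d" "v \<in> stopping_words N S d" "u \<noteq> v"
  shows "v \<noteq> u @ x"
proof
  assume v: "v = u @ x"
  have x: "x \<noteq> []" using v assms(3) by auto
  have u: "u \<in> all_words" "smin u < d" using assms(1) by (simp_all add: stopping_words_eq)
  have "v \<in> all_words" and b: "d \<le> smin (butlast v)" using assms(2) by (simp_all add: stopping_words_eq)
  hence "butlast x \<in> all_words" using v by (auto simp: in_lists_conv_set dest: in_set_butlastD)
  moreover have "butlast v = u @ butlast x" using x v by (simp add: butlast_append)
  ultimately have "smin (butlast v) \<le> smin u" using smin_append_le[OF u(1)] by simp
  with b u(2) show False by simp
qed

section \<open>The upper bound\<close>

lemma sum_weight_bounded:
  assumes "t \<ge> 0" "summable_exponent t"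
  obtains M where "M > 0" "\<And>A. finite A \<Longrightarrow> A \<subseteq> all_words \<Longrightarrow> (\<Sum>w\<in>A. weight t w) \<le> M"
proof -
  obtain M where M: "\<And>L. partial_weight {1..N} (weight t) L \<le> M"
    using assms(2) unfolding summable_exponent_def by blast
  have "(\<Sum>w\<in>A. weight t w) \<le> max 1 M" if A: "finite A" "A \<subseteq> all_words" for A
  proof -
    have "(\<Sum>w\<in>A. weight t w) \<le> partial_weight {1..N} (weight t) (Max (length ` A))"
      unfolding partial_weight_def
    proof (rule sum_mono2)
      show "finite {w \<in> all_words. length w \<le> Max (length ` A)}"
        by (rule finite_lists_bounded_length) simp
      show "A \<subseteq> {w \<in> all_words. length w \<le> Max (length ` A)}" using A by auto
      show "0 \<le> weight t w" if "w \<in> {w \<in> all_words. length w \<le> Max (length ` A)} - A" for w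
        using that weight_pos[OF _ assms(1), of w] by simp
    qed
    thus ?thesis using M[of "Max (length ` A)"] by simp
  qed
  thus thesis using that[of "max 1 M"] by simp
qed

text \<open>
  If a stopping word p is a prefix of w, then the image of C under w is contained in the image of X under p.
\<close>

lemma orbit_subset_large_stopping:
  assumes inv: "\<And>i. i \<in> {1..N} \<Longrightarrow> S i ` X \<subseteq> X" and CX: "C \<subseteq> X" and d: "d \<le> 1"
  shows "orbit C \<subseteq> (\<Union>w\<in>large_words d. word_map S w ` C) \<union> (\<Union>w\<in>stopping_words N S d. word_map S w ` X)"
  unfolding orbit_def
proof (rule UN_least)
  fix w assume w: "w \<in> all_words"
  from large_or_stopping_prefix[OF d w]
  show "word_map S w ` C \<subseteq> (\<Union>w\<in>large_words d. word_map S w ` C) \<union> (\<Union>w\<in>stopping_words N S d. word_map S w ` X)"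
  proof
    assume "\<exists>p\<in>stopping_words N S d. \<exists>v. w = p @ v"
    then obtain p v where p: "p \<in> stopping_words N S d" "w = p @ v" by blast
    have v: "v \<in> all_words" using w p(2) by simp
    have "word_map S v ` C \<subseteq> X"
      by (rule subset_trans[OF image_mono[OF CX] word_map_image_subset[OF inv v]])
    hence "word_map S w ` C \<subseteq> word_map S p ` X"
      unfolding p(2) word_map_append image_comp[symmetric] by (rule image_mono)
    also have "\<dots> \<subseteq> (\<Union>w\<in>stopping_words N S d. word_map S w ` X)" using p(1) by (rule UN_upper)
    finally show ?thesis by (rule le_supI2)
  qed blast
qed

lemma word_map_image: "w \<in> all_words \<Longrightarrow> word_map S w ` F = (\<lambda>x. lin w *v x + word_map S w 0) ` F"
  by (rule arg_cong[where f = "\<lambda>f. f ` F", OF word_map_eq])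

lemma bounded_word_map_image: "w \<in> all_words \<Longrightarrow> bounded F \<Longrightarrow> bounded (word_map S w ` F)"
proof -
  assume w: "w \<in> all_words" and "bounded F"
  then obtain R where "F \<subseteq> ball 0 R" using bounded_subset_ballD by blast
  hence "F \<subseteq> cball 0 R" using ball_subset_cball[of 0 R] by blast
  hence "word_map S w ` F \<subseteq> word_map S w ` cball 0 R" by (rule image_mono)
  moreover have "bounded (word_map S w ` cball 0 R)"
    unfolding word_map_image[OF w] by (rule affine_image_cball_bounded)
  ultimately show ?thesis by (rule bounded_subset[rotated])
qed

text \<open>
  Cover C by cubes of side d / \<alpha>_n. The image of such a cube has smallest semi-axis of order d, so \<alpha>_n is the
  scale at which \<open>ellipsoid_count\<close> gives \<phi>^B; this needs n - 1 \<le> B \<le> n.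
\<close>

lemma covering_number_large_word_le:
  assumes w: "w \<in> large_words d" and d: "d > 0" and C: "bounded C"
    and B: "real CARD('n) - 1 \<le> B" "B \<le> real CARD('n)"
    and K: "\<And>\<rho>. 0 < \<rho> \<Longrightarrow> \<rho> \<le> 1 \<Longrightarrow> real (covering_number \<rho> C) \<le> K * \<rho> powr (- B)"
  shows "real (covering_number d (word_map S w ` C))
    \<le> (8 * real CARD('n) * real CARD('n)) ^ CARD('n) * K * d powr (- B) * weight B w"
proof -
  let ?n = "CARD('n)" and ?a = "smin w" and ?c = "(8 * real CARD('n) * real CARD('n)) ^ CARD('n)"
  have W: "w \<in> all_words" and a: "d \<le> ?a" using w by (auto simp: large_words_def)
  have a0: "?a > 0" by (rule smin_pos[OF W])
  have n1: "real ?n \<ge> 1" by (simp add: Suc_le_eq)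
  have B0: "0 \<le> B" using B(1) n1 by linarith
  have "real (covering_number d (word_map S w ` C))
      \<le> ?c * real (covering_number (d / ?a) C) * ellipsoid_count (lin w) (d / (d / ?a))"
    unfolding word_map_image[OF W] using a0 d by (intro covering_number_image_le invertible_lin W C) simp_all
  also have "d / (d / ?a) = ?a" using d a0 by simp
  also have "?c * real (covering_number (d / ?a) C) * ellipsoid_count (lin w) ?a
      \<le> ?c * (K * (d / ?a) powr (- B)) * ellipsoid_count (lin w) ?a"
    using K[of "d / ?a"] a a0 d ellipsoid_count_ge_1[of "lin w" ?a]
    by (intro mult_right_mono mult_left_mono) auto
  also have "\<dots> = ?c * K * d powr (- B) * (?a powr B * ellipsoid_count (lin w) ?a)"
    using d a0 by (simp add: powr_divide powr_minus field_simps)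
  also have "?a powr B * ellipsoid_count (lin w) ?a = weight B w"
  proof -
    have p: "?n - 1 < ?n" "real (?n - 1) = real ?n - 1" by (simp_all add: of_nat_diff Suc_le_eq)
    show ?thesis using sv_function_eq_ellipsoid_count[OF invertible_lin[OF W] B0 B(2) p(1)] B p(2)
      by (simp add: singular_value_def)
  qed
  finally show ?thesis .
qed

text \<open>
  For a stopping word \<alpha>_n is comparable to d, which turns the count of cubes at scale d into \<phi>^B.
\<close>

lemma covering_number_stopping_word_le:
  assumes w: "w \<in> stopping_words N S d" and d: "d > 0" and r: "r > 0"
    and B: "real CARD('n) - 1 \<le> B" "B \<le> real CARD('n)"
  shows "real (covering_number d (word_map S w ` cball z r))
    \<le> (8 * real CARD('n)) ^ CARD('n) * max 1 r ^ CARD('n) * amin powr (- B) * d powr (- B) * weight B w"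
proof -
  let ?n = "CARD('n)" and ?a = "smin w" and ?c = "(8 * real CARD('n)) ^ CARD('n)"
  have W: "w \<in> all_words" and a: "?a < d" using w by (auto simp: stopping_words_eq)
  have a0: "?a > 0" by (rule smin_pos[OF W])
  have n1: "real ?n \<ge> 1" by (simp add: Suc_le_eq)
  have B0: "0 \<le> B" using B(1) n1 by linarith
  have p: "?n - 1 < ?n" "real (?n - 1) = real ?n - 1" by (simp_all add: of_nat_diff Suc_le_eq)
  have wB: "weight B w = ?a powr B * ellipsoid_count (lin w) ?a"
    using sv_function_eq_ellipsoid_count[OF invertible_lin[OF W] B0 B(2) p(1)] B p(2)
    by (simp add: singular_value_def)
  have "real (covering_number d (word_map S w ` cball z r)) \<le> ?c * ellipsoid_count (lin w) (d / r)"
    unfolding word_map_image[OF W] by (intro covering_number_ellipsoid_le invertible_lin W d r)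
  also have "ellipsoid_count (lin w) (d / r) \<le> max 1 r ^ ?n * ellipsoid_count (lin w) (r * (d / r))"
    using d r by (intro ellipsoid_count_scale invertible_lin W) auto
  also have "r * (d / r) = d" using r by simp
  also have "ellipsoid_count (lin w) d \<le> ellipsoid_count (lin w) ?a"
    using a a0 by (intro ellipsoid_count_antimono invertible_lin W) auto
  also have "\<dots> = ?a powr (- B) * weight B w"
    unfolding wB using a0 by (simp add: powr_minus)
  also have "?a powr (- B) \<le> (amin * d) powr (- B)"
    using smin_stopping_word_ge[OF w] amin_pos d B0 by (intro powr_mono2') auto
  also have "(amin * d) powr (- B) = amin powr (- B) * d powr (- B)"
    using amin_pos d by (simp add: powr_mult)
  finally show ?thesis using weight_pos[OF W B0] by (simp add: mult_ac)
qed

text \<open>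
  Every covering number in the decomposition of the orbit at scale d is at most a constant times d^(-B) \<phi>^B, and the
  series of \<phi>^B converges because B exceeds the critical exponent.
\<close>

theorem upper_box_dim_orbit_le:
  assumes inv: "\<And>i. i \<in> {1..N} \<Longrightarrow> S i ` cball z r \<subseteq> cball z r" and r: "r > 0"
    and C: "C \<subseteq> cball z r" "C \<noteq> {}"
    and B: "real CARD('n) - 1 \<le> B" "B \<le> real CARD('n)"
    and s: "critical_exponent < B" and ub: "upper_box_dim C < ereal B"
  shows "upper_box_dim (closure (orbit C)) \<le> ereal B"
proof -
  let ?X = "cball z r"
  have bC: "bounded C" using C(1) bounded_cball bounded_subset by blast
  have bO: "bounded (orbit C)" using orbit_subset[OF inv C(1)] bounded_cball bounded_subset by blast
  have B0: "B \<ge> 0" using s critical_exponent_nonneg by linarith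
  obtain K where K: "K > 0" "\<And>\<rho>. 0 < \<rho> \<Longrightarrow> \<rho> \<le> 1 \<Longrightarrow> real (covering_number \<rho> C) \<le> K * \<rho> powr (- B)"
    using covering_number_le_of_upper_box_dim[OF bC C(2) ub B0] by blast
  obtain M where M: "M > 0" "\<And>A. finite A \<Longrightarrow> A \<subseteq> all_words \<Longrightarrow> (\<Sum>w\<in>A. weight B w) \<le> M"
    using sum_weight_bounded[OF B0 summable_above_critical[OF s]] by blast
  define K1 where "K1 = (8 * real CARD('n) * real CARD('n)) ^ CARD('n) * K"
  define K2 where "K2 = (8 * real CARD('n)) ^ CARD('n) * max 1 r ^ CARD('n) * amin powr (- B)"
  have K12: "K1 > 0" "K2 > 0" unfolding K1_def K2_def using K(1) amin_pos
    by (intro mult_pos_pos zero_less_power; simp)+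
  have "real (covering_number d (closure (orbit C))) \<le> ((K1 + K2) * M) * d powr (- B)"
    if d: "0 < d" "d \<le> 1" for d
  proof -
    let ?G = "large_words d" and ?Q = "stopping_words N S d"
    have GW: "?G \<subseteq> all_words" by (auto simp: large_words_def)
    have finG: "finite ?G" and finQ: "finite ?Q"
      using finite_large_words finite_stopping_words d by auto
    have bG: "bounded (word_map S w ` C)" if "w \<in> ?G" for w
      using that GW bC by (intro bounded_word_map_image) auto
    have bQ: "bounded (word_map S w ` ?X)" if "w \<in> ?Q" for w
      using that stopping_words_subset[of d] by (intro bounded_word_map_image) auto
    let ?A = "\<Union>w\<in>?G. word_map S w ` C" and ?B = "\<Union>w\<in>?Q. word_map S w ` ?X"
    have bAB: "bounded ?A" "bounded ?B" using finG finQ bG bQ by (auto intro!: bounded_UN)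
    have "covering_number d (closure (orbit C)) \<le> covering_number d (orbit C)"
      by (rule covering_number_closure[OF bO d(1)])
    also have "\<dots> \<le> covering_number d (?A \<union> ?B)"
      using bAB by (intro covering_number_mono orbit_subset_large_stopping inv C(1) d) auto
    also have "\<dots> \<le> covering_number d ?A + covering_number d ?B"
      by (intro covering_number_Un bAB d(1))
    also have "\<dots> \<le> (\<Sum>w\<in>?G. covering_number d (word_map S w ` C)) + (\<Sum>w\<in>?Q. covering_number d (word_map S w ` ?X))"
      by (intro add_mono covering_number_UN finG finQ bG bQ d(1))
    finally have "real (covering_number d (closure (orbit C)))
      \<le> real ((\<Sum>w\<in>?G. covering_number d (word_map S w ` C)) + (\<Sum>w\<in>?Q. covering_number d (word_map S w ` ?X)))"
      by (rule of_nat_mono)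
    also have "\<dots> = (\<Sum>w\<in>?G. real (covering_number d (word_map S w ` C))) + (\<Sum>w\<in>?Q. real (covering_number d (word_map S w ` ?X)))"
      by (simp only: of_nat_add of_nat_sum)
    also have "\<dots> \<le> (\<Sum>w\<in>?G. K1 * d powr (- B) * weight B w) + (\<Sum>w\<in>?Q. K2 * d powr (- B) * weight B w)"
      unfolding K1_def K2_def
      by (intro add_mono sum_mono covering_number_large_word_le covering_number_stopping_word_le d(1) bC B K(2) r)
    also have "\<dots> = K1 * d powr (- B) * (\<Sum>w\<in>?G. weight B w) + K2 * d powr (- B) * (\<Sum>w\<in>?Q. weight B w)"
      by (simp only: sum_distrib_left)
    also have "\<dots> \<le> K1 * d powr (- B) * M + K2 * d powr (- B) * M"
      using K12 by (intro add_mono mult_left_mono M(2) finG finQ GW stopping_words_subset) auto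
    finally show ?thesis by (simp add: algebra_simps)
  qed
  moreover have "bounded (closure (orbit C))" using bO by (rule bounded_closure)
  moreover have "closure (orbit C) \<noteq> {}" using C(2) condensation_subset_orbit[of C] by auto
  moreover have "(K1 + K2) * M > 0" using K12 M(1) by simp
  ultimately show ?thesis by (intro upper_box_dim_le)
qed

section \<open>The lower bound\<close>

lemma inj_map: "i \<in> {1..N} \<Longrightarrow> inj (S i)"
proof -
  assume "i \<in> {1..N}"
  then obtain A b where A: "invertible A" "S i = (\<lambda>x. A *v x + b)" using ifs unfolding affine_IFS_def by blast
  have "inj ((*v) A)" using inj_matrix_vector_mult[OF A(1)] .
  thus ?thesis unfolding A(2) inj_def by simp
qed

text \<open>
  At the first letter where the two words differ the images of U are disjoint; the common prefix is injective and
  the remaining letters map U into itself.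
\<close>

lemma incomparable_images_disjoint:
  assumes U: "\<And>i. i \<in> {1..N} \<Longrightarrow> S i ` U \<subseteq> U"
    and disj: "\<And>i j. i \<in> {1..N} \<Longrightarrow> j \<in> {1..N} \<Longrightarrow> i \<noteq> j \<Longrightarrow> S i ` U \<inter> S j ` U = {}"
    and "u \<in> all_words" "v \<in> all_words" "\<And>x. v \<noteq> u @ x" "\<And>x. u \<noteq> v @ x"
  shows "word_map S u ` U \<inter> word_map S v ` U = {}"
  using assms(3-)
proof (induction u arbitrary: v)
  case Nil
  thus ?case by (metis append_Nil)
next
  case (Cons i u)
  obtain j v' where v: "v = j # v'" using Cons.prems(3) by (metis append_Nil neq_Nil_conv)
  have ij: "i \<in> {1..N}" "j \<in> {1..N}" "u \<in> all_words" "v' \<in> all_words"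
    using Cons.hyps Cons.prems(1) v by simp_all
  have im: "word_map S (k # x) ` U = S k ` (word_map S x ` U)" for k x by (simp add: image_comp)
  show ?case
  proof (cases "i = j")
    case True
    have "word_map S u ` U \<inter> word_map S v' ` U = {}"
      using Cons.prems v True ij by (intro Cons.IH) auto
    hence "S i ` (word_map S u ` U) \<inter> S i ` (word_map S v' ` U) = {}"
      using image_Int[OF inj_map[OF ij(1)], of "word_map S u ` U" "word_map S v' ` U"] by simp
    thus ?thesis unfolding v im using True by simp
  next
    case False
    have "S i ` (word_map S u ` U) \<subseteq> S i ` U" "S j ` (word_map S v' ` U) \<subseteq> S j ` U"
      by (intro image_mono word_map_image_subset U ij; assumption)+
    thus ?thesis unfolding v im using disj[OF ij(1,2) False] by blast
  qed
qed

lemma ball_subset_word_map_image: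
  assumes w: "w \<in> all_words" and U: "ball c e \<subseteq> U"
  shows "ball (word_map S w c) (smin w * e) \<subseteq> word_map S w ` U"
proof
  fix y assume y: "y \<in> ball (word_map S w c) (smin w * e)"
  obtain A' where A': "lin w ** A' = mat 1" using invertible_lin[OF w] by (auto simp: invertible_def)
  define x where "x = A' *v (y - word_map S w 0)"
  have "lin w *v x = y - word_map S w 0" by (simp add: x_def matrix_vector_mul_assoc A')
  hence x: "word_map S w x = y" using fun_cong[OF word_map_eq[OF w], of x] by simp
  have "smin w * norm (c - x) \<le> norm (lin w *v (c - x))"
    by (rule norm_matrix_bounds[OF invertible_lin[OF w]])
  also have "\<dots> = norm (word_map S w c - y)" using word_map_diff[OF w, of c x] x by simp
  also have "\<dots> < smin w * e" using y by (simp add: dist_norm)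
  finally have "norm (c - x) < e" using smin_pos[OF w] by simp
  hence "x \<in> U" using U by (auto simp: dist_norm)
  thus "y \<in> word_map S w ` U" using x by blast
qed

text \<open>
  C has a neighbourhood of some radius h inside U. Its image under a stopping word contains a neighbourhood of radius
  \<alpha>_n h, of order d, of the image of C, and the images of U under different stopping words are disjoint.
\<close>

lemma stopping_images_separated:
  assumes cosc: "COSC N S C" and C: "compact C" "C \<noteq> {}"
  obtains e where "e > 0"
    "\<And>d u v x y. 0 < d \<Longrightarrow> u \<in> stopping_words N S d \<Longrightarrow> v \<in> stopping_words N S d \<Longrightarrow> u \<noteq> v \<Longrightarrow>
       x \<in> word_map S u ` C \<Longrightarrow> y \<in> word_map S v ` C \<Longrightarrow> e * d \<le> norm (x - y)"
proof -
  obtain U where U: "open U" "C \<subseteq> U" "\<And>i. i \<in> {1..N} \<Longrightarrow> S i ` U \<subseteq> U"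
    "\<And>i j. i \<in> {1..N} \<Longrightarrow> j \<in> {1..N} \<Longrightarrow> i \<noteq> j \<Longrightarrow> S i ` U \<inter> S j ` U = {}"
  proof -
    from cosc obtain U where "open U" "C \<subseteq> U - (\<Union>i\<in>{1..N}. closure (S i ` U))"
      "\<forall>i\<in>{1..N}. S i ` U \<subseteq> U" "\<forall>i\<in>{1..N}. \<forall>j\<in>{1..N}. i \<noteq> j \<longrightarrow> S i ` U \<inter> S j ` U = {}"
      unfolding COSC_def by (elim exE conjE)
    thus thesis using that[of U] by auto
  qed
  obtain h where h: "h > 0" "(\<Union>c\<in>C. ball c h) \<subseteq> U"
    by (rule compact_subset_open_imp_ball_epsilon_subset[OF C(1) U(1,2)])
  show thesis
  proof (rule that[of "h * amin"])
    show "h * amin > 0" using h(1) amin_pos by simp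
    fix d u v x y
    assume d: "0 < (d::real)" and uv: "u \<in> stopping_words N S d" "v \<in> stopping_words N S d" "u \<noteq> v"
      and x: "x \<in> word_map S u ` C" and y: "y \<in> word_map S v ` C"
    have W: "u \<in> all_words" "v \<in> all_words" using uv stopping_words_subset by auto
    have disj: "word_map S u ` U \<inter> word_map S v ` U = {}"
      using stopping_words_not_prefix[OF uv] stopping_words_not_prefix[OF uv(2,1)] uv(3)
      by (intro incomparable_images_disjoint[OF U(3,4) W]) auto
    obtain c where c: "c \<in> C" "x = word_map S u c" using x by blast
    have "ball x (smin u * h) \<subseteq> word_map S u ` U"
      unfolding c(2) using h(2) c(1) by (intro ball_subset_word_map_image W) blast
    moreover have "y \<in> word_map S v ` U" using y U(2) by blast
    ultimately have "y \<notin> ball x (smin u * h)" using disj by blast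
    hence "smin u * h \<le> norm (x - y)" by (simp add: dist_norm not_less)
    moreover have "amin * d * h \<le> smin u * h"
      using smin_stopping_word_ge[OF uv(1)] h(1) by (intro mult_right_mono) auto
    ultimately show "h * amin * d \<le> norm (x - y)" by (simp add: mult_ac)
  qed
qed

lemma sum_stopping_weight_ge:
  assumes t: "0 \<le> t" "t < critical_exponent" and d: "0 < d" "d \<le> 1"
  shows "1 \<le> submult_const * (\<Sum>w\<in>stopping_words N S d. weight t w)"
proof (rule cut_set_weight_ge[OF t(1) not_summable_below_critical[OF t]])
  show "finite (stopping_words N S d)" "finite (large_words d)"
    by (intro finite_stopping_words finite_large_words d)+
  show "large_words d \<subseteq> all_words" by (auto simp: large_words_def)
qed (intro stopping_words_subset large_or_stopping_prefix d; assumption)+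

text \<open>
  The images of C under the stopping words at scale d are separated by a multiple of d, so at a slightly smaller
  scale a d their covering numbers add up. Each of them is at least \<kappa> times that of an ellipsoid, hence at least a
  constant times d^(-t) \<phi>^t, and the sum of \<phi>^t over the stopping words is bounded below.
\<close>

theorem lower_box_dim_orbit_ge:
  assumes cosc: "COSC N S C" and C: "compact C" "C \<noteq> {}" and r: "r > 0"
    and kappa: "\<kappa> > 0"
      "\<And>d w. 0 < d \<Longrightarrow> d \<le> 1 \<Longrightarrow> w \<in> stopping_words N S d \<Longrightarrow>
         \<kappa> * real (covering_number d (word_map S w ` cball z r)) \<le> real (covering_number d (word_map S w ` C))"
    and F: "orbit C \<subseteq> F" "bounded F"
    and t: "0 \<le> t" "t \<le> real CARD('n)" "t < critical_exponent"
  shows "ereal t \<le> lower_box_dim F"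
proof -
  let ?n = "real CARD('n)"
  obtain e where e: "e > 0"
    "\<And>d u v x y. 0 < d \<Longrightarrow> u \<in> stopping_words N S d \<Longrightarrow> v \<in> stopping_words N S d \<Longrightarrow> u \<noteq> v \<Longrightarrow>
       x \<in> word_map S u ` C \<Longrightarrow> y \<in> word_map S v ` C \<Longrightarrow> e * d \<le> norm (x - y)"
    using stopping_images_separated[OF cosc C] by blast
  \<comment> \<open>Cubes of side a d have diameter at most n a d, which is less than the distance e d of the pieces.\<close>
  define a where "a = min 1 (e / (2 * ?n))"
  have n0: "?n > 0" by simp
  have a: "0 < a" "a \<le> 1" using e(1) n0 by (auto simp: a_def)
  have "a \<le> e / (2 * ?n)" by (simp add: a_def)
  hence "?n * a \<le> e / 2" using n0 by (simp add: field_simps)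
  hence an: "?n * a < e" using e(1) by linarith
  define K where "K = max 1 (1 / r) ^ CARD('n) * (?n * (?n + 1)) ^ CARD('n)"
  have K: "K > 0" unfolding K_def using n0 by (intro mult_pos_pos zero_less_power) auto
  define L where "L = \<kappa> / (K * submult_const)"
  have L: "L > 0" using kappa(1) K submult_const_ge_1 by (simp add: L_def)
  have main: "L * d powr (- t) \<le> real (covering_number (a * d) F)" if d: "0 < d" "d \<le> 1" for d
  proof -
    let ?Q = "stopping_words N S d"
    have ad: "0 < a * d" "a * d \<le> d" using a d by (auto simp: mult_le_cancel_right1)
    have QW: "w \<in> all_words" if "w \<in> ?Q" for w using that stopping_words_subset[of d] by blast
    have sub: "(\<Union>w\<in>?Q. word_map S w ` C) \<subseteq> F" using F(1) QW unfolding orbit_def by blast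
    have bC: "bounded C" using C(1) by (rule compact_imp_bounded)
    have each: "\<kappa> / K * d powr (- t) * weight t w \<le> real (covering_number (a * d) (word_map S w ` C))"
      if w: "w \<in> ?Q" for w
    proof -
      note W = QW[OF w]
      have "weight t w \<le> d powr t * ellipsoid_count (lin w) d"
        by (intro sv_function_le_ellipsoid_count invertible_lin W t d)
      also have "ellipsoid_count (lin w) d \<le> max 1 (1 / r) ^ CARD('n) * ellipsoid_count (lin w) (1 / r * d)"
        using r d by (intro ellipsoid_count_scale invertible_lin W) auto
      also have "1 / r * d = d / r" by simp
      also have "ellipsoid_count (lin w) (d / r)
         \<le> (?n * (?n + 1)) ^ CARD('n) * real (covering_number d (word_map S w ` cball z r))"
        unfolding word_map_image[OF W] by (intro covering_number_ellipsoid_ge invertible_lin W d r)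
      finally have "weight t w \<le> d powr t * (K * real (covering_number d (word_map S w ` cball z r)))"
        using d by (simp add: K_def mult_ac)
      hence "\<kappa> / K * d powr (- t) * weight t w
          \<le> \<kappa> / K * d powr (- t) * (d powr t * (K * real (covering_number d (word_map S w ` cball z r))))"
        using kappa(1) K by (intro mult_left_mono) auto
      also have "\<dots> = \<kappa> * real (covering_number d (word_map S w ` cball z r))"
        using d K by (simp add: powr_minus)
      also have "\<dots> \<le> real (covering_number d (word_map S w ` C))" by (rule kappa(2)[OF d w])
      also have "\<dots> \<le> real (covering_number (a * d) (word_map S w ` C))"
        using covering_number_antimono[OF bounded_word_map_image[OF W bC] ad] by simp
      finally show ?thesis .
    qed
    have "L * d powr (- t) = \<kappa> / K * d powr (- t) * (1 / submult_const)" by (simp add: L_def)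
    also have "1 / submult_const \<le> (\<Sum>w\<in>?Q. weight t w)"
      using sum_stopping_weight_ge[OF t(1,3) d] submult_const_ge_1 by (simp add: field_simps)
    hence "\<kappa> / K * d powr (- t) * (1 / submult_const) \<le> \<kappa> / K * d powr (- t) * (\<Sum>w\<in>?Q. weight t w)"
      using kappa(1) K by (intro mult_left_mono) auto
    also have "\<dots> = (\<Sum>w\<in>?Q. \<kappa> / K * d powr (- t) * weight t w)" by (simp only: sum_distrib_left)
    also have "\<dots> \<le> (\<Sum>w\<in>?Q. real (covering_number (a * d) (word_map S w ` C)))"
      by (intro sum_mono each)
    also have "\<dots> = real (\<Sum>w\<in>?Q. covering_number (a * d) (word_map S w ` C))" by (simp only: of_nat_sum)
    also have "\<dots> \<le> real (covering_number (a * d) (\<Union>w\<in>?Q. word_map S w ` C))"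
    proof (intro of_nat_mono sum_covering_number_separated_le finite_stopping_words d ad
        bounded_subset[OF F(2) sub])
      fix u v x y assume *: "u \<in> ?Q" "v \<in> ?Q" "u \<noteq> v" "x \<in> word_map S u ` C" "y \<in> word_map S v ` C"
      have "?n * (a * d) < e * d" using an d by (simp add: mult.assoc[symmetric])
      also have "\<dots> \<le> norm (x - y)" by (rule e(2)[OF d(1) *])
      finally show "?n * (a * d) < norm (x - y)" .
    qed
    also have "\<dots> \<le> real (covering_number (a * d) F)"
      by (intro of_nat_mono covering_number_mono sub F(2) ad)
    finally show ?thesis .
  qed
  show ?thesis
  proof (rule lower_box_dim_ge[of "L * a powr t" a])
    show "L * a powr t > 0" "a > 0" using L a by auto
    fix d :: real assume d: "0 < d" "d \<le> a"
    have "L * (d / a) powr (- t) \<le> real (covering_number (a * (d / a)) F)"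
      using d a by (intro main) auto
    moreover have "L * (d / a) powr (- t) = L * a powr t * d powr (- t)"
      using d a by (simp add: powr_divide powr_minus field_simps)
    ultimately show "L * a powr t * d powr (- t) \<le> real (covering_number d F)" using a by simp
  qed
qed

end

section \<open>The box dimensions of the inhomogeneous set\<close>

theorem theorem2p3:
  fixes S :: "nat \<Rightarrow> real^'n \<Rightarrow> real^'n" and N :: nat
    and C X :: "(real^'n) set" and z :: "real^'n" and r s \<kappa> :: real
  assumes "affine_IFS N S"
    and "s = affinity_dimension N S"
    and "s \<le> real CARD('n)"
    and "C \<noteq> {}" and "compact C"
    and "COSC N S C"
    and "r > 0" and "X = cball z r"
    and "\<forall>i\<in>{1..N}. S i ` X \<subseteq> X"
    and "C \<subseteq> X"
    and "lower_box_dim C \<ge> ereal (real CARD('n) - 1)"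
    and "\<kappa> > 0"
    and "\<forall>\<delta>\<in>{0<..1}. \<forall>w\<in>stopping_words N S \<delta>.
           real (covering_number \<delta> (word_map S w ` C))
             \<ge> \<kappa> * real (covering_number \<delta> (word_map S w ` X))"
  shows "upper_box_dim (inhomogeneous_set N S C) = max (ereal s) (upper_box_dim C) \<and>
         max (ereal s) (lower_box_dim C) \<le> lower_box_dim (inhomogeneous_set N S C) \<and>
         lower_box_dim (inhomogeneous_set N S C) \<le> max (ereal s) (upper_box_dim C)"
proof -
  interpret contracting_affine_IFS N S by unfold_locales (rule assms(1))
  let ?n = "real CARD('n)" and ?F = "inhomogeneous_set N S C"
  have s: "s = critical_exponent" using assms(2) affinity_dimension_eq by simp
  have inv: "\<And>i. i \<in> {1..N} \<Longrightarrow> S i ` cball z r \<subseteq> cball z r" using assms(8,9) by blast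
  have CX: "C \<subseteq> cball z r" using assms(8,10) by simp
  have bO: "bounded (orbit C)" using orbit_subset[OF inv CX] bounded_cball bounded_subset by blast
  have F: "?F = closure (orbit C)" by (rule inhomogeneous_set_eq[OF assms(4,5) bO])
  have bF: "bounded ?F" unfolding F using bO by (rule bounded_closure)
  have OF: "orbit C \<subseteq> ?F" unfolding F by (rule closure_subset)
  have CF: "C \<subseteq> ?F" using OF condensation_subset_orbit[of C] by blast
  have neF: "?F \<noteq> {}" using CF assms(4) by blast
  have nU: "ereal (?n - 1) \<le> upper_box_dim C"
    using assms(11) lower_le_upper_box_dim[of C] by (rule order_trans)
  have upper: "upper_box_dim ?F \<le> max (ereal s) (upper_box_dim C)"
  proof (rule dense_ge)
    fix b assume b: "max (ereal s) (upper_box_dim C) < b"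
    show "upper_box_dim ?F \<le> b"
    proof (cases b)
      case (real B)
      show ?thesis
      proof (cases "B \<le> ?n")
        case True
        \<comment> \<open>Here the lower bound on the dimension of C enters: it puts B into the range n - 1 \<le> B \<le> n.\<close>
        have "ereal (?n - 1) < ereal B" using nU b real by (simp only: max_less_iff_conj) (metis le_less_trans)
        thus ?thesis unfolding F real using b real s
          by (intro upper_box_dim_orbit_le[OF inv assms(7) CX assms(4) _ True]) auto
      next
        case False
        have "upper_box_dim ?F \<le> ereal ?n" by (rule upper_box_dim_le_dimension[OF bF neF])
        also have "\<dots> \<le> b" using False real by simp
        finally show ?thesis .
      qed
    qed (use b in auto)
  qed
  have sF: "ereal s \<le> lower_box_dim ?F"
  proof (cases "s \<le> ?n - 1")
    case True
    hence "ereal s \<le> ereal (?n - 1)" by simp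
    also have "\<dots> \<le> lower_box_dim ?F"
      using assms(11) box_dim_mono(2)[OF CF bF assms(4)] by (rule order_trans)
    finally show ?thesis .
  next
    case False
    show ?thesis
    proof (rule dense_le)
      fix b assume b: "b < ereal s"
      show "b \<le> lower_box_dim ?F"
      proof (cases b)
        case (real t)
        \<comment> \<open>Increasing t only strengthens the claim, and n - 1 is a non-negative number below s.\<close>
        define t' where "t' = max t (?n - 1)"
        have n1: "?n \<ge> 1" by (simp add: Suc_le_eq)
        have "0 \<le> ?n - 1" using n1 by linarith
        hence t': "t \<le> t'" "0 \<le> t'" "t' < s" using b real False by (auto simp: t'_def le_max_iff_disj)
        have "b \<le> ereal t'" using real t'(1) by simp
        also have "ereal t' \<le> lower_box_dim ?F"
        proof (rule lower_box_dim_orbit_ge[OF assms(6,5,4,7,12) _ OF bF t'(2)])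
          show "\<kappa> * real (covering_number d (word_map S w ` cball z r)) \<le> real (covering_number d (word_map S w ` C))"
            if "0 < d" "d \<le> 1" "w \<in> stopping_words N S d" for d w
            using assms(13) that assms(8) by simp
        qed (use t' s assms(3) in auto)
        finally show ?thesis .
      qed (use b in auto)
    qed
  qed
  have "max (ereal s) (upper_box_dim C) \<le> upper_box_dim ?F"
    using sF lower_le_upper_box_dim[of ?F] box_dim_mono(1)[OF CF bF assms(4)]
    by (auto intro: order_trans)
  moreover have "max (ereal s) (lower_box_dim C) \<le> lower_box_dim ?F"
    using sF box_dim_mono(2)[OF CF bF assms(4)] by simp
  moreover have "lower_box_dim ?F \<le> max (ereal s) (upper_box_dim C)"
    using lower_le_upper_box_dim[of ?F] upper by (rule order_trans)
  ultimately show ?thesis using upper by (auto intro: antisym)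
qed

end
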